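(* Let $F$ be a nonreal field with $\mathrm{char}\,F\ne2$ and $u(F)<\infty$. Let $\alpha\in\mathrm{Br}_2(F)$ with $\mathrm{ind}\,\alpha=8$. Then $$u^+(\alpha)\le\Big\lfloor\tfrac{87}{64}u(F)\Big\rfloor+\Big\lfloor\tfrac{63}{32}u(F)\Big\rfloor\le\tfrac{213}{64}u(F).$$
   Context: A field $F$ is nonreal if $-1$ is a sum of squares; then $u(F)$ is the supremum of dimensions of anisotropic quadratic forms over $F$. $\mathrm{Br}_2(F)$ is the $2$-torsion of the Brauer group. For $\alpha\in\mathrm{Br}_2(F)$ with $D$ the division algebra of class $\alpha$, $u^+(\alpha)$ is the supremum of the ranks (= $\dim_D V$) of anisotropic hermitian forms over $(D,\gamma)$ for any orthogonal involution $\gamma$ on $D$ (independent of the choice); here a hermitian form over $(D,\gamma)$ is a biadditive $h:V\times V\to D$ with $h(v\alpha,w\beta)=\gamma(\alpha)h(v,w)\beta$ and $h(w,v)=\gamma(h(v,w))$, anisotropic if $h(v,v)\ne0$ for $v\ne0$, and an $F$-linear involution is orthogonal if over a splitting field it is adjoint to a symmetric (non-alternating) bilinear form. *)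

theory Defs
  imports "HOL-Analysis.Analysis" "HOL-Library.Extended_Nat"
begin

definition qf_eval :: "nat \<Rightarrow> (nat \<Rightarrow> nat \<Rightarrow> 'a::field) \<Rightarrow> (nat \<Rightarrow> 'a) \<Rightarrow> 'a" where
  "qf_eval n a x = (\<Sum>i<n. \<Sum>j<n. a i j * x i * x j)"

definition anisotropic_qf :: "nat \<Rightarrow> (nat \<Rightarrow> nat \<Rightarrow> 'a::field) \<Rightarrow> bool" where
  "anisotropic_qf n a \<longleftrightarrow> (\<forall>x. qf_eval n a x = 0 \<longrightarrow> (\<forall>i<n. x i = 0))"

definition u_inv :: "'a::field itself \<Rightarrow> enat" where
  "u_inv _ = Sup {enat n | n. \<exists>a :: nat \<Rightarrow> nat \<Rightarrow> 'a. anisotropic_qf n a}"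

definition nonreal_field :: "'a::field itself \<Rightarrow> bool" where
  "nonreal_field _ \<longleftrightarrow> (\<exists>(x :: nat \<Rightarrow> 'a) m. (\<Sum>i<m. x i ^ 2) = - 1)"

definition central_algebra_hom :: "('a::field \<Rightarrow> 'd::division_ring) \<Rightarrow> bool" where
  "central_algebra_hom \<iota> \<longleftrightarrow>
     \<iota> 1 = 1 \<and> (\<forall>x y. \<iota> (x + y) = \<iota> x + \<iota> y) \<and> (\<forall>x y. \<iota> (x * y) = \<iota> x * \<iota> y) \<and>
     {z. \<forall>d. z * d = d * z} = range \<iota>"

definition algebra_dim :: "('a::field \<Rightarrow> 'd::division_ring) \<Rightarrow> nat \<Rightarrow> bool" where
  "algebra_dim \<iota> m \<longleftrightarrow> (\<exists>e :: nat \<Rightarrow> 'd. \<forall>d. \<exists>!c :: nat \<Rightarrow> 'a.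
      (\<forall>i\<ge>m. c i = 0) \<and> d = (\<Sum>i<m. \<iota> (c i) * e i))"

text \<open>Central division F-algebra of degree 8 (index 8), i.e. of dimension 64.\<close>
definition central_division_algebra_deg8 :: "('a::field \<Rightarrow> 'd::division_ring) \<Rightarrow> bool" where
  "central_division_algebra_deg8 \<iota> \<longleftrightarrow> central_algebra_hom \<iota> \<and> algebra_dim \<iota> 64"

definition F_linear_involution :: "('a::field \<Rightarrow> 'd::division_ring) \<Rightarrow> ('d \<Rightarrow> 'd) \<Rightarrow> bool" where
  "F_linear_involution \<iota> \<gamma> \<longleftrightarrow>
     (\<forall>x y. \<gamma> (x + y) = \<gamma> x + \<gamma> y) \<and> (\<forall>x y. \<gamma> (x * y) = \<gamma> y * \<gamma> x) \<and>
     (\<forall>x. \<gamma> (\<gamma> x) = x) \<and> (\<forall>c x. \<gamma> (\<iota> c * x) = \<iota> c * \<gamma> x)"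

text \<open>A splitting of D (of degree 8) over an extension field K of F (embedded by kappa):
  an F-algebra homomorphism phi : D -> M_8(K) whose K-span is all of M_8(K), i.e. the
  induced map D (x)_F K -> M_8(K) is a K-algebra isomorphism.\<close>
definition splitting_deg8 ::
  "('a::field \<Rightarrow> 'd::division_ring) \<Rightarrow> ('a \<Rightarrow> 'k::field) \<Rightarrow> ('d \<Rightarrow> 'k^8^8) \<Rightarrow> bool" where
  "splitting_deg8 \<iota> \<kappa> \<phi> \<longleftrightarrow>
     \<kappa> 1 = 1 \<and> (\<forall>x y. \<kappa> (x + y) = \<kappa> x + \<kappa> y) \<and> (\<forall>x y. \<kappa> (x * y) = \<kappa> x * \<kappa> y) \<and>
     (\<forall>x y. \<phi> (x + y) = \<phi> x + \<phi> y) \<and> (\<forall>x y. \<phi> (x * y) = \<phi> x ** \<phi> y) \<and>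
     (\<forall>c. \<phi> (\<iota> c) = mat (\<kappa> c)) \<and>
     (\<forall>M :: 'k^8^8. \<exists>N (k :: nat \<Rightarrow> 'k) (d :: nat \<Rightarrow> 'd). M = (\<Sum>i<N. mat (k i) ** \<phi> (d i)))"

text \<open>gamma is orthogonal (w.r.t. the splitting phi): after extending scalars, gamma is the
  adjoint involution of a nondegenerate symmetric bilinear form b(x,y) = x^T S y,
  i.e. phi(gamma d) = S^{-1} phi(d)^T S.\<close>
definition orthogonal_wrt ::
  "('d::division_ring \<Rightarrow> 'k::field^8^8) \<Rightarrow> ('d \<Rightarrow> 'd) \<Rightarrow> bool" where
  "orthogonal_wrt \<phi> \<gamma> \<longleftrightarrow> (\<exists>S :: 'k^8^8. transpose S = S \<and> invertible S \<and>
     (\<forall>d. \<phi> (\<gamma> d) = matrix_inv S ** transpose (\<phi> d) ** S))"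

text \<open>The right D-vector space D^n, realised as functions nat => D vanishing from n on;
  right scalar multiplication is componentwise (v a)_i = v_i * a.\<close>
definition Dspace :: "nat \<Rightarrow> (nat \<Rightarrow> 'd::division_ring) set" where
  "Dspace n = {v. \<forall>i\<ge>n. v i = 0}"

definition hermitian_form ::
  "('d::division_ring \<Rightarrow> 'd) \<Rightarrow> nat \<Rightarrow> ((nat \<Rightarrow> 'd) \<Rightarrow> (nat \<Rightarrow> 'd) \<Rightarrow> 'd) \<Rightarrow> bool" where
  "hermitian_form \<gamma> n h \<longleftrightarrow>
     (\<forall>v\<in>Dspace n. \<forall>v'\<in>Dspace n. \<forall>w\<in>Dspace n.
        h (\<lambda>i. v i + v' i) w = h v w + h v' w \<and> h w (\<lambda>i. v i + v' i) = h w v + h w v') \<and>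
     (\<forall>v\<in>Dspace n. \<forall>w\<in>Dspace n. \<forall>a b.
        h (\<lambda>i. v i * a) (\<lambda>i. w i * b) = \<gamma> a * h v w * b) \<and>
     (\<forall>v\<in>Dspace n. \<forall>w\<in>Dspace n. h w v = \<gamma> (h v w))"

definition anisotropic_hermitian ::
  "('d::division_ring \<Rightarrow> 'd) \<Rightarrow> nat \<Rightarrow> ((nat \<Rightarrow> 'd) \<Rightarrow> (nat \<Rightarrow> 'd) \<Rightarrow> 'd) \<Rightarrow> bool" where
  "anisotropic_hermitian \<gamma> n h \<longleftrightarrow> hermitian_form \<gamma> n h \<and>
     (\<forall>v\<in>Dspace n. v \<noteq> (\<lambda>_. 0) \<longrightarrow> h v v \<noteq> 0)"

text \<open>u^+ computed with the orthogonal involution gamma on D (independent of gamma).\<close>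
definition u_plus :: "('d::division_ring \<Rightarrow> 'd) \<Rightarrow> enat" where
  "u_plus \<gamma> = Sup {enat n | n. \<exists>h. anisotropic_hermitian \<gamma> n h}"

end

theory Submission
  imports Defs "HOL-Algebra.Algebraic_Closure_Type" "HOL-Library.Function_Algebras" "HOL-Library.Set_Algebras"
begin

text \<open>
  First, \<open>D\<close> contains a biquadratic field \<open>F(i, j)\<close> with \<open>i\<^sup>2, j\<^sup>2 \<in> F\<close>. For a symplectic involution on
  \<open>D\<close> there are at least 36 dimensions of skew elements, so a symmetric \<open>s\<close> commutes with at least 8
  of them. Choose a field \<open>E\<close> maximal among the extensions of \<open>F\<close> in an algebraically closed field
  for which \<open>D\<^sub>E\<close> remains a division algebra without symmetric elements of degree 2. A descent along
  quadratic extensions shows that \<open>E\<close> is quadratically closed; then three quadratic forms on the skew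
  elements commuting with \<open>s\<close> have a common zero, which is an element of degree 2 of \<open>D\<^sub>E\<close>, a
  contradiction. So \<open>D\<close> itself contains \<open>i\<close>, and \<open>j\<close> is found in the centralizer of \<open>i\<close>.

  After conjugating \<open>\<gamma>\<close> into an orthogonal involution \<open>\<sigma>\<close> fixing \<open>i\<close> and \<open>j\<close>, the trace turns a
  hermitian form into a symmetric \<open>F\<close>-bilinear form \<open>\<beta>\<close> with \<open>\<beta> (v d) w = \<beta> v (w \<sigma>(d))\<close>, and \<open>v\<close> is
  isotropic iff \<open>\<beta> (v x) v = 0\<close> for all \<open>x \<in> D\<close>. This system of quadratic forms is solved in layers: if
  the forms with \<open>x \<in> B e\<close> have a common zero on every \<open>B\<close>-subspace of \<open>F\<close>-dimension more than \<open>c\<close>, then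
  a \<open>B\<close>-subspace of dimension more than \<open>c + 2 c'\<close> has a \<open>B\<close>-subspace of dimension more than \<open>c'\<close> on
  which all of them vanish. Let \<open>Q\<close> be the centralizer of \<open>F(i, j)\<close> and \<open>D = Q + Q w\<^sub>1 + Q w\<^sub>2 + Q w\<^sub>3\<close> the
  decomposition under conjugation by \<open>i\<close> and \<open>j\<close>. The layers give \<open>45u\<close> for \<open>Q\<close> and \<open>21u\<close> for each
  \<open>Q w\<^sub>k\<close>, hence \<open>45u + 2 \<cdot> 21u = 87u\<close> for the centralizer \<open>Q + Q w\<^sub>1\<close> of \<open>i\<close> and \<open>63u\<close> for
  \<open>Q w\<^sub>2 + Q w\<^sub>3\<close>. Since \<open>D\<^sup>n\<close> has \<open>F\<close>-dimension \<open>64n\<close> and subspaces over the centralizer of \<open>i\<close> have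
  dimension divisible by \<open>32\<close>, the bound follows.
\<close>

section \<open>Division subrings\<close>

definition division_subring :: "'r::ring_1 set \<Rightarrow> bool" where
  "division_subring B \<longleftrightarrow> 1 \<in> B \<and> (\<forall>x\<in>B. \<forall>y\<in>B. x - y \<in> B \<and> x * y \<in> B) \<and>
     (\<forall>x\<in>B. x \<noteq> 0 \<longrightarrow> (\<exists>y\<in>B. x * y = 1 \<and> y * x = 1))"

lemma division_subring_one: "division_subring B \<Longrightarrow> 1 \<in> B"
  and division_subring_diff: "division_subring B \<Longrightarrow> x \<in> B \<Longrightarrow> y \<in> B \<Longrightarrow> x - y \<in> B"
  and division_subring_mult: "division_subring B \<Longrightarrow> x \<in> B \<Longrightarrow> y \<in> B \<Longrightarrow> x * y \<in> B"
  unfolding division_subring_def by auto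

lemma division_subring_inverseE:
  assumes "division_subring B" "x \<in> B" "x \<noteq> 0"
  obtains y where "y \<in> B" "x * y = 1" "y * x = 1"
  using assms unfolding division_subring_def by auto

lemma division_subring_zero: "division_subring B \<Longrightarrow> 0 \<in> B"
  using division_subring_diff[of B 1 1] division_subring_one[of B] by simp

lemma division_subring_minus: "division_subring B \<Longrightarrow> x \<in> B \<Longrightarrow> - x \<in> B"
  using division_subring_diff[of B 0 x] division_subring_zero[of B] by simp

lemma division_subring_add: "division_subring B \<Longrightarrow> x \<in> B \<Longrightarrow> y \<in> B \<Longrightarrow> x + y \<in> B"
  using division_subring_diff[of B x "- y"] division_subring_minus[of B y] by simp

lemmas division_subring_closed = division_subring_zero division_subring_one division_subring_add
  division_subring_diff division_subring_minus division_subring_mult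

lemma division_subring_diff_cancel:
  assumes "division_subring B" "x - y \<in> B" "y \<in> B" shows "x \<in> B"
  using division_subring_add[OF assms] by simp

lemma division_subring_mult_eq_0:
  assumes "division_subring B" "x \<in> B" "x \<noteq> 0"
  shows "x * y = 0 \<Longrightarrow> y = 0" and "y * x = 0 \<Longrightarrow> y = 0"
proof -
  obtain z where z: "x * z = 1" "z * x = 1" using division_subring_inverseE[OF assms] .
  show "y = 0" if "x * y = 0"
  proof -
    have "y = z * (x * y)" using z by (simp flip: mult.assoc)
    then show ?thesis using that by simp
  qed
  show "y = 0" if "y * x = 0"
  proof -
    have "y = (y * x) * z" using z by (simp add: mult.assoc)
    then show ?thesis using that by simp
  qed
qed

lemma division_subring_UNIV: "division_subring (UNIV :: 'd::division_ring set)"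
proof -
  have "\<exists>y. x * y = 1 \<and> y * x = 1" if "x \<noteq> 0" for x :: 'd
    using that by (intro exI[of _ "inverse x"]) simp
  then show ?thesis unfolding division_subring_def by simp
qed

lemma division_subring_inverse:
  fixes x :: "'d::division_ring"
  assumes "division_subring B" "x \<in> B" shows "inverse x \<in> B"
proof (cases "x = 0")
  case False
  then show ?thesis using division_subring_inverseE[OF assms] inverse_unique by metis
qed (simp add: division_subring_zero assms)

lemma division_subring_Inter:
  assumes ne: "\<B> \<noteq> {}" and div: "\<And>B. B \<in> \<B> \<Longrightarrow> division_subring B"
  shows "division_subring (\<Inter>\<B>)"
  unfolding division_subring_def
proof (intro conjI ballI impI)
  fix x assume x: "x \<in> \<Inter>\<B>"
  show "\<exists>y\<in>\<Inter>\<B>. x * y = 1 \<and> y * x = 1" if "x \<noteq> 0"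
  proof -
    obtain B where "B \<in> \<B>" using ne by blast
    then obtain y where y: "x * y = 1" "y * x = 1" using division_subring_inverseE[OF div] x \<open>x \<noteq> 0\<close> by blast
    have "y \<in> C" if C: "C \<in> \<B>" for C
    proof -
      obtain z where z: "z \<in> C" "x * z = 1" using division_subring_inverseE[OF div[OF C]] x \<open>x \<noteq> 0\<close> C by blast
      have "y = y * (x * z)" using z by simp
      also have "\<dots> = z" using y by (simp flip: mult.assoc)
      finally show ?thesis using z by simp
    qed
    then show ?thesis using y by blast
  qed
qed (use div in \<open>auto intro: division_subring_closed\<close>)

lemma division_subring_Union_chain:
  assumes ne: "\<C> \<noteq> {}" and chain: "subset.chain UNIV \<C>" and div: "\<And>B. B \<in> \<C> \<Longrightarrow> division_subring B"
  shows "division_subring (\<Union>\<C>)"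
  unfolding division_subring_def
proof (intro conjI ballI impI)
  show "1 \<in> \<Union>\<C>" using ne div division_subring_one by blast
  fix x assume x: "x \<in> \<Union>\<C>"
  then show "\<exists>y\<in>\<Union>\<C>. x * y = 1 \<and> y * x = 1" if "x \<noteq> 0"
    using that div division_subring_inverseE by (metis UnionE UnionI)
  fix y assume "y \<in> \<Union>\<C>"
  then obtain B where "B \<in> \<C>" "x \<in> B" "y \<in> B"
    using finite_subset_Union_chain[of "{x, y}" \<C>] ne chain x by auto
  then show "x - y \<in> \<Union>\<C>" "x * y \<in> \<Union>\<C>" using div by (meson UnionI division_subring_closed)+
qed

lemma commutes_diff: "(x::'r::ring_1) * z = z * x \<Longrightarrow> y * z = z * y \<Longrightarrow> (x - y) * z = z * (x - y)"
  by (simp add: algebra_simps)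

lemma commutes_add: "(x::'r::ring_1) * z = z * x \<Longrightarrow> y * z = z * y \<Longrightarrow> (x + y) * z = z * (x + y)"
  by (simp add: algebra_simps)

lemma commutes_mult: "(x::'r::ring_1) * z = z * x \<Longrightarrow> y * z = z * y \<Longrightarrow> x * y * z = z * (x * y)"
  by (metis mult.assoc)

locale unital_ring_hom =
  fixes f :: "'a::ring_1 \<Rightarrow> 'b::ring_1"
  assumes hom_one: "f 1 = 1"
    and hom_add: "f (x + y) = f x + f y"
    and hom_mult: "f (x * y) = f x * f y"
begin

lemma hom_zero: "f 0 = 0"
  using hom_add[of 0 0] by simp

lemma hom_diff: "f (x - y) = f x - f y"
  using hom_add[of "x - y" y] by simp

lemma hom_minus: "f (- x) = - f x"
  using hom_diff[of 0 x] by (simp add: hom_zero)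

lemma hom_sum: "f (sum g I) = (\<Sum>i\<in>I. f (g i))"
  by (induction I rule: infinite_finite_induct) (auto simp: hom_zero hom_add)

lemma division_subring_image:
  assumes "division_subring E" shows "division_subring (f ` E)"
  unfolding division_subring_def
proof (intro conjI ballI impI)
  show "1 \<in> f ` E" using division_subring_one[OF assms] hom_one by (metis imageI)
  fix x assume "x \<in> f ` E"
  then obtain e where e: "e \<in> E" "x = f e" by blast
  show "\<exists>y\<in>f ` E. x * y = 1 \<and> y * x = 1" if "x \<noteq> 0"
  proof -
    have "e \<noteq> 0" using that e hom_zero by auto
    then obtain y where "y \<in> E" "e * y = 1" "y * e = 1" using division_subring_inverseE[OF assms e(1)] by metis
    then show ?thesis using e hom_one hom_mult by (metis imageI)
  qed
  fix y assume "y \<in> f ` E"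
  then obtain d where d: "d \<in> E" "y = f d" by blast
  show "x - y \<in> f ` E" unfolding e(2) d(2) hom_diff[symmetric]
    by (rule imageI) (rule division_subring_diff[OF assms e(1) d(1)])
  show "x * y \<in> f ` E" unfolding e(2) d(2) hom_mult[symmetric]
    by (rule imageI) (rule division_subring_mult[OF assms e(1) d(1)])
qed

end

locale division_ring_hom = unital_ring_hom f for f :: "'a::division_ring \<Rightarrow> 'b::ring_1"
begin

lemma hom_eq_0_iff: "f x = 0 \<longleftrightarrow> x = 0"
proof
  assume "f x = 0"
  show "x = 0"
  proof (rule ccontr)
    assume "x \<noteq> 0"
    then have "f x * f (inverse x) = 1" by (simp add: hom_one flip: hom_mult)
    then show False using \<open>f x = 0\<close> by simp
  qed
qed (simp add: hom_zero)

lemma hom_eq_iff: "f x = f y \<longleftrightarrow> x = y"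
  using hom_eq_0_iff[of "x - y"] by (simp add: hom_diff)

lemma hom_two_nonzero:
  assumes "(2::'a) \<noteq> 0" shows "(2::'b) \<noteq> 0"
proof -
  have "f 2 = 2" using hom_add[of 1 1] by (simp add: hom_one)
  then show ?thesis using assms hom_eq_0_iff[of 2] by simp
qed

end

section \<open>Dimension over division subrings\<close>

definition subspace_over :: "('v::ab_group_add \<Rightarrow> 'r::ring_1 \<Rightarrow> 'v) \<Rightarrow> 'r set \<Rightarrow> 'v set \<Rightarrow> bool" where
  "subspace_over act B W \<longleftrightarrow> 0 \<in> W \<and> (\<forall>v\<in>W. \<forall>w\<in>W. v + w \<in> W) \<and> (\<forall>v\<in>W. \<forall>b\<in>B. act v b \<in> W)"

definition adjoin :: "('v::ab_group_add \<Rightarrow> 'r::ring_1 \<Rightarrow> 'v) \<Rightarrow> 'r set \<Rightarrow> 'v set \<Rightarrow> 'v \<Rightarrow> 'v set" where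
  "adjoin act B W v = W + act v ` B"

text \<open>Dimension is read off from a complete flag, because division subrings and subspaces are plain sets here.\<close>

inductive has_dim :: "('v::ab_group_add \<Rightarrow> 'r::ring_1 \<Rightarrow> 'v) \<Rightarrow> 'r set \<Rightarrow> nat \<Rightarrow> 'v set \<Rightarrow> bool"
  for act :: "'v::ab_group_add \<Rightarrow> 'r::ring_1 \<Rightarrow> 'v" and B :: "'r set" where
  has_dim_0: "has_dim act B 0 {0}"
| has_dim_Suc: "has_dim act B n W \<Longrightarrow> v \<notin> W \<Longrightarrow> has_dim act B (Suc n) (adjoin act B W v)"

lemma adjoinI: "w \<in> W \<Longrightarrow> b \<in> B \<Longrightarrow> w + act v b \<in> adjoin act B W v"
  unfolding adjoin_def by blast

lemma adjoinE:
  assumes "x \<in> adjoin act B W v"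
  obtains w b where "x = w + act v b" "w \<in> W" "b \<in> B"
  using assms unfolding adjoin_def by (auto elim!: set_plus_elim)

lemma subspace_over_mono: "subspace_over act B W \<Longrightarrow> B' \<subseteq> B \<Longrightarrow> subspace_over act B' W"
  unfolding subspace_over_def by blast

lemma subspace_over_zero: "subspace_over act B W \<Longrightarrow> 0 \<in> W"
  and subspace_over_add: "subspace_over act B W \<Longrightarrow> v \<in> W \<Longrightarrow> w \<in> W \<Longrightarrow> v + w \<in> W"
  and subspace_over_act: "subspace_over act B W \<Longrightarrow> v \<in> W \<Longrightarrow> b \<in> B \<Longrightarrow> act v b \<in> W"
  unfolding subspace_over_def by auto

lemma subspace_over_sum: "subspace_over act B W \<Longrightarrow> (\<And>i. i \<in> I \<Longrightarrow> f i \<in> W) \<Longrightarrow> sum f I \<in> W"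
  by (induction I rule: infinite_finite_induct) (auto simp: subspace_over_zero subspace_over_add)

lemma subspace_over_Int: "subspace_over act B W \<Longrightarrow> subspace_over act B W' \<Longrightarrow> subspace_over act B (W \<inter> W')"
  unfolding subspace_over_def by blast

lemma subspace_over_set_plus_least:
  "subspace_over act B W \<Longrightarrow> U \<subseteq> W \<Longrightarrow> U' \<subseteq> W \<Longrightarrow> U + U' \<subseteq> W"
  unfolding subspace_over_def set_plus_def by blast

lemma has_dim_0_iff: "has_dim act B 0 W \<longleftrightarrow> W = {0}"
  by (subst has_dim.simps) auto

lemma has_dim_SucE:
  assumes "has_dim act B (Suc n) W"
  obtains W0 v where "W = adjoin act B W0 v" "has_dim act B n W0" "v \<notin> W0"
  using assms by (cases rule: has_dim.cases) auto

definition linear_over ::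
  "('v::ab_group_add \<Rightarrow> 'r::ring_1 \<Rightarrow> 'v) \<Rightarrow> ('w::ab_group_add \<Rightarrow> 'r \<Rightarrow> 'w) \<Rightarrow> 'r set \<Rightarrow> 'v set \<Rightarrow> ('v \<Rightarrow> 'w) \<Rightarrow> bool" where
  "linear_over act act' B W f \<longleftrightarrow>
     (\<forall>x\<in>W. \<forall>y\<in>W. f (x + y) = f x + f y) \<and> (\<forall>x\<in>W. \<forall>b\<in>B. f (act x b) = act' (f x) b)"

lemma linear_over_add: "linear_over act act' B W f \<Longrightarrow> x \<in> W \<Longrightarrow> y \<in> W \<Longrightarrow> f (x + y) = f x + f y"
  and linear_over_act: "linear_over act act' B W f \<Longrightarrow> x \<in> W \<Longrightarrow> b \<in> B \<Longrightarrow> f (act x b) = act' (f x) b"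
  unfolding linear_over_def by auto

lemma linear_over_subset: "linear_over act act' B W f \<Longrightarrow> U \<subseteq> W \<Longrightarrow> linear_over act act' B U f"
  unfolding linear_over_def by blast

lemma linear_over_zero: "linear_over act act' B W f \<Longrightarrow> subspace_over act B W \<Longrightarrow> f 0 = 0"
  using linear_over_add[of act act' B W f 0 0] subspace_over_zero[of act B W] by simp

definition span_family :: "('v::ab_group_add \<Rightarrow> 'r::ring_1 \<Rightarrow> 'v) \<Rightarrow> 'r set \<Rightarrow> nat \<Rightarrow> (nat \<Rightarrow> 'v) \<Rightarrow> 'v set" where
  "span_family act B n b = {\<Sum>i<n. act (b i) (c i) | c. \<forall>i. c i \<in> B}"

definition independent_family :: "('v::ab_group_add \<Rightarrow> 'r::ring_1 \<Rightarrow> 'v) \<Rightarrow> 'r set \<Rightarrow> nat \<Rightarrow> (nat \<Rightarrow> 'v) \<Rightarrow> bool" where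
  "independent_family act B n b \<longleftrightarrow>
     (\<forall>c. (\<forall>i. c i \<in> B) \<longrightarrow> (\<Sum>i<n. act (b i) (c i)) = 0 \<longrightarrow> (\<forall>i<n. c i = 0))"

lemma span_familyI: "(\<And>i. c i \<in> B) \<Longrightarrow> (\<Sum>i<n. act (b i) (c i)) \<in> span_family act B n b"
  unfolding span_family_def by blast

lemma span_familyE:
  assumes "x \<in> span_family act B n b"
  obtains c where "x = (\<Sum>i<n. act (b i) (c i))" "\<forall>i. c i \<in> B"
  using assms unfolding span_family_def by blast

lemma independent_familyD:
  "independent_family act B n b \<Longrightarrow> (\<And>i. c i \<in> B) \<Longrightarrow> (\<Sum>i<n. act (b i) (c i)) = 0 \<Longrightarrow> i < n \<Longrightarrow> c i = 0"
  unfolding independent_family_def by blast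

lemma independent_family_mono: "independent_family act B' n b \<Longrightarrow> B \<subseteq> B' \<Longrightarrow> independent_family act B n b"
  unfolding independent_family_def by blast

lemma span_family_mono: "B \<subseteq> B' \<Longrightarrow> span_family act B n b \<subseteq> span_family act B' n b"
  unfolding span_family_def by blast

lemma (in unital_ring_hom) span_family_imageE:
  assumes "x \<in> span_family (*) (f ` E) n b"
  obtains c where "x = (\<Sum>i<n. b i * f (c i))" "\<forall>i. c i \<in> E"
proof -
  obtain d where d: "x = (\<Sum>i<n. b i * d i)" "\<forall>i. d i \<in> f ` E" using assms by (rule span_familyE)
  then have "\<forall>i. \<exists>e. e \<in> E \<and> d i = f e" by blast
  then obtain c where "\<And>i. d i = f (c i)" "\<forall>i. c i \<in> E" by metis
  then show thesis using that d(1) by simp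
qed

lemma (in unital_ring_hom) span_family_imageI:
  "(\<And>i. c i \<in> E) \<Longrightarrow> (\<Sum>i<n. b i * f (c i)) \<in> span_family (*) (f ` E) n b"
  by (rule span_familyI) blast

lemma (in division_ring_hom) independent_family_imageD:
  assumes "independent_family (*) (f ` E) n b" "\<And>i. c i \<in> E" "(\<Sum>i<n. b i * f (c i)) = 0" "i < n"
  shows "c i = 0"
  using independent_familyD[OF assms(1) _ assms(3,4)] assms(2) by (simp add: hom_eq_0_iff)

lemma (in division_ring_hom) independent_family_imageI:
  assumes "\<And>c i. (\<And>i. c i \<in> E) \<Longrightarrow> (\<Sum>i<n. b i * f (c i)) = 0 \<Longrightarrow> i < n \<Longrightarrow> c i = 0"
  shows "independent_family (*) (f ` E) n b"
  unfolding independent_family_def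
proof (intro allI impI)
  fix d i assume d: "\<forall>i. d i \<in> f ` E" "(\<Sum>i<n. b i * d i) = 0" and i: "i < n"
  then have "\<forall>i. \<exists>e. e \<in> E \<and> d i = f e" by blast
  then obtain c where c: "\<And>i. d i = f (c i)" "\<And>i. c i \<in> E" by metis
  have "c i = 0" by (rule assms[OF c(2) _ i]) (use d(2) c(1) in simp)
  then show "d i = 0" by (simp add: c(1) hom_zero)
qed

lemma span_family_cong: "(\<And>i. i < n \<Longrightarrow> b i = b' i) \<Longrightarrow> span_family act B n b = span_family act B n b'"
  unfolding span_family_def by (metis (no_types, lifting) lessThan_iff sum.cong)

lemma independent_family_cong:
  assumes "\<And>i. i < n \<Longrightarrow> b i = b' i"
  shows "independent_family act B n b = independent_family act B n b'"
proof -
  have "(\<Sum>i<n. act (b i) (c i)) = (\<Sum>i<n. act (b' i) (c i))" for c using assms by (intro sum.cong) auto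
  then show ?thesis unfolding independent_family_def by simp
qed

lemma span_family_least: "subspace_over act B W \<Longrightarrow> (\<And>i. i < n \<Longrightarrow> b i \<in> W) \<Longrightarrow> span_family act B n b \<subseteq> W"
  by (auto elim!: span_familyE intro!: subspace_over_sum[of act B W] subspace_over_act[of act B W])

lemma span_family_Suc:
  assumes "division_subring B"
  shows "span_family act B (Suc n) b = adjoin act B (span_family act B n b) (b n)"
proof (intro equalityI subsetI)
  fix x assume "x \<in> span_family act B (Suc n) b"
  then obtain c where "x = (\<Sum>i<n. act (b i) (c i)) + act (b n) (c n)" "\<forall>i. c i \<in> B" by (auto elim!: span_familyE)
  then show "x \<in> adjoin act B (span_family act B n b) (b n)" by (auto intro!: adjoinI span_familyI)
next
  fix x assume "x \<in> adjoin act B (span_family act B n b) (b n)"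
  then obtain c d where x: "x = (\<Sum>i<n. act (b i) (c i)) + act (b n) d" "\<forall>i. c i \<in> B" "d \<in> B"
    by (auto elim!: adjoinE span_familyE)
  then have "x = (\<Sum>i<Suc n. act (b i) ((c(n := d)) i))" by simp
  also have "\<dots> \<in> span_family act B (Suc n) b" by (rule span_familyI) (use x in auto)
  finally show "x \<in> span_family act B (Suc n) b" .
qed

locale right_module =
  fixes act :: "'v::ab_group_add \<Rightarrow> 'r::ring_1 \<Rightarrow> 'v" (infixl "\<cdot>" 80)
  assumes act_add_left: "(v + w) \<cdot> b = v \<cdot> b + w \<cdot> b"
    and act_add_right: "v \<cdot> (a + b) = v \<cdot> a + v \<cdot> b"
    and act_mult: "v \<cdot> (a * b) = v \<cdot> a \<cdot> b"
    and act_one [simp]: "v \<cdot> 1 = v"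
begin

lemma act_zero_left [simp]: "0 \<cdot> b = 0"
  using act_add_left[of 0 0 b] by simp

lemma act_zero_right [simp]: "v \<cdot> 0 = 0"
  using act_add_right[of v 0 0] by simp

lemma act_minus_right: "v \<cdot> (- b) = - (v \<cdot> b)"
  using act_add_right[of v b "- b"] by (simp add: eq_neg_iff_add_eq_0 add.commute)

lemma act_diff_right: "v \<cdot> (a - b) = v \<cdot> a - v \<cdot> b"
  using act_add_right[of v a "- b"] by (simp add: act_minus_right)

lemma subspace_over_minus: "division_subring B \<Longrightarrow> subspace_over (\<cdot>) B W \<Longrightarrow> v \<in> W \<Longrightarrow> - v \<in> W"
  using subspace_over_act[of "(\<cdot>)" B W v "- 1"] by (simp add: act_minus_right division_subring_closed)

lemma subspace_over_diff:
  "division_subring B \<Longrightarrow> subspace_over (\<cdot>) B W \<Longrightarrow> v \<in> W \<Longrightarrow> w \<in> W \<Longrightarrow> v - w \<in> W"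
  using subspace_over_add[of "(\<cdot>)" B W v "- w"] subspace_over_minus[of B W w] by simp

lemma subspace_over_act_cancel:
  assumes "division_subring B" "subspace_over (\<cdot>) B W" "b \<in> B" "b \<noteq> 0" "v \<cdot> b \<in> W"
  shows "v \<in> W"
proof -
  obtain c where c: "c \<in> B" "b * c = 1" using division_subring_inverseE[OF assms(1,3,4)] .
  then have "v = v \<cdot> b \<cdot> c" by (simp flip: act_mult)
  then show ?thesis using subspace_over_act[OF assms(2,5) c(1)] by simp
qed

lemma subspace_over_singleton_zero: "subspace_over (\<cdot>) B {0}"
  by (simp add: subspace_over_def)

lemma adjoin_superset:
  assumes "division_subring B" shows "W \<subseteq> adjoin (\<cdot>) B W v"
proof
  fix w assume "w \<in> W"
  then show "w \<in> adjoin (\<cdot>) B W v"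
    using adjoinI[of w W 0 B "(\<cdot>)" v] by (simp add: division_subring_zero assms)
qed

lemma adjoin_new:
  assumes "division_subring B" "subspace_over (\<cdot>) B W" shows "v \<in> adjoin (\<cdot>) B W v"
  using adjoinI[of 0 W 1 B "(\<cdot>)" v] by (simp add: division_subring_one subspace_over_zero[OF assms(2)] assms(1))

lemma adjoin_least:
  "subspace_over (\<cdot>) B U \<Longrightarrow> W \<subseteq> U \<Longrightarrow> v \<in> U \<Longrightarrow> adjoin (\<cdot>) B W v \<subseteq> U"
  by (auto elim!: adjoinE intro!: subspace_over_add[of "(\<cdot>)" B U] subspace_over_act[of "(\<cdot>)" B U])

lemma subspace_over_set_plus:
  assumes "subspace_over (\<cdot>) B W" "subspace_over (\<cdot>) B U"
  shows "subspace_over (\<cdot>) B (W + U)"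
  unfolding subspace_over_def
proof (intro conjI ballI)
  show "0 \<in> W + U"
    using set_plus_intro[OF subspace_over_zero[OF assms(1)] subspace_over_zero[OF assms(2)]] by simp
  fix x assume "x \<in> W + U"
  then obtain w u where x: "x = w + u" "w \<in> W" "u \<in> U" by (rule set_plus_elim)
  show "x \<cdot> b \<in> W + U" if "b \<in> B" for b
    unfolding x act_add_left
    by (rule set_plus_intro) (use subspace_over_act[OF assms(1) x(2)] subspace_over_act[OF assms(2) x(3)] that in auto)
  fix y assume "y \<in> W + U"
  then obtain w' u' where y: "y = w' + u'" "w' \<in> W" "u' \<in> U" by (rule set_plus_elim)
  have "x + y = (w + w') + (u + u')" unfolding x y by (simp add: algebra_simps)
  then show "x + y \<in> W + U" using assms x y by (metis set_plus_intro subspace_over_add)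
qed

lemma subspace_over_line:
  assumes "division_subring B" shows "subspace_over (\<cdot>) B ((\<cdot>) v ` B)"
  unfolding subspace_over_def
proof (intro conjI ballI)
  show "0 \<in> (\<cdot>) v ` B" using division_subring_zero[OF assms] by force
  fix x assume "x \<in> (\<cdot>) v ` B"
  then obtain a where a: "x = v \<cdot> a" "a \<in> B" by blast
  show "x \<cdot> b \<in> (\<cdot>) v ` B" if "b \<in> B" for b
    unfolding a(1) act_mult[symmetric] using a that assms by (blast intro: division_subring_mult)
  fix y assume "y \<in> (\<cdot>) v ` B"
  then obtain b where b: "y = v \<cdot> b" "b \<in> B" by blast
  show "x + y \<in> (\<cdot>) v ` B"
    unfolding a(1) b(1) act_add_right[symmetric] using a b assms by (blast intro: division_subring_add)
qed

lemma subspace_over_adjoin: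
  "division_subring B \<Longrightarrow> subspace_over (\<cdot>) B W \<Longrightarrow> subspace_over (\<cdot>) B (adjoin (\<cdot>) B W v)"
  unfolding adjoin_def by (intro subspace_over_set_plus subspace_over_line)

lemma adjoin_exchange:
  assumes "division_subring B" "subspace_over (\<cdot>) B W" "x \<in> adjoin (\<cdot>) B W v" "x \<notin> W"
  shows "adjoin (\<cdot>) B W v = adjoin (\<cdot>) B W x"
proof
  obtain w b where x: "x = w + v \<cdot> b" "w \<in> W" "b \<in> B" using assms(3) by (rule adjoinE)
  show "adjoin (\<cdot>) B W x \<subseteq> adjoin (\<cdot>) B W v"
    by (intro adjoin_least subspace_over_adjoin adjoin_superset assms)
  have "b \<noteq> 0" using x assms(4) by auto
  have "v \<cdot> b = x - w" using x by simp
  also have "\<dots> \<in> adjoin (\<cdot>) B W x"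
    by (intro subspace_over_diff[OF assms(1)] subspace_over_adjoin adjoin_new assms
        subsetD[OF adjoin_superset[OF assms(1)] x(2)])
  finally have "v \<in> adjoin (\<cdot>) B W x"
    using subspace_over_act_cancel[OF assms(1) subspace_over_adjoin[OF assms(1,2)] x(3) \<open>b \<noteq> 0\<close>] by blast
  then show "adjoin (\<cdot>) B W v \<subseteq> adjoin (\<cdot>) B W x"
    by (intro adjoin_least subspace_over_adjoin adjoin_superset assms)
qed

lemma adjoin_Int:
  assumes "division_subring B" "subspace_over (\<cdot>) B W" "subspace_over (\<cdot>) B U"
    "U \<subseteq> adjoin (\<cdot>) B W v" "x \<in> U" "x \<notin> W"
  shows "U = adjoin (\<cdot>) B (U \<inter> W) x"
proof
  show "adjoin (\<cdot>) B (U \<inter> W) x \<subseteq> U"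
    by (intro adjoin_least assms) auto
  show "U \<subseteq> adjoin (\<cdot>) B (U \<inter> W) x"
  proof
    fix y assume "y \<in> U"
    then have "y \<in> adjoin (\<cdot>) B W x" using adjoin_exchange[OF assms(1,2), of x v] assms by blast
    then obtain w b where y: "y = w + x \<cdot> b" "w \<in> W" "b \<in> B" by (rule adjoinE)
    then have "w = y - x \<cdot> b" by simp
    also have "\<dots> \<in> U"
      by (intro subspace_over_diff[OF assms(1,3)] \<open>y \<in> U\<close> subspace_over_act[OF assms(3,5)] y(3))
    finally show "y \<in> adjoin (\<cdot>) B (U \<inter> W) x" using y by (auto intro: adjoinI)
  qed
qed

lemma has_dim_subspace: "has_dim (\<cdot>) B n W \<Longrightarrow> division_subring B \<Longrightarrow> subspace_over (\<cdot>) B W"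
  by (induction rule: has_dim.induct) (auto intro: subspace_over_adjoin simp: subspace_over_singleton_zero)

lemma has_dim_subspace_strict:
  assumes "has_dim (\<cdot>) B n W" "division_subring B" "subspace_over (\<cdot>) B U" "U \<subseteq> W"
  shows "\<exists>m\<le>n. has_dim (\<cdot>) B m U \<and> (U \<noteq> W \<longrightarrow> m < n)"
  using assms
proof (induction arbitrary: U rule: has_dim.induct)
  case has_dim_0
  then have "U = {0}" using subspace_over_zero by blast
  then show ?case using has_dim.has_dim_0 by blast
next
  case (has_dim_Suc n W v)
  note W = has_dim_subspace[OF has_dim_Suc.hyps(1) \<open>division_subring B\<close>]
  obtain m where m: "m \<le> n" "has_dim (\<cdot>) B m (U \<inter> W)" "U \<inter> W \<noteq> W \<longrightarrow> m < n"
    using has_dim_Suc.IH[OF \<open>division_subring B\<close> subspace_over_Int[OF \<open>subspace_over (\<cdot>) B U\<close> W]] by auto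
  show ?case
  proof (cases "U \<subseteq> W")
    case True
    then have "U \<inter> W = U" by blast
    then show ?thesis using m by (metis le_imp_less_Suc le_SucI)
  next
    case False
    then obtain x where x: "x \<in> U" "x \<notin> W" by blast
    have U: "U = adjoin (\<cdot>) B (U \<inter> W) x"
      by (rule adjoin_Int[OF \<open>division_subring B\<close> W has_dim_Suc.prems(2,3) x])
    have "has_dim (\<cdot>) B (Suc m) U"
      using has_dim.has_dim_Suc[OF m(2), of x] x U by auto
    moreover have "U \<inter> W \<noteq> W" if "U \<noteq> adjoin (\<cdot>) B W v"
      using that U adjoin_exchange[OF \<open>division_subring B\<close> W _ x(2)] has_dim_Suc.prems(3) x(1) by (metis subsetD)
    ultimately show ?thesis using m by (metis Suc_le_mono Suc_less_eq)
  qed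
qed

lemma has_dim_subspaceE:
  assumes "has_dim (\<cdot>) B n W" "division_subring B" "subspace_over (\<cdot>) B U" "U \<subseteq> W"
  obtains m where "m \<le> n" "has_dim (\<cdot>) B m U"
  using has_dim_subspace_strict[OF assms] by blast

lemma has_dim_of_hyperplane_Int:
  assumes B: "division_subring B" and W0: "subspace_over (\<cdot>) B W0" and W1: "subspace_over (\<cdot>) B W1"
    and eq: "adjoin (\<cdot>) B W0 v = adjoin (\<cdot>) B W1 w" and w: "w \<notin> W1" and ne: "W0 \<noteq> W1"
    and l: "has_dim (\<cdot>) B l (W0 \<inter> W1)"
  shows "has_dim (\<cdot>) B (Suc l) W0"
proof -
  have "\<not> W0 \<subseteq> W1"
  proof
    assume sub: "W0 \<subseteq> W1"
    then obtain x where x: "x \<in> W1" "x \<notin> W0" using ne by blast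
    have "w \<in> adjoin (\<cdot>) B W0 v" unfolding eq by (rule adjoin_new[OF B W1])
    also have "\<dots> = adjoin (\<cdot>) B W0 x"
      using adjoin_exchange[OF B W0 _ x(2)] adjoin_superset[OF B, of W1 w] x(1) eq by blast
    also have "\<dots> \<subseteq> W1" by (rule adjoin_least[OF W1 sub x(1)])
    finally show False using w by blast
  qed
  then obtain y where y: "y \<in> W0" "y \<notin> W1" by blast
  have "W0 = adjoin (\<cdot>) B (W0 \<inter> W1) y"
    by (rule adjoin_Int[OF B W1 W0 _ y]) (use adjoin_superset[OF B, of W0 v] eq in auto)
  then show ?thesis using has_dim_Suc[OF l, of y] y by simp
qed

lemma has_dim_unique:
  assumes B: "division_subring B" and "has_dim (\<cdot>) B n W" "has_dim (\<cdot>) B m W"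
  shows "m = n"
  using assms(2,3)
proof (induction n arbitrary: m W)
  case 0
  then have "W = {0}" by (simp add: has_dim_0_iff)
  show ?case
  proof (cases m)
    case (Suc k)
    then obtain W0 v where W: "W = adjoin (\<cdot>) B W0 v" "has_dim (\<cdot>) B k W0" "v \<notin> W0"
      using 0 has_dim_SucE by metis
    note sW0 = has_dim_subspace[OF W(2) B]
    have "v \<in> {0}" using adjoin_new[OF B sW0, of v] W(1) \<open>W = {0}\<close> by simp
    then show ?thesis using subspace_over_zero[OF sW0] W(3) by simp
  qed simp
next
  case (Suc n)
  obtain W0 v where W: "W = adjoin (\<cdot>) B W0 v" and W0: "has_dim (\<cdot>) B n W0" and v: "v \<notin> W0"
    using Suc.prems(1) by (rule has_dim_SucE)
  note sW0 = has_dim_subspace[OF W0 B]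
  have "v \<in> W" "v \<noteq> 0" using adjoin_new[OF B sW0, of v] v subspace_over_zero[OF sW0] unfolding W by blast+
  then have "W \<noteq> {0}" by blast
  then obtain k where k: "m = Suc k" using Suc.prems(2) by (cases m) (auto simp: has_dim_0_iff)
  then obtain W1 w where W': "W = adjoin (\<cdot>) B W1 w" and W1: "has_dim (\<cdot>) B k W1" and w: "w \<notin> W1"
    using Suc.prems(2) has_dim_SucE by metis
  note sW1 = has_dim_subspace[OF W1 B]
  have "k = n"
  proof (cases "W0 = W1")
    case True
    then show ?thesis using Suc.IH W0 W1 by simp
  next
    case False
    obtain l where l: "has_dim (\<cdot>) B l (W0 \<inter> W1)"
      using has_dim_subspaceE[OF W0 B subspace_over_Int[OF sW0 sW1]] by blast
    have "has_dim (\<cdot>) B (Suc l) W0"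
      by (rule has_dim_of_hyperplane_Int[OF B sW0 sW1 _ w False l]) (use W W' in simp)
    moreover have "has_dim (\<cdot>) B (Suc l) W1"
      by (rule has_dim_of_hyperplane_Int[OF B sW1 sW0 _ v]) (use W W' False l in \<open>auto simp: Int_commute\<close>)
    ultimately show ?thesis using Suc.IH[OF W0] Suc.IH[of W1] W1 by blast
  qed
  then show ?case using k by simp
qed

lemma has_dim_mono:
  assumes "division_subring B" "has_dim (\<cdot>) B n W" "has_dim (\<cdot>) B m U" "U \<subseteq> W"
  shows "m \<le> n"
  using has_dim_subspaceE[OF assms(2,1) has_dim_subspace[OF assms(3,1)] assms(4)]
    has_dim_unique[OF assms(1,3)] by metis

lemma has_dim_eqI:
  assumes "division_subring B" "has_dim (\<cdot>) B n W" "has_dim (\<cdot>) B m U" "U \<subseteq> W" "n \<le> m"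
  shows "U = W"
  using has_dim_subspace_strict[OF assms(2,1) has_dim_subspace[OF assms(3,1)] assms(4)]
    has_dim_unique[OF assms(1,3)] assms(5) by (metis not_less)

lemma ex_nonzero_of_dim_pos:
  assumes "division_subring B" "has_dim (\<cdot>) B n W" "0 < n"
  obtains v where "v \<in> W" "v \<noteq> 0"
  using has_dim_eqI[OF assms(1,2) has_dim_0] has_dim_mono[OF assms(1) has_dim_0 assms(2)] assms(3)
  by (metis le_zero_eq not_less_iff_gr_or_eq singletonI subsetI)

lemma ex_maximal_subspace:
  assumes B: "division_subring B" and W: "has_dim (\<cdot>) B n W"
    and P: "\<And>U. P U \<Longrightarrow> subspace_over (\<cdot>) B U \<and> U \<subseteq> W" and U0: "P U0"
  obtains U where "P U" "\<And>U'. P U' \<Longrightarrow> U \<subseteq> U' \<Longrightarrow> U' = U"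
proof -
  let ?D = "\<lambda>d. \<exists>U. P U \<and> has_dim (\<cdot>) B d U"
  have bound: "d \<le> n" if "?D d" for d using that P has_dim_mono[OF B W] by blast
  obtain d0 where d0: "?D d0" using has_dim_subspaceE[OF W B, of U0] P[OF U0] U0 by blast
  define d where "d = Greatest ?D"
  have "?D d" and max: "\<And>e. ?D e \<Longrightarrow> e \<le> d"
    using GreatestI_nat[of ?D, OF d0 bound] Greatest_le_nat[of ?D, OF _ bound] unfolding d_def by blast+
  then obtain U where U: "P U" "has_dim (\<cdot>) B d U" by blast
  have "U' = U" if U': "P U'" "U \<subseteq> U'" for U'
  proof -
    obtain e where e: "has_dim (\<cdot>) B e U'" using has_dim_subspaceE[OF W B, of U'] P[OF U'(1)] by blast
    then have "e \<le> d" using max U'(1) by blast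
    then show ?thesis using has_dim_eqI[OF B e U(2) U'(2)] by simp
  qed
  then show thesis using that U(1) by blast
qed

lemma has_dim_direct_sum:
  assumes B: "division_subring B" and W: "has_dim (\<cdot>) B n W" and "has_dim (\<cdot>) B m U" "W \<inter> U \<subseteq> {0}"
  shows "has_dim (\<cdot>) B (n + m) (W + U)"
  using assms(3,4)
proof (induction rule: has_dim.induct)
  case has_dim_0
  then show ?case using W by simp
next
  case (has_dim_Suc m U v)
  note sU = has_dim_subspace[OF has_dim_Suc.hyps(1) B]
  have "v \<notin> W + U"
  proof
    assume "v \<in> W + U"
    then obtain w u where v: "v = w + u" "w \<in> W" "u \<in> U" by (rule set_plus_elim)
    then have "w = v - u" by simp
    also have "\<dots> \<in> adjoin (\<cdot>) B U v"
      by (intro subspace_over_diff[OF B] subspace_over_adjoin adjoin_new B sU subsetD[OF adjoin_superset[OF B] v(3)])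
    finally have "w = 0" using has_dim_Suc.prems v(2) by blast
    then show False using v \<open>v \<notin> U\<close> by simp
  qed
  moreover have "has_dim (\<cdot>) B (n + m) (W + U)"
    using has_dim_Suc.IH has_dim_Suc.prems adjoin_superset[OF B] by blast
  ultimately have "has_dim (\<cdot>) B (Suc (n + m)) (adjoin (\<cdot>) B (W + U) v)" by (intro has_dim.has_dim_Suc)
  then show ?case by (simp add: adjoin_def add.assoc)
qed

lemma has_dim_complementE:
  assumes B: "division_subring B" and W: "has_dim (\<cdot>) B n W" and U: "subspace_over (\<cdot>) B U" "U \<subseteq> W"
  obtains T where "subspace_over (\<cdot>) B T" "U \<inter> T = {0}" "W = U + T"
proof -
  note sW = has_dim_subspace[OF W B]
  let ?P = "\<lambda>T. subspace_over (\<cdot>) B T \<and> T \<subseteq> W \<and> U \<inter> T = {0}"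
  have "?P {0}"
    using subspace_over_singleton_zero subspace_over_zero[OF sW] subspace_over_zero[OF U(1)] by blast
  then obtain T where T: "?P T" and max: "\<And>T'. ?P T' \<Longrightarrow> T \<subseteq> T' \<Longrightarrow> T' = T"
    using ex_maximal_subspace[OF B W, of ?P] by metis
  have sUT: "subspace_over (\<cdot>) B (U + T)" using U(1) T by (intro subspace_over_set_plus) auto
  have "W \<subseteq> U + T"
  proof
    fix v assume v: "v \<in> W"
    show "v \<in> U + T"
    proof (rule ccontr)
      assume nv: "v \<notin> U + T"
      have "U \<inter> adjoin (\<cdot>) B T v \<subseteq> {0}"
      proof
        fix x assume x: "x \<in> U \<inter> adjoin (\<cdot>) B T v"
        then obtain t b where t: "x = t + v \<cdot> b" "t \<in> T" "b \<in> B" by (auto elim: adjoinE)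
        have "- t \<in> T" using subspace_over_minus[OF B] T t(2) by blast
        then have "x + (- t) \<in> U + T" using x by blast
        then have "v \<cdot> b \<in> U + T" using t(1) by simp
        then have "b = 0" using subspace_over_act_cancel[OF B sUT t(3)] nv by blast
        then have "x \<in> T" using t by simp
        then show "x \<in> {0}" using x T by blast
      qed
      moreover have "0 \<in> U \<inter> adjoin (\<cdot>) B T v"
        using T subsetD[OF adjoin_superset[OF B, of T v], of 0] by blast
      ultimately have "U \<inter> adjoin (\<cdot>) B T v = {0}" by blast
      then have "?P (adjoin (\<cdot>) B T v)"
        using T v subspace_over_adjoin[OF B, of T v] adjoin_least[OF sW, of T v] by simp
      then have "adjoin (\<cdot>) B T v = T" by (rule max) (rule adjoin_superset[OF B])
      then have "v \<in> T" using adjoin_new[OF B, of T v] T by blast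
      then show False using nv set_plus_intro[OF subspace_over_zero[OF U(1)], of v T] by simp
    qed
  qed
  moreover have "U + T \<subseteq> W" by (rule subspace_over_set_plus_least[OF sW U(2)]) (use T in blast)
  ultimately show thesis using that T by blast
qed

lemma span_family_base:
  assumes "division_subring B" "i < n" shows "b i \<in> span_family (\<cdot>) B n b"
proof -
  have "(\<Sum>j<n. b j \<cdot> (if j = i then 1 else 0)) = (\<Sum>j<n. if j = i then b j else 0)"
    by (intro sum.cong) auto
  also have "\<dots> = b i" using assms(2) by simp
  finally have "b i = (\<Sum>j<n. b j \<cdot> (if j = i then 1 else 0))" by simp
  also have "\<dots> \<in> span_family (\<cdot>) B n b"
    by (rule span_familyI) (use assms(1) in \<open>auto simp: division_subring_closed\<close>)
  finally show ?thesis .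
qed

lemma independent_family_SucI:
  assumes B: "division_subring B" and ind: "independent_family (\<cdot>) B n b" and new: "b n \<notin> span_family (\<cdot>) B n b"
  shows "independent_family (\<cdot>) B (Suc n) b"
  unfolding independent_family_def
proof (intro allI impI)
  fix c i assume c: "\<forall>i. c i \<in> B" "(\<Sum>i<Suc n. b i \<cdot> c i) = 0" and i: "i < Suc n"
  have "c n = 0"
  proof (rule ccontr)
    assume "c n \<noteq> 0"
    then obtain z where z: "z \<in> B" "c n * z = 1" using division_subring_inverseE[OF B] c(1) by metis
    have "b n = b n \<cdot> c n \<cdot> z" using z by (simp flip: act_mult)
    also have "b n \<cdot> c n = (\<Sum>i<n. b i \<cdot> (- c i))"
      using c(2) by (simp add: act_minus_right sum_negf eq_neg_iff_add_eq_0 add.commute)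
    also have "\<dots> \<cdot> z = (\<Sum>i<n. b i \<cdot> (- c i * z))"
      unfolding act_mult by (induction n) (simp_all add: act_add_left)
    also have "\<dots> \<in> span_family (\<cdot>) B n b"
      by (rule span_familyI) (use c(1) z(1) B in \<open>blast intro: division_subring_closed\<close>)
    finally show False using new by blast
  qed
  then show "c i = 0" using independent_familyD[of "(\<cdot>)" B n b c i] ind c i by (auto simp: less_Suc_eq)
qed

lemma independent_family_Suc_iff:
  assumes B: "division_subring B"
  shows "independent_family (\<cdot>) B (Suc n) b \<longleftrightarrow> independent_family (\<cdot>) B n b \<and> b n \<notin> span_family (\<cdot>) B n b"
proof (intro iffI conjI)
  assume ind: "independent_family (\<cdot>) B (Suc n) b"
  show "independent_family (\<cdot>) B n b"
    unfolding independent_family_def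
  proof (intro allI impI)
    fix c i assume c: "\<forall>i. c i \<in> B" "(\<Sum>i<n. b i \<cdot> c i) = 0" and i: "i < n"
    have "(c(n := 0)) i = 0"
      by (rule independent_familyD[OF ind]) (use c i division_subring_zero[OF B] in auto)
    then show "c i = 0" using i by simp
  qed
  show "b n \<notin> span_family (\<cdot>) B n b"
  proof
    assume "b n \<in> span_family (\<cdot>) B n b"
    then obtain c where c: "b n = (\<Sum>i<n. b i \<cdot> c i)" "\<forall>i. c i \<in> B" by (rule span_familyE)
    have "(c(n := - 1)) n = 0"
      by (rule independent_familyD[OF ind])
        (use c B division_subring_minus division_subring_one in \<open>auto simp: act_minus_right\<close>)
    then show False by simp
  qed
qed (use independent_family_SucI[OF B] in blast)

lemma has_dim_span_family:
  assumes B: "division_subring B" and "independent_family (\<cdot>) B n b"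
  shows "has_dim (\<cdot>) B n (span_family (\<cdot>) B n b)"
  using assms(2)
proof (induction n)
  case 0
  then show ?case using division_subring_zero[OF B] by (auto simp: span_family_def has_dim_0_iff)
next
  case (Suc n)
  then show ?case
    unfolding span_family_Suc[OF B] independent_family_Suc_iff[OF B] by (blast intro: has_dim_Suc)
qed

lemma has_dim_span_family_le:
  assumes B: "division_subring B"
  obtains m where "m \<le> n" "has_dim (\<cdot>) B m (span_family (\<cdot>) B n b)" "\<not> independent_family (\<cdot>) B n b \<Longrightarrow> m < n"
proof -
  have "\<exists>m\<le>n. has_dim (\<cdot>) B m (span_family (\<cdot>) B n b) \<and> (\<not> independent_family (\<cdot>) B n b \<longrightarrow> m < n)"
  proof (induction n)
    case 0
    have "independent_family (\<cdot>) B 0 b" by (simp add: independent_family_def)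
    then show ?case using has_dim_span_family[OF B] by blast
  next
    case (Suc n)
    then obtain m where m: "m \<le> n" "has_dim (\<cdot>) B m (span_family (\<cdot>) B n b)"
      "\<not> independent_family (\<cdot>) B n b \<longrightarrow> m < n" by blast
    show ?case
    proof (cases "b n \<in> span_family (\<cdot>) B n b")
      case True
      then have "span_family (\<cdot>) B (Suc n) b = span_family (\<cdot>) B n b"
        unfolding span_family_Suc[OF B]
        by (intro equalityI adjoin_superset[OF B] adjoin_least[OF has_dim_subspace[OF m(2) B] order_refl])
      then show ?thesis using m by (metis le_SucI le_imp_less_Suc)
    next
      case False
      then show ?thesis
        using m has_dim_Suc[OF m(2)] unfolding span_family_Suc[OF B] independent_family_Suc_iff[OF B]
        by (metis Suc_le_mono Suc_less_eq)
    qed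
  qed
  then show thesis using that by blast
qed

lemma subspace_over_span_family:
  assumes "division_subring B" shows "subspace_over (\<cdot>) B (span_family (\<cdot>) B n b)"
  using has_dim_span_family_le[OF assms, of n b] has_dim_subspace[OF _ assms] by metis

lemma independent_family_prefix:
  assumes "division_subring B" "m \<le> n" "independent_family (\<cdot>) B n b"
  shows "independent_family (\<cdot>) B m b"
  using assms(2,3) by (induction rule: inc_induct) (auto simp: independent_family_Suc_iff[OF assms(1)])

lemma independent_family_of_spanning:
  assumes B: "division_subring B" and W: "has_dim (\<cdot>) B n W" "W \<subseteq> span_family (\<cdot>) B n b"
  shows "independent_family (\<cdot>) B n b"
proof (rule ccontr)
  assume "\<not> ?thesis"
  then obtain m where "m < n" "has_dim (\<cdot>) B m (span_family (\<cdot>) B n b)"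
    using has_dim_span_family_le[OF B, of n b] by metis
  then show False using has_dim_mono[OF B _ W] by fastforce
qed

lemma basis_extension:
  assumes B: "division_subring B" and W: "has_dim (\<cdot>) B (m + k) W"
    and b: "independent_family (\<cdot>) B m b" "\<And>i. i < m \<Longrightarrow> b i \<in> W"
  obtains b' where "\<And>i. i < m \<Longrightarrow> b' i = b i" "independent_family (\<cdot>) B (m + k) b'"
    "span_family (\<cdot>) B (m + k) b' = W"
proof -
  note sW = has_dim_subspace[OF W B]
  have "\<exists>b'. (\<forall>i<m. b' i = b i) \<and> independent_family (\<cdot>) B (m + l) b' \<and> (\<forall>i<m + l. b' i \<in> W)"
    if "l \<le> k" for l
    using that
  proof (induction l)
    case (Suc l)
    then obtain b' where b': "\<forall>i<m. b' i = b i" "independent_family (\<cdot>) B (m + l) b'" "\<forall>i<m + l. b' i \<in> W"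
      by auto
    let ?S = "span_family (\<cdot>) B (m + l)"
    have "?S b' \<subseteq> W" using b'(3) by (intro span_family_least[OF sW]) auto
    moreover have "?S b' \<noteq> W"
      using has_dim_unique[OF B W] has_dim_span_family[OF B b'(2)] Suc.prems by fastforce
    ultimately obtain v where v: "v \<in> W" "v \<notin> ?S b'" by blast
    let ?b = "b'(m + l := v)"
    have "?S ?b = ?S b'" by (rule span_family_cong) simp
    moreover have "independent_family (\<cdot>) B (m + l) ?b = independent_family (\<cdot>) B (m + l) b'"
      by (rule independent_family_cong) simp
    ultimately have "independent_family (\<cdot>) B (m + Suc l) ?b"
      using b'(2) v(2) unfolding add_Suc_right independent_family_Suc_iff[OF B] by simp
    moreover have "\<forall>i<m. ?b i = b i" "\<forall>i<m + Suc l. ?b i \<in> W" using b' v(1) by (auto simp: less_Suc_eq)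
    ultimately show ?case by blast
  qed (use b in auto)
  from this[of k] obtain b' where b': "\<forall>i<m. b' i = b i" "independent_family (\<cdot>) B (m + k) b'"
    "\<forall>i<m + k. b' i \<in> W" by auto
  have "span_family (\<cdot>) B (m + k) b' = W"
    by (rule has_dim_eqI[OF B W has_dim_span_family[OF B b'(2)]])
      (use b'(3) in \<open>auto intro: span_family_least[OF sW, THEN subsetD]\<close>)
  then show thesis using that b' by blast
qed

lemma has_dim_basisE:
  assumes "division_subring B" "has_dim (\<cdot>) B n W"
  obtains b where "independent_family (\<cdot>) B n b" "span_family (\<cdot>) B n b = W" "\<And>i. i < n \<Longrightarrow> b i \<in> W"
proof -
  obtain b where b: "independent_family (\<cdot>) B (0 + n) b" "span_family (\<cdot>) B (0 + n) b = W"
    by (rule basis_extension[OF assms(1), of 0 n W "\<lambda>_. 0"]) (use assms in \<open>auto simp: independent_family_def\<close>)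
  then show thesis using that span_family_base[OF assms(1)] by (metis add_0)
qed

lemma linear_over_diff:
  assumes "division_subring B" "subspace_over (\<cdot>) B W" "linear_over (\<cdot>) act' B W f" "x \<in> W" "y \<in> W"
  shows "f (x - y) = f x - f y"
  using linear_over_add[OF assms(3) subspace_over_diff[OF assms(1,2,4,5)] assms(5)] by simp

lemma has_dim_image:
  assumes B: "division_subring B" and W: "has_dim (\<cdot>) B n W" and "right_module act'"
    and f: "linear_over (\<cdot>) act' B W f" and inj: "\<And>x. x \<in> W \<Longrightarrow> f x = 0 \<Longrightarrow> x = 0"
  shows "has_dim act' B n (f ` W)"
  using W f inj
proof (induction rule: has_dim.induct)
  case has_dim_0
  interpret M': right_module act' by fact
  have "f 0 = 0" by (rule linear_over_zero[OF has_dim_0(1) subspace_over_singleton_zero])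
  then show ?case by (simp add: has_dim.has_dim_0)
next
  case (has_dim_Suc n W v)
  interpret M': right_module act' by fact
  note sW = has_dim_subspace[OF has_dim_Suc.hyps(1) B]
  note sA = subspace_over_adjoin[OF B sW, of v] and sub = adjoin_superset[OF B, of W v]
  note v = adjoin_new[OF B sW, of v]
  have IH: "has_dim act' B n (f ` W)"
    by (rule has_dim_Suc.IH[OF linear_over_subset[OF has_dim_Suc.prems(1) sub]]) (use has_dim_Suc.prems(2) sub in blast)
  have "f v \<notin> f ` W"
  proof
    assume "f v \<in> f ` W"
    then obtain w where w: "w \<in> W" "f v = f w" by blast
    then have "f (v - w) = 0" using linear_over_diff[OF B sA has_dim_Suc.prems(1) v] sub by auto
    then have "v - w = 0" using has_dim_Suc.prems(2) subspace_over_diff[OF B sA v] w sub by blast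
    then show False using w \<open>v \<notin> W\<close> by simp
  qed
  then have "has_dim act' B (Suc n) (adjoin act' B (f ` W) (f v))" by (rule has_dim.has_dim_Suc[OF IH])
  moreover have "f (w + v \<cdot> b) = f w + act' (f v) b" if "w \<in> W" "b \<in> B" for w b
    using linear_over_add[OF has_dim_Suc.prems(1) subsetD[OF sub that(1)] subspace_over_act[OF sA v that(2)]]
      linear_over_act[OF has_dim_Suc.prems(1) v that(2)] by simp
  then have "adjoin act' B (f ` W) (f v) = f ` adjoin (\<cdot>) B W v"
    by (intro equalityI subsetI) (auto elim!: adjoinE intro: adjoinI simp flip: image_iff intro!: rev_image_eqI)
  ultimately show ?case by simp
qed

lemma has_dim_hyperplane:
  assumes B: "division_subring B" and W: "has_dim (\<cdot>) B n W" and H: "subspace_over (\<cdot>) B H" "H \<subseteq> W"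
    and codim: "\<And>y. y \<in> W \<Longrightarrow> y \<notin> H \<Longrightarrow> W \<subseteq> adjoin (\<cdot>) B H y"
  obtains m where "has_dim (\<cdot>) B m H" "n \<le> Suc m"
proof -
  obtain m where m: "has_dim (\<cdot>) B m H" using has_dim_subspaceE[OF W B H] .
  show thesis
  proof (cases "H = W")
    case True
    then have "m = n" using has_dim_unique[OF B W] m by simp
    then show ?thesis using that m by simp
  next
    case False
    then obtain y where y: "y \<in> W" "y \<notin> H" using H(2) by blast
    have "n \<le> Suc m" by (rule has_dim_mono[OF B has_dim_Suc[OF m y(2)] W codim[OF y]])
    then show ?thesis using that m by blast
  qed
qed

lemma subset_adjoin_preimage:
  assumes B: "division_subring B" and W: "subspace_over (\<cdot>) B W" and f: "linear_over (\<cdot>) act' B W f"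
    and y: "y \<in> W" "f ` W \<subseteq> adjoin act' B U (f y)"
  shows "W \<subseteq> adjoin (\<cdot>) B {x \<in> W. f x \<in> U} y"
proof
  fix x assume x: "x \<in> W"
  then have "f x \<in> adjoin act' B U (f y)" using y(2) by blast
  then obtain u b where ub: "f x = u + act' (f y) b" "u \<in> U" "b \<in> B" by (rule adjoinE)
  have yb: "y \<cdot> b \<in> W" by (rule subspace_over_act[OF W y(1) ub(3)])
  have "f (x - y \<cdot> b) = u"
    using linear_over_diff[OF B W f x yb] linear_over_act[OF f y(1) ub(3)] ub(1) by simp
  then have "x - y \<cdot> b \<in> {x \<in> W. f x \<in> U}" using subspace_over_diff[OF B W x yb] ub(2) by simp
  from adjoinI[OF this ub(3), of "(\<cdot>)" y] show "x \<in> adjoin (\<cdot>) B {x \<in> W. f x \<in> U} y" by simp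
qed

lemma has_dim_kernel:
  assumes B: "division_subring B" and W: "has_dim (\<cdot>) B n W"
    and U: "has_dim act' B r U" "right_module act'"
    and f: "linear_over (\<cdot>) act' B W f" "f ` W \<subseteq> U"
  obtains m where "has_dim (\<cdot>) B m {x \<in> W. f x = 0}" "n \<le> m + r"
proof -
  have "\<exists>m. has_dim (\<cdot>) B m {x \<in> W. f x = 0} \<and> n \<le> m + r"
    using U(1) W f
  proof (induction arbitrary: n W rule: has_dim.induct)
    case has_dim_0
    then have "{x \<in> W. f x = 0} = W" by auto
    then show ?case using has_dim_0 by auto
  next
    case (has_dim_Suc r U v)
    interpret M': right_module act' by fact
    note sW = has_dim_subspace[OF has_dim_Suc.prems(1) B]
    note sU = M'.has_dim_subspace[OF has_dim_Suc.hyps(1) B]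
    note f = has_dim_Suc.prems(2)
    let ?H = "{x \<in> W. f x \<in> U}"
    have sH: "subspace_over (\<cdot>) B ?H"
      using sW sU linear_over_zero[OF f sW] linear_over_add[OF f] linear_over_act[OF f]
      unfolding subspace_over_def by auto
    have "W \<subseteq> adjoin (\<cdot>) B ?H y" if y: "y \<in> W" "y \<notin> ?H" for y
    proof (rule subset_adjoin_preimage[OF B sW f y(1)])
      show "f ` W \<subseteq> adjoin act' B U (f y)"
        using M'.adjoin_exchange[OF B sU, of "f y" v] has_dim_Suc.prems(3) y by blast
    qed
    then obtain m where m: "has_dim (\<cdot>) B m ?H" "n \<le> Suc m"
      using has_dim_hyperplane[OF B has_dim_Suc.prems(1) sH] by blast
    have "\<exists>l. has_dim (\<cdot>) B l {x \<in> ?H. f x = 0} \<and> m \<le> l + r"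
      by (rule has_dim_Suc.IH[OF m(1)]) (use f in \<open>auto intro: linear_over_subset\<close>)
    moreover have "{x \<in> ?H. f x = 0} = {x \<in> W. f x = 0}" using subspace_over_zero[OF sU] by auto
    ultimately show ?case using m(2) by auto
  qed
  then show thesis using that by blast
qed

lemma functional_along:
  assumes B: "division_subring B" and H: "subspace_over (\<cdot>) B H" and v: "v \<notin> H"
  obtains f where "linear_over (\<cdot>) (*) B (adjoin (\<cdot>) B H v) f" "f ` adjoin (\<cdot>) B H v \<subseteq> B"
    "\<And>x. x \<in> adjoin (\<cdot>) B H v \<Longrightarrow> f x = 0 \<longleftrightarrow> x \<in> H"
proof -
  let ?M = "adjoin (\<cdot>) B H v"
  have "\<exists>b\<in>B. x - v \<cdot> b \<in> H" if "x \<in> ?M" for x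
    using that by (rule adjoinE) (metis add_diff_cancel_right')
  then obtain f where f: "\<And>x. x \<in> ?M \<Longrightarrow> f x \<in> B" "\<And>x. x \<in> ?M \<Longrightarrow> x - v \<cdot> f x \<in> H" by metis
  have unique: "f x = b" if x: "x \<in> ?M" and b: "b \<in> B" "x - v \<cdot> b \<in> H" for x b
  proof -
    have "v \<cdot> (f x - b) = (x - v \<cdot> b) - (x - v \<cdot> f x)" by (simp add: act_diff_right)
    also have "\<dots> \<in> H" by (intro subspace_over_diff[OF B H] b f x)
    finally have "f x - b = 0"
      using subspace_over_act_cancel[OF B H division_subring_diff[OF B f(1)[OF x] b(1)]] v by blast
    then show ?thesis by simp
  qed
  note sM = subspace_over_adjoin[OF B H, of v]
  have "f (x + y) = f x + f y" if x: "x \<in> ?M" and y: "y \<in> ?M" for x y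
  proof (rule unique[OF subspace_over_add[OF sM x y]])
    have "x + y - v \<cdot> (f x + f y) = (x - v \<cdot> f x) + (y - v \<cdot> f y)" by (simp add: act_add_right)
    then show "x + y - v \<cdot> (f x + f y) \<in> H" using subspace_over_add[OF H f(2)[OF x] f(2)[OF y]] by (simp only:)
  qed (use f x y B in \<open>simp add: division_subring_closed\<close>)
  moreover have "f (x \<cdot> b) = f x * b" if x: "x \<in> ?M" and b: "b \<in> B" for x b
  proof (rule unique[OF subspace_over_act[OF sM x b]])
    have "x \<cdot> b - v \<cdot> (f x * b) = (x - v \<cdot> f x) \<cdot> b"
      using act_add_left[of "x - v \<cdot> f x" "v \<cdot> f x" b] by (simp add: act_mult)
    then show "x \<cdot> b - v \<cdot> (f x * b) \<in> H" using subspace_over_act[OF H f(2)[OF x] b] by simp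
  qed (use f x b B in \<open>simp add: division_subring_closed\<close>)
  ultimately have "linear_over (\<cdot>) (*) B ?M f" unfolding linear_over_def by blast
  moreover have "f x = 0 \<longleftrightarrow> x \<in> H" if x: "x \<in> ?M" for x
    using f(2)[OF x] unique[OF x division_subring_zero[OF B]] by auto
  ultimately show thesis using that f(1) by blast
qed

lemma functional_vanishing_on:
  assumes B: "division_subring B" and M: "has_dim (\<cdot>) B (Suc n) M" and N: "subspace_over (\<cdot>) B N" "N \<subset> M"
  obtains f where "linear_over (\<cdot>) (*) B M f" "f ` M \<subseteq> B" "\<And>x. x \<in> N \<Longrightarrow> f x = 0"
    "has_dim (\<cdot>) B n {x \<in> M. f x = 0}"
proof -
  note sM = has_dim_subspace[OF M B]
  obtain T where T: "subspace_over (\<cdot>) B T" "N \<inter> T = {0}" "M = N + T"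
    using has_dim_complementE[OF B M N(1)] N(2) by blast
  have "T \<subseteq> M" unfolding T(3) using set_plus_intro[OF subspace_over_zero[OF N(1)]] by fastforce
  then obtain k where k: "has_dim (\<cdot>) B k T" using has_dim_subspaceE[OF M B T(1)] by blast
  have "T \<noteq> {0}" using T(3) N(2) by auto
  then obtain l where "k = Suc l" using k by (cases k) (auto simp: has_dim_0_iff)
  then obtain T0 v where T0: "T = adjoin (\<cdot>) B T0 v" "has_dim (\<cdot>) B l T0" "v \<notin> T0"
    using k by (metis has_dim_SucE)
  let ?H = "N + T0"
  have M_eq: "M = adjoin (\<cdot>) B ?H v" unfolding T(3) T0(1) adjoin_def by (simp add: add.assoc)
  note sT0 = has_dim_subspace[OF T0(2) B]
  have sH: "subspace_over (\<cdot>) B ?H" by (rule subspace_over_set_plus[OF N(1) sT0])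
  have v: "v \<notin> ?H"
  proof
    assume "v \<in> ?H"
    then obtain x t where v: "v = x + t" "x \<in> N" "t \<in> T0" by (rule set_plus_elim)
    have "v - t \<in> T"
      unfolding T0(1) by (intro subspace_over_diff[OF B subspace_over_adjoin[OF B sT0]] adjoin_new[OF B sT0]
          subsetD[OF adjoin_superset[OF B] v(3)])
    then have "x = 0" using v T(2) by auto
    then show False using v T0(3) by simp
  qed
  obtain f where f: "linear_over (\<cdot>) (*) B M f" "f ` M \<subseteq> B" "\<And>x. x \<in> M \<Longrightarrow> f x = 0 \<longleftrightarrow> x \<in> ?H"
    by (rule functional_along[OF B sH v, folded M_eq]) (rule that)
  have HM: "?H \<subseteq> M" unfolding M_eq by (rule adjoin_superset[OF B])
  obtain h where h: "has_dim (\<cdot>) B h ?H" using has_dim_subspaceE[OF M B sH HM] .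
  then have "h = n" using has_dim_unique[OF B M has_dim_Suc[OF h v, folded M_eq]] by simp
  moreover have "{x \<in> M. f x = 0} = ?H" using f(3) HM by blast
  moreover have "N \<subseteq> ?H" using set_plus_intro[OF _ subspace_over_zero[OF sT0]] by fastforce
  ultimately show thesis using that[OF f(1,2)] f(3) HM h by (metis subsetD)
qed

lemma has_dim_extend_scalarsE:
  assumes B: "division_subring B" and W: "has_dim (\<cdot>) B n W"
    and B': "division_subring B'" "B \<subseteq> B'" "subspace_over (\<cdot>) B' W"
  obtains t where "has_dim (\<cdot>) B' t W"
proof -
  let ?P = "\<lambda>U. U \<subseteq> W \<and> (\<exists>t. has_dim (\<cdot>) B' t U)"
  have "?P {0}" using has_dim_0[of "(\<cdot>)" B'] subspace_over_zero[OF B'(3)] by blast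
  moreover have "subspace_over (\<cdot>) B U \<and> U \<subseteq> W" if "?P U" for U
    using that has_dim_subspace[OF _ B'(1)] subspace_over_mono[OF _ B'(2)] by blast
  ultimately obtain U where U: "?P U" and max: "\<And>U'. ?P U' \<Longrightarrow> U \<subseteq> U' \<Longrightarrow> U' = U"
    using ex_maximal_subspace[OF B W, of ?P] by metis
  then obtain t where t: "has_dim (\<cdot>) B' t U" by blast
  have "W \<subseteq> U"
  proof
    fix v assume v: "v \<in> W"
    show "v \<in> U"
    proof (rule ccontr)
      assume "v \<notin> U"
      then have "?P (adjoin (\<cdot>) B' U v)"
        using has_dim_Suc[OF t, of v] adjoin_least[OF B'(3) _ v, of U] U by blast
      then have "adjoin (\<cdot>) B' U v = U" by (rule max) (rule adjoin_superset[OF B'(1)])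
      then show False using adjoin_new[OF B'(1) has_dim_subspace[OF t B'(1)], of v] \<open>v \<notin> U\<close> by simp
    qed
  qed
  then have "U = W" using U by blast
  then show thesis using that t by blast
qed

end

lemma right_module_times: "right_module ((*) :: 'r::ring_1 \<Rightarrow> 'r \<Rightarrow> 'r)"
  by unfold_locales (auto simp: algebra_simps)

interpretation ring: right_module "(*) :: 'r::ring_1 \<Rightarrow> 'r \<Rightarrow> 'r"
  by (rule right_module_times)

lemma has_dim_self:
  fixes B :: "'r::ring_1 set"
  assumes "division_subring B" shows "has_dim (*) B 1 B"
proof -
  have "has_dim (*) B 1 (adjoin (*) B {0} 1)" using has_dim_Suc[OF has_dim_0[of "(*)" B], of 1] by simp
  moreover have "adjoin (*) B {0} 1 = B" unfolding adjoin_def set_plus_def by auto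
  ultimately show ?thesis by simp
qed

lemma (in right_module) has_dim_tower:
  assumes B: "division_subring B" "has_dim (*) B k B'" and B': "division_subring B'" "B \<subseteq> B'"
    and W: "has_dim (\<cdot>) B' t W"
  shows "has_dim (\<cdot>) B (k * t) W"
  using W
proof (induction rule: has_dim.induct)
  case has_dim_0
  then show ?case by (simp add: has_dim_0_iff)
next
  case (has_dim_Suc t T v)
  note sT = has_dim_subspace[OF has_dim_Suc.hyps(1) B'(1)]
  have inj: "b = 0" if "b \<in> B'" "v \<cdot> b \<in> T" for b
    using subspace_over_act_cancel[OF B'(1) sT that(1) _ that(2)] \<open>v \<notin> T\<close> by blast
  have "has_dim (\<cdot>) B k ((\<cdot>) v ` B')"
    by (rule ring.has_dim_image[OF B(1,2) right_module_axioms])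
      (use inj subspace_over_zero[OF sT] in \<open>auto simp: linear_over_def act_add_right act_mult\<close>)
  moreover have "T \<inter> (\<cdot>) v ` B' \<subseteq> {0}" using inj act_zero_right by force
  ultimately have "has_dim (\<cdot>) B (k * t + k) (T + (\<cdot>) v ` B')"
    by (intro has_dim_direct_sum[OF B(1) has_dim_Suc.IH])
  then show ?case by (simp add: adjoin_def add.commute)
qed

definition pointwise_act :: "(nat \<Rightarrow> 'r::ring_1) \<Rightarrow> 'r \<Rightarrow> nat \<Rightarrow> 'r" where
  "pointwise_act v d = (\<lambda>i. v i * d)"

definition coordinate_space :: "'r::ring_1 set \<Rightarrow> nat \<Rightarrow> (nat \<Rightarrow> 'r) set" where
  "coordinate_space D n = {v. (\<forall>i<n. v i \<in> D) \<and> (\<forall>i\<ge>n. v i = 0)}"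

lemma right_module_pointwise_act: "right_module pointwise_act"
  by unfold_locales (auto simp: pointwise_act_def fun_eq_iff algebra_simps)

lemma has_dim_coordinate_space:
  assumes "division_subring D"
  shows "has_dim pointwise_act D n (coordinate_space D n)"
proof (induction n)
  case 0
  have "coordinate_space D 0 = {0}" by (auto simp: coordinate_space_def fun_eq_iff)
  then show ?case by (simp add: has_dim_0)
next
  case (Suc n)
  let ?e = "\<lambda>k. if k = n then 1 else 0 :: 'a"
  have "?e \<notin> coordinate_space D n" by (auto simp: coordinate_space_def)
  then have "has_dim pointwise_act D (Suc n) (adjoin pointwise_act D (coordinate_space D n) ?e)"
    by (rule has_dim_Suc[OF Suc.IH])
  moreover have "adjoin pointwise_act D (coordinate_space D n) ?e = coordinate_space D (Suc n)"
  proof (intro equalityI subsetI)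
    fix v assume v: "v \<in> coordinate_space D (Suc n)"
    have "v = (v(n := 0)) + pointwise_act ?e (v n)" by (auto simp: fun_eq_iff pointwise_act_def)
    also have "\<dots> \<in> adjoin pointwise_act D (coordinate_space D n) ?e"
      by (rule adjoinI) (use v in \<open>auto simp: coordinate_space_def\<close>)
    finally show "v \<in> adjoin pointwise_act D (coordinate_space D n) ?e" .
  next
    fix v assume "v \<in> adjoin pointwise_act D (coordinate_space D n) ?e"
    then show "v \<in> coordinate_space D (Suc n)"
      by (auto elim!: adjoinE simp: coordinate_space_def pointwise_act_def less_Suc_eq)
  qed
  ultimately show ?case by simp
qed

section \<open>Totally isotropic subspaces\<close>

locale reflexive_form = right_module act
  for act :: "'v::ab_group_add \<Rightarrow> 'r::ring_1 \<Rightarrow> 'v" (infixl "\<cdot>" 80) +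
  fixes F :: "'r set" and W :: "'v set" and g :: "'v \<Rightarrow> 'v \<Rightarrow> 'r"
  assumes F: "division_subring F" and W: "subspace_over (\<cdot>) F W"
    and form_mem: "x \<in> W \<Longrightarrow> y \<in> W \<Longrightarrow> g x y \<in> F"
    and form_add_left: "x \<in> W \<Longrightarrow> y \<in> W \<Longrightarrow> z \<in> W \<Longrightarrow> g (x + y) z = g x z + g y z"
    and form_linear_right: "x \<in> W \<Longrightarrow> linear_over (\<cdot>) (*) F W (g x)"
    and form_reflexive: "x \<in> W \<Longrightarrow> y \<in> W \<Longrightarrow> g x y = 0 \<Longrightarrow> g y x = 0"
begin

lemma form_add_right: "x \<in> W \<Longrightarrow> y \<in> W \<Longrightarrow> z \<in> W \<Longrightarrow> g x (y + z) = g x y + g x z"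
  and form_act_right: "x \<in> W \<Longrightarrow> y \<in> W \<Longrightarrow> c \<in> F \<Longrightarrow> g x (y \<cdot> c) = g x y * c"
  using linear_over_add[OF form_linear_right] linear_over_act[OF form_linear_right] by blast+

lemma form_zero_left: "y \<in> W \<Longrightarrow> g 0 y = 0"
  using form_add_left[of 0 0 y] subspace_over_zero[OF W] by simp

lemma reflexive_form_subset:
  assumes "subspace_over (\<cdot>) F U" "U \<subseteq> W" shows "reflexive_form (\<cdot>) F U g"
  by unfold_locales
    (use F assms form_mem form_add_left form_reflexive linear_over_subset[OF form_linear_right] in \<open>auto simp: subset_iff\<close>)

definition perp :: "'v set \<Rightarrow> 'v set" where
  "perp T = {w \<in> W. \<forall>t\<in>T. g t w = 0}"

lemma perp_adjoin:
  assumes T: "subspace_over (\<cdot>) F T" "T \<subseteq> W" and v: "v \<in> W"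
  shows "perp (adjoin (\<cdot>) F T v) = {w \<in> perp T. g v w = 0}"
proof (intro equalityI subsetI)
  fix w assume w: "w \<in> {w \<in> perp T. g v w = 0}"
  have "g t w = 0" if t_mem: "t \<in> adjoin (\<cdot>) F T v" for t
  proof -
    obtain s c where t: "t = s + v \<cdot> c" "s \<in> T" "c \<in> F" using t_mem by (rule adjoinE)
    have vc: "v \<cdot> c \<in> W" using subspace_over_act[OF W v t(3)] .
    have "g w v = 0" using form_reflexive[OF v] w unfolding perp_def by blast
    then have "g w (v \<cdot> c) = 0" using form_act_right[of w v c] w v t(3) by (simp add: perp_def)
    then have "g (v \<cdot> c) w = 0" using form_reflexive vc w unfolding perp_def by blast
    then show ?thesis using form_add_left[of s "v \<cdot> c" w] t T vc w by (auto simp: perp_def)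
  qed
  then show "w \<in> perp (adjoin (\<cdot>) F T v)" using w unfolding perp_def by blast
next
  fix w assume "w \<in> perp (adjoin (\<cdot>) F T v)"
  then show "w \<in> {w \<in> perp T. g v w = 0}"
    using adjoin_new[OF F T(1), of v] adjoin_superset[OF F, of T v] unfolding perp_def by blast
qed

lemma has_dim_perp:
  assumes m: "has_dim (\<cdot>) F m W" and T: "has_dim (\<cdot>) F d T" "T \<subseteq> W"
  shows "\<exists>k. has_dim (\<cdot>) F k (perp T) \<and> m \<le> k + d"
  using T
proof (induction rule: has_dim.induct)
  case has_dim_0
  have "perp {0} = W" unfolding perp_def by (auto simp: form_zero_left)
  then show ?case using m by auto
next
  case (has_dim_Suc d T v)
  note sT = has_dim_subspace[OF has_dim_Suc.hyps(1) F]
  have TW: "T \<subseteq> W" using has_dim_Suc.prems adjoin_superset[OF F] by blast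
  have vW: "v \<in> W" using has_dim_Suc.prems adjoin_new[OF F sT] by blast
  obtain k where k: "has_dim (\<cdot>) F k (perp T)" "m \<le> k + d" using has_dim_Suc.IH TW by blast
  have "perp T \<subseteq> W" unfolding perp_def by blast
  then obtain l where "has_dim (\<cdot>) F l {w \<in> perp T. g v w = 0}" "k \<le> l + 1"
    using has_dim_kernel[OF F k(1) has_dim_self[OF F] right_module_times
        linear_over_subset[OF form_linear_right[OF vW]]] form_mem[OF vW] by blast
  then show ?case using k(2) perp_adjoin[OF sT TW vW] by (intro exI[of _ l]) simp
qed

definition has_adjoints :: "'r set \<Rightarrow> bool" where
  "has_adjoints B \<longleftrightarrow> (\<forall>b\<in>B. \<exists>b'\<in>B. \<forall>x\<in>W. \<forall>y\<in>W. g (x \<cdot> b) y = g x (y \<cdot> b'))"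

definition totally_isotropic :: "'v set \<Rightarrow> bool" where
  "totally_isotropic T \<longleftrightarrow> T \<subseteq> W \<and> (\<forall>x\<in>T. \<forall>y\<in>T. g x y = 0)"

lemma perp_act:
  assumes B: "subspace_over (\<cdot>) B W" "has_adjoints B" and T: "subspace_over (\<cdot>) B T" "T \<subseteq> W"
    and w: "w \<in> perp T" and b: "b \<in> B"
  shows "w \<cdot> b \<in> perp T"
proof -
  have wW: "w \<in> W" using w by (simp add: perp_def)
  obtain b' where b': "b' \<in> B" "\<forall>x\<in>W. \<forall>y\<in>W. g (x \<cdot> b) y = g x (y \<cdot> b')"
    using B(2) b unfolding has_adjoints_def by blast
  have "g t (w \<cdot> b) = 0" if t: "t \<in> T" for t
  proof -
    have tb: "t \<cdot> b' \<in> T" using subspace_over_act[OF T(1) t b'(1)] .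
    then have "g (t \<cdot> b') w = 0" using w by (simp add: perp_def)
    then have "g w (t \<cdot> b') = 0" using form_reflexive tb wW T(2) by blast
    then have "g (w \<cdot> b) t = 0" using b'(2) t wW T(2) by auto
    then show ?thesis using form_reflexive subspace_over_act[OF B(1) wW b] t T(2) by blast
  qed
  then show ?thesis using subspace_over_act[OF B(1) wW b] by (simp add: perp_def)
qed

lemma totally_isotropic_adjoin:
  assumes B: "division_subring B" "subspace_over (\<cdot>) B W" "has_adjoints B"
    and T: "totally_isotropic T" "subspace_over (\<cdot>) B T"
    and v: "v \<in> perp T" "\<And>b. b \<in> B \<Longrightarrow> g (v \<cdot> b) v = 0"
  shows "totally_isotropic (adjoin (\<cdot>) B T v)"
  unfolding totally_isotropic_def
proof (intro conjI ballI)
  have TW: "T \<subseteq> W" and vW: "v \<in> W" using T(1) v(1) by (auto simp: totally_isotropic_def perp_def)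
  then show "adjoin (\<cdot>) B T v \<subseteq> W" by (intro adjoin_least[OF B(2)])
  fix x y assume xy: "x \<in> adjoin (\<cdot>) B T v" "y \<in> adjoin (\<cdot>) B T v"
  obtain t b where x: "x = t + v \<cdot> b" "t \<in> T" "b \<in> B" using xy(1) by (rule adjoinE)
  obtain t' b' where y: "y = t' + v \<cdot> b'" "t' \<in> T" "b' \<in> B" using xy(2) by (rule adjoinE)
  have perp: "g s (v \<cdot> c) = 0" "g (v \<cdot> c) s = 0" "v \<cdot> c \<in> W" if "s \<in> T" "c \<in> B" for s c
    using perp_act[OF B(2,3) T(2) TW v(1) that(2)] that(1) form_reflexive TW by (auto simp: perp_def)
  obtain a where a: "a \<in> B" "\<forall>x\<in>W. \<forall>y\<in>W. g (x \<cdot> b) y = g x (y \<cdot> a)"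
    using B(3) x(3) unfolding has_adjoints_def by blast
  have ba: "b' * a \<in> B" using y(3) a(1) B(1) by (simp add: division_subring_closed)
  have "g (v \<cdot> b) (v \<cdot> b') = g v (v \<cdot> (b' * a))" using a vW perp(3)[OF x(2) y(3)] by (simp add: act_mult)
  also have "\<dots> = 0" using form_reflexive[OF perp(3)[OF x(2) ba] vW] v(2)[OF ba] by simp
  finally have diag: "g (v \<cdot> b) (v \<cdot> b') = 0" .
  have "g x y = (g t t' + g t (v \<cdot> b')) + (g (v \<cdot> b) t' + g (v \<cdot> b) (v \<cdot> b'))"
    unfolding x(1) y(1) using x(2) y(2) TW perp(3)[OF x(2) x(3)] perp(3)[OF y(2) y(3)] subspace_over_add[OF W]
    by (simp add: form_add_left form_add_right subset_iff)
  then show "g x y = 0"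
    using diag perp x y T(1) by (simp add: totally_isotropic_def)
qed

lemma totally_isotropic_complementE:
  assumes B: "division_subring B" "F \<subseteq> B" "subspace_over (\<cdot>) B W" "has_adjoints B"
    and T: "totally_isotropic T" "subspace_over (\<cdot>) B T" and dims: "has_dim (\<cdot>) F m W" "has_dim (\<cdot>) F d T"
  obtains T' k where "subspace_over (\<cdot>) B T'" "T' \<subseteq> perp T" "T \<inter> T' = {0}" "has_dim (\<cdot>) F k T'" "m \<le> k + 2 * d"
proof -
  have TW: "T \<subseteq> W" using T(1) by (simp add: totally_isotropic_def)
  obtain k where k: "has_dim (\<cdot>) F k (perp T)" "m \<le> k + d" using has_dim_perp[OF dims TW] by blast
  have perp: "subspace_over (\<cdot>) B (perp T)"
    using has_dim_subspace[OF k(1) F] perp_act[OF B(3,4) T(2) TW] unfolding subspace_over_def by blast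
  obtain e where e: "has_dim (\<cdot>) B e (perp T)" using has_dim_extend_scalarsE[OF F k(1) B(1,2) perp] .
  have "T \<subseteq> perp T" using T(1) unfolding totally_isotropic_def perp_def by blast
  then obtain T' where T': "subspace_over (\<cdot>) B T'" "T \<inter> T' = {0}" "perp T = T + T'"
    using has_dim_complementE[OF B(1) e T(2)] by blast
  have sub: "T' \<subseteq> perp T" unfolding T'(3) using set_plus_intro[OF subspace_over_zero[OF T(2)]] by fastforce
  obtain k' where k': "has_dim (\<cdot>) F k' T'"
    using has_dim_subspaceE[OF k(1) F subspace_over_mono[OF T'(1) B(2)] sub] by blast
  have "has_dim (\<cdot>) F (d + k') (perp T)"
    unfolding T'(3) by (rule has_dim_direct_sum[OF F dims(2) k']) (use T'(2) in blast)
  then have "k = d + k'" using has_dim_unique[OF F _ k(1)] by blast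
  then show thesis using that[OF T'(1) sub T'(2) k'] k(2) by linarith
qed

lemma totally_isotropic_subspaceE:
  assumes B: "division_subring B" "F \<subseteq> B" "subspace_over (\<cdot>) B W" "has_adjoints B"
    and m: "has_dim (\<cdot>) F m W"
    and iso: "\<And>U k. U \<subseteq> W \<Longrightarrow> subspace_over (\<cdot>) B U \<Longrightarrow> has_dim (\<cdot>) F k U \<Longrightarrow> c < k \<Longrightarrow>
      \<exists>v\<in>U. v \<noteq> 0 \<and> (\<forall>b\<in>B. g (v \<cdot> b) v = 0)"
  obtains T d where "totally_isotropic T" "subspace_over (\<cdot>) B T" "has_dim (\<cdot>) F d T" "m \<le> c + 2 * d"
proof -
  let ?P = "\<lambda>T. totally_isotropic T \<and> subspace_over (\<cdot>) B T"
  have "?P {0}"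
    using subspace_over_zero[OF W] form_zero_left subspace_over_singleton_zero by (simp add: totally_isotropic_def)
  moreover have "subspace_over (\<cdot>) F U \<and> U \<subseteq> W" if "?P U" for U
    using that subspace_over_mono[OF _ B(2)] by (auto simp: totally_isotropic_def)
  ultimately obtain T where T: "?P T" and max: "\<And>T'. ?P T' \<Longrightarrow> T \<subseteq> T' \<Longrightarrow> T' = T"
    using ex_maximal_subspace[OF F m, of ?P] by metis
  then have TW: "T \<subseteq> W" and sT: "subspace_over (\<cdot>) B T" by (auto simp: totally_isotropic_def)
  obtain d where d: "has_dim (\<cdot>) F d T" using has_dim_subspaceE[OF m F subspace_over_mono[OF sT B(2)] TW] .
  obtain T' k where T': "subspace_over (\<cdot>) B T'" "T' \<subseteq> perp T" "T \<inter> T' = {0}" "has_dim (\<cdot>) F k T'" "m \<le> k + 2 * d"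
    using totally_isotropic_complementE[OF B _ sT m d] T by blast
  have "k \<le> c"
  proof (rule ccontr)
    assume "\<not> k \<le> c"
    then obtain v where v: "v \<in> T'" "v \<noteq> 0" "\<forall>b\<in>B. g (v \<cdot> b) v = 0"
      using iso[OF _ T'(1,4)] T'(2) by (auto simp: perp_def)
    have "totally_isotropic (adjoin (\<cdot>) B T v)"
      by (rule totally_isotropic_adjoin[OF B(1,3,4)]) (use T v T'(2) in auto)
    then have "adjoin (\<cdot>) B T v = T"
      using max subspace_over_adjoin[OF B(1) sT] adjoin_superset[OF B(1)] by blast
    then have "v \<in> T" using adjoin_new[OF B(1) sT, of v] by simp
    then show False using v T'(3) by blast
  qed
  then have "m \<le> c + 2 * d" using T'(5) by linarith
  then show thesis using that T d by blast
qed

lemma orthogonal_complementE: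
  assumes v: "v \<in> W" "g v v \<noteq> 0" and w: "w \<in> W"
  obtains c where "c \<in> F" "g v (w - v \<cdot> c) = 0"
proof -
  obtain p where p: "p \<in> F" "g v v * p = 1" using division_subring_inverseE[OF F form_mem[OF v(1,1)] v(2)] by metis
  have c: "p * g v w \<in> F" by (rule division_subring_mult[OF F p(1) form_mem[OF v(1) w]])
  have "g v (w - v \<cdot> (p * g v w)) = g v w - g v v * (p * g v w)"
    using linear_over_diff[OF F W form_linear_right[OF v(1)] w subspace_over_act[OF W v(1) c]]
      form_act_right[OF v(1,1) c] by simp
  then show thesis using that c p(2) by (simp flip: mult.assoc)
qed

context
  assumes form_sym: "\<And>x y. x \<in> W \<Longrightarrow> y \<in> W \<Longrightarrow> g x y = g y x"
    and F_square_roots: "\<And>a. a \<in> F \<Longrightarrow> \<exists>b\<in>F. b * b = a"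
begin

lemma form_square_sum:
  assumes v: "v \<in> W" "w \<in> W" "g v w = 0" and f: "f \<in> F"
  shows "g (v \<cdot> f + w) (v \<cdot> f + w) = g v v * f * f + g w w"
proof -
  let ?x = "v \<cdot> f + w"
  have vf: "v \<cdot> f \<in> W" and x: "?x \<in> W" using subspace_over_act[OF W v(1) f] subspace_over_add[OF W _ v(2)] by auto
  have "g ?x ?x = g v ?x * f + g w ?x"
    using form_add_right[OF x vf v(2)] form_act_right[OF x v(1) f] form_sym[OF x v(1)] form_sym[OF x v(2)] by simp
  also have "g v ?x = g v v * f" using form_add_right[OF v(1) vf v(2)] form_act_right[OF v(1,1) f] v(3) by simp
  also have "g w ?x = g w w"
    using form_add_right[OF v(2) vf v(2)] form_act_right[OF v(2,1) f] form_sym[OF v(2,1)] v(3) by simp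
  finally show ?thesis .
qed

lemma isotropic_vector_of_square_roots:
  assumes m: "has_dim (\<cdot>) F m W" "2 \<le> m"
  shows "\<exists>v\<in>W. v \<noteq> 0 \<and> g v v = 0"
proof -
  obtain v where v: "v \<in> W" "v \<noteq> 0" using ex_nonzero_of_dim_pos[OF F m(1)] m(2) by auto
  let ?L = "adjoin (\<cdot>) F {0} v"
  have L: "has_dim (\<cdot>) F (Suc 0) ?L" using has_dim_Suc[OF has_dim_0, of v] v(2) by simp
  note sL = has_dim_subspace[OF L F]
  have vL: "v \<cdot> c \<in> ?L" if "c \<in> F" for c
    using subspace_over_act[OF sL adjoin_new[OF F subspace_over_singleton_zero] that] .
  show ?thesis
  proof (cases "g v v = 0")
    case False
    have "\<not> W \<subseteq> ?L" using has_dim_mono[OF F L m(1)] m(2) by auto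
    then obtain w where w: "w \<in> W" "w \<notin> ?L" by blast
    obtain c where c: "c \<in> F" "g v (w - v \<cdot> c) = 0" using orthogonal_complementE[OF v(1) False w(1)] .
    let ?w = "w - v \<cdot> c"
    have w': "?w \<in> W" by (rule subspace_over_diff[OF F W w(1) subspace_over_act[OF W v(1) c(1)]])
    have w'L: "?w \<notin> ?L" using subspace_over_add[OF sL _ vL[OF c(1)], of ?w] w(2) by auto
    obtain p where p: "p \<in> F" "g v v * p = 1" using division_subring_inverseE[OF F form_mem[OF v(1,1)] False] by metis
    obtain f where f: "f \<in> F" "f * f = - (p * g ?w ?w)"
      using F_square_roots p(1) form_mem[OF w' w'] F by (meson division_subring_minus division_subring_mult)
    have "g v v * f * f + g ?w ?w = 0" using f(2) p(2) by (simp add: mult.assoc) (simp flip: mult.assoc)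
    then have "g (v \<cdot> f + ?w) (v \<cdot> f + ?w) = 0" using form_square_sum[OF v(1) w' c(2) f(1)] by simp
    moreover have "v \<cdot> f + ?w \<noteq> 0"
    proof
      assume "v \<cdot> f + ?w = 0"
      then have "?w = v \<cdot> (- f)" by (simp add: act_minus_right eq_neg_iff_add_eq_0 add.commute)
      then show False using w'L vL[OF division_subring_minus[OF F f(1)]] by simp
    qed
    moreover have "v \<cdot> f + ?w \<in> W" by (rule subspace_over_add[OF W subspace_over_act[OF W v(1) f(1)] w'])
    ultimately show ?thesis by blast
  qed (use v in blast)
qed

lemma form_act_commute:
  assumes "x \<in> W" "y \<in> W" "b \<in> F" shows "g (x \<cdot> b) y = g x (y \<cdot> b)"
proof -
  have "g (x \<cdot> b) y = g y (x \<cdot> b)" using form_sym subspace_over_act[OF W assms(1,3)] assms(2) by simp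
  then show ?thesis using form_act_right assms form_sym[OF assms(1,2)] by simp
qed

end

lemma totally_isotropic_of_square_rootsE:
  assumes sym: "\<And>x y. x \<in> W \<Longrightarrow> y \<in> W \<Longrightarrow> g x y = g y x"
    and sqrt: "\<And>a. a \<in> F \<Longrightarrow> \<exists>b\<in>F. b * b = a"
    and m: "has_dim (\<cdot>) F m W"
  obtains T d where "totally_isotropic T" "has_dim (\<cdot>) F d T" "m \<le> 1 + 2 * d"
proof (rule totally_isotropic_subspaceE[OF F order_refl W _ m])
  show "has_adjoints F"
    unfolding has_adjoints_def using form_act_commute[OF sym sqrt] by blast
  fix U k assume U: "U \<subseteq> W" "subspace_over (\<cdot>) F U" "has_dim (\<cdot>) F k U" "1 < k"
  interpret U: reflexive_form "(\<cdot>)" F U g by (rule reflexive_form_subset[OF U(2,1)])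
  have symU: "g x y = g y x" if "x \<in> U" "y \<in> U" for x y using sym that U(1) by blast
  obtain v where v: "v \<in> U" "v \<noteq> 0" "g v v = 0"
    using U.isotropic_vector_of_square_roots[OF symU sqrt U(3)] U(4) by auto
  have "g (v \<cdot> b) v = 0" if "b \<in> F" for b
    using U.form_act_commute[OF symU sqrt v(1,1) that] U.form_act_right[OF v(1,1) that] v(3) by simp
  then show "\<exists>v\<in>U. v \<noteq> 0 \<and> (\<forall>b\<in>F. g (v \<cdot> b) v = 0)" using v by blast
qed (rule that)

end

lemma (in right_module) reflexive_form_of_symmetric_map:
  assumes E: "division_subring E" and K: "subspace_over (\<cdot>) E K"
    and f: "linear_over act' (*) E M f" "f ` M \<subseteq> E"
    and s: "\<And>x y. x \<in> K \<Longrightarrow> y \<in> K \<Longrightarrow> s x y \<in> M" "\<And>x y. x \<in> K \<Longrightarrow> y \<in> K \<Longrightarrow> s x y = s y x"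
      "\<And>x. x \<in> K \<Longrightarrow> linear_over (\<cdot>) act' E K (s x)"
  shows "reflexive_form (\<cdot>) E K (\<lambda>x y. f (s x y))"
proof
  show "f (s x y) \<in> E" if "x \<in> K" "y \<in> K" for x y using f(2) s(1)[OF that] by blast
  show lin: "linear_over (\<cdot>) (*) E K (\<lambda>y. f (s x y))" if "x \<in> K" for x
    using s(3)[OF that] f(1) s(1)[OF that] by (simp add: linear_over_def)
  show "f (s (x + y) z) = f (s x z) + f (s y z)" if "x \<in> K" "y \<in> K" "z \<in> K" for x y z
    using linear_over_add[OF lin[OF that(3)] that(1,2)] s(2) that subspace_over_add[OF K] by metis
  show "f (s y x) = 0" if "x \<in> K" "y \<in> K" "f (s x y) = 0" for x y using s(2) that by simp
qed (fact E K)+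

lemma (in right_module) symmetric_bilinear_map_isotropic:
  fixes s :: "'v \<Rightarrow> 'v \<Rightarrow> 'w::ab_group_add" and act' :: "'w \<Rightarrow> 'r \<Rightarrow> 'w"
  assumes E: "division_subring E" and sqrt: "\<And>a. a \<in> E \<Longrightarrow> \<exists>b\<in>E. b * b = a"
    and "right_module act'" and N: "has_dim act' E n N"
    and M: "has_dim act' E (n + l) M" "N \<subseteq> M" and K: "has_dim (\<cdot>) E k K" "2 ^ l \<le> k"
    and s: "\<And>x y. x \<in> K \<Longrightarrow> y \<in> K \<Longrightarrow> s x y \<in> M" "\<And>x y. x \<in> K \<Longrightarrow> y \<in> K \<Longrightarrow> s x y = s y x"
      "\<And>x. x \<in> K \<Longrightarrow> linear_over (\<cdot>) act' E K (s x)"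
  shows "\<exists>v\<in>K. v \<noteq> 0 \<and> s v v \<in> N"
  using M K s
proof (induction l arbitrary: k K M)
  case 0
  interpret M': right_module act' by fact
  have "N = M" using M'.has_dim_eqI[OF E _ N] 0(1,2) by simp
  moreover obtain v where "v \<in> K" "v \<noteq> 0" using ex_nonzero_of_dim_pos[OF E 0(3)] 0(4) by auto
  ultimately show ?case using 0(5) by blast
next
  case (Suc l)
  interpret M': right_module act' by fact
  note s_lin = Suc.prems(7)
  have M: "has_dim act' E (Suc (n + l)) M" using Suc.prems(1) by simp
  have "N \<noteq> M" using M'.has_dim_unique[OF E N] M by fastforce
  then obtain f where f: "linear_over act' (*) E M f" "f ` M \<subseteq> E" "\<And>x. x \<in> N \<Longrightarrow> f x = 0"
    "has_dim act' E (n + l) {x \<in> M. f x = 0}"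
    using M'.functional_vanishing_on[OF E M M'.has_dim_subspace[OF N E]] Suc.prems(2) by blast
  interpret form: reflexive_form "(\<cdot>)" E K "\<lambda>x y. f (s x y)"
    by (rule reflexive_form_of_symmetric_map[OF E has_dim_subspace[OF Suc.prems(3) E] f(1,2) Suc.prems(5-7)])
  have sym: "f (s x y) = f (s y x)" if "x \<in> K" "y \<in> K" for x y using Suc.prems(6)[OF that] by simp
  obtain T d where T: "form.totally_isotropic T" "has_dim (\<cdot>) E d T" "k \<le> 1 + 2 * d"
    using form.totally_isotropic_of_square_rootsE[OF sym sqrt Suc.prems(3)] .
  have TK: "T \<subseteq> K" using T(1) by (simp add: form.totally_isotropic_def)
  have "2 ^ l \<le> d" using Suc.prems(4) T(3) by simp
  then have "\<exists>v\<in>T. v \<noteq> 0 \<and> s v v \<in> N"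
  proof (intro Suc.IH[OF f(4) _ T(2)])
    show "N \<subseteq> {x \<in> M. f x = 0}" using f(3) Suc.prems(2) by blast
    show "s x y \<in> {x \<in> M. f x = 0}" if "x \<in> T" "y \<in> T" for x y
      using T(1) Suc.prems(5) that TK by (auto simp: form.totally_isotropic_def subset_iff)
    show "s x y = s y x" if "x \<in> T" "y \<in> T" for x y using Suc.prems(6) that TK by blast
    show "linear_over (\<cdot>) act' E T (s x)" if "x \<in> T" for x using linear_over_subset[OF s_lin TK] that TK by blast
  qed
  then show ?case using TK by blast
qed

section \<open>Extensions of division subrings\<close>

lemma (in right_module) adjoin_unique_zero:
  assumes B: "division_subring B" and W: "subspace_over (\<cdot>) B W" and v: "v \<notin> W"
    and w: "w \<in> W" "b \<in> B" "w + v \<cdot> b = 0"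
  shows "w = 0 \<and> b = 0"
proof -
  have "v \<cdot> b = - w" using w(3) by (simp add: eq_neg_iff_add_eq_0 add.commute)
  then have "v \<cdot> b \<in> W" using subspace_over_minus[OF B W w(1)] by simp
  then have "b = 0" using subspace_over_act_cancel[OF B W w(2)] v by blast
  then show ?thesis using w(3) by simp
qed

lemma division_subring_subspace:
  "division_subring M \<Longrightarrow> B \<subseteq> M \<Longrightarrow> subspace_over (*) B M"
  unfolding subspace_over_def by (auto simp: division_subring_closed)

lemma division_subring_of_has_dim:
  assumes B: "division_subring B" "B \<subseteq> M" and M: "has_dim (*) B m M"
    and mult: "\<And>x y. x \<in> M \<Longrightarrow> y \<in> M \<Longrightarrow> x * y \<in> M"
    and cancel: "\<And>x y. x \<in> M \<Longrightarrow> y \<in> M \<Longrightarrow> x \<noteq> 0 \<Longrightarrow> x * y = 0 \<Longrightarrow> y = 0"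
  shows "division_subring M"
proof -
  have one: "1 \<in> M" using B division_subring_one by blast
  have right_inverse: "\<exists>y\<in>M. x * y = 1" if x: "x \<in> M" "x \<noteq> 0" for x
  proof -
    have "has_dim (*) B m ((*) x ` M)"
    proof (rule ring.has_dim_image[OF B(1) M right_module_times])
      show "linear_over (*) (*) B M ((*) x)" by (simp add: linear_over_def distrib_left mult.assoc)
      show "y = 0" if "y \<in> M" "x * y = 0" for y by (rule cancel[OF x(1) that(1) x(2) that(2)])
    qed
    then have "(*) x ` M = M" using ring.has_dim_eqI[OF B(1) M] mult x(1) by blast
    then show ?thesis using one by (metis imageE)
  qed
  moreover have "\<exists>y\<in>M. x * y = 1 \<and> y * x = 1" if x: "x \<in> M" "x \<noteq> 0" for x
  proof -
    obtain y where y: "y \<in> M" "x * y = 1" using right_inverse[OF x] by blast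
    then obtain z where z: "y * z = 1" using right_inverse[of y] by fastforce
    have "x = x * (y * z)" using z by simp
    also have "\<dots> = z" using y by (simp flip: mult.assoc)
    finally show ?thesis using y z by blast
  qed
  moreover have "x - y \<in> M" if "x \<in> M" "y \<in> M" for x y
    by (rule ring.subspace_over_diff[OF B(1) ring.has_dim_subspace[OF M B(1)] that])
  ultimately show ?thesis using one mult by (simp add: division_subring_def)
qed

abbreviation extension :: "'r::ring_1 set \<Rightarrow> 'r \<Rightarrow> 'r set" where
  "extension B v \<equiv> adjoin (*) B B v"

lemma extension_superset: "division_subring B \<Longrightarrow> B \<subseteq> extension B v"
  by (rule ring.adjoin_superset)

lemma extension_new: "division_subring B \<Longrightarrow> v \<in> extension B v"
  by (rule ring.adjoin_new) (auto intro: division_subring_subspace)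

lemma extension_least: "division_subring M \<Longrightarrow> B \<subseteq> M \<Longrightarrow> v \<in> M \<Longrightarrow> extension B v \<subseteq> M"
  by (rule ring.adjoin_least) (auto intro: division_subring_subspace)

lemma has_dim_extension: "division_subring B \<Longrightarrow> v \<notin> B \<Longrightarrow> has_dim (*) B 2 (extension B v)"
  using has_dim_Suc[OF has_dim_self] by (simp add: numeral_2_eq_2)

lemma extension_commutes:
  assumes "\<And>b. b \<in> B \<Longrightarrow> b * z = z * b" "v * z = z * v" "x \<in> extension B v"
  shows "x * z = z * x"
proof -
  obtain a b where x: "x = a + v * b" "a \<in> B" "b \<in> B" using assms(3) by (rule adjoinE)
  show ?thesis unfolding x(1) by (intro commutes_add commutes_mult assms(1,2) x(2,3))
qed

lemma extension_commutative:
  assumes B: "\<And>x y. x \<in> B \<Longrightarrow> y \<in> B \<Longrightarrow> x * y = y * x" and v: "\<And>x. x \<in> B \<Longrightarrow> x * v = v * x"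
    and xy: "x \<in> extension B v" "y \<in> extension B v"
  shows "x * y = y * x"
proof (rule extension_commutes[OF _ _ xy(1)])
  show "b * y = y * b" if "b \<in> B" for b
    using extension_commutes[of B b v y] B[OF that] v[OF that] xy(2) by metis
  show "v * y = y * v" using extension_commutes[of B v v y] v xy(2) by metis
qed

lemma extension_mult_closed:
  assumes B: "division_subring B" and vv: "v * v \<in> B" and conj: "\<And>b. b \<in> B \<Longrightarrow> \<exists>b'\<in>B. b * v = v * b'"
    and xy: "x \<in> extension B v" "y \<in> extension B v"
  shows "x * y \<in> extension B v"
proof -
  obtain a b where x: "x = a + v * b" "a \<in> B" "b \<in> B" using xy(1) by (rule adjoinE)
  obtain c d where y: "y = c + v * d" "c \<in> B" "d \<in> B" using xy(2) by (rule adjoinE)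
  obtain a' b' where a': "a' \<in> B" "a * v = v * a'" and b': "b' \<in> B" "b * v = v * b'" using conj x by blast
  have "x * y = a * c + (a * v) * d + v * (b * c) + v * (b * v) * d" unfolding x y by (simp add: algebra_simps)
  also have "\<dots> = (a * c + v * v * (b' * d)) + v * (a' * d + b * c)"
    unfolding a' b' by (simp add: algebra_simps)
  also have "\<dots> \<in> extension B v"
    by (rule adjoinI) (use x y a' b' vv B in \<open>auto intro!: division_subring_add division_subring_mult\<close>)
  finally show ?thesis .
qed

lemma quadratic_extension_division_subring:
  assumes B: "division_subring B" and comm: "\<And>b. b \<in> B \<Longrightarrow> b * s = s * b" and ss: "s * s \<in> B"
    and no_root: "\<And>z. z \<in> B \<Longrightarrow> z * z \<noteq> s * s"
  shows "division_subring (extension B s)"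
proof (rule division_subring_of_has_dim[OF B extension_superset[OF B]])
  show "has_dim (*) B 2 (extension B s)" using has_dim_extension[OF B] no_root by blast
  show "x * y \<in> extension B s" if "x \<in> extension B s" "y \<in> extension B s" for x y
    using extension_mult_closed[OF B ss _ that] comm by blast
  fix x y assume x: "x \<in> extension B s" "x \<noteq> 0" and xy: "x * y = 0"
  obtain a b where ab: "x = a + s * b" "a \<in> B" "b \<in> B" using x(1) by (rule adjoinE)
  show "y = 0"
  proof (cases "b = 0")
    case True
    then show ?thesis using division_subring_mult_eq_0(1)[OF B ab(2)] ab(1) x(2) xy by simp
  next
    case False
    obtain c where c: "c \<in> B" "c * b = 1" using division_subring_inverseE[OF B ab(3) False] .
    define z where "z = a * c"
    have z: "z \<in> B" unfolding z_def using ab(2) c(1) B by (simp add: division_subring_mult)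
    have "z * b = a" unfolding z_def using c(2) by (simp add: mult.assoc)
    then have "x = (z + s) * b" using ab(1) comm[OF ab(3)] by (simp add: distrib_right)
    then have "(z - s) * (z + s) * (b * y) = 0" using xy by (simp add: mult.assoc)
    moreover have "(z - s) * (z + s) = z * z - s * s" using comm[OF z] by (simp add: algebra_simps)
    ultimately have "(z * z - s * s) * (b * y) = 0" by simp
    moreover have "z * z - s * s \<in> B" "z * z - s * s \<noteq> 0"
      using z ss B no_root[OF z] by (auto simp: division_subring_closed)
    ultimately have "b * y = 0" using division_subring_mult_eq_0(1)[OF B] by blast
    then show ?thesis using division_subring_mult_eq_0(1)[OF B ab(3) False] by blast
  qed
qed

section \<open>Central division algebras\<close>

definition centralizer :: "'r::ring_1 set \<Rightarrow> 'r set \<Rightarrow> 'r set" where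
  "centralizer D S = {x \<in> D. \<forall>s\<in>S. x * s = s * x}"

definition anticentralizer :: "'r::ring_1 set \<Rightarrow> 'r \<Rightarrow> 'r set" where
  "anticentralizer D a = {x \<in> D. x * a = - (a * x)}"

lemma centralizer_iff: "x \<in> centralizer D S \<longleftrightarrow> x \<in> D \<and> (\<forall>s\<in>S. x * s = s * x)"
  unfolding centralizer_def by simp

lemma anticentralizer_iff: "x \<in> anticentralizer D a \<longleftrightarrow> x \<in> D \<and> x * a = - (a * x)"
  unfolding anticentralizer_def by simp

lemma commutator_anticommutes:
  fixes a :: "'r::ring_1"
  assumes "a * a * y = y * (a * a)"
  shows "(y * a - a * y) * a = - (a * (y * a - a * y))"
  using assms by (simp add: algebra_simps)

lemma anticommuting_mult:
  fixes x :: "'r::ring_1"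
  assumes "x * a = - (a * x)" "y * a = - (a * y)"
  shows "x * y * a = a * (x * y)"
  using assms by (metis minus_minus mult.assoc mult_minus_left mult_minus_right)

lemma anticommuting_inverse:
  fixes w :: "'r::ring_1"
  assumes "w * a = - (a * w)" "w * w' = 1" "w' * w = 1"
  shows "w' * a = - (a * w')"
proof -
  have "w' * a = w' * (a * w) * w'" using assms(2) by (simp add: mult.assoc)
  also have "a * w = - (w * a)" using assms(1) by simp
  also have "w' * (- (w * a)) * w' = - (w' * w * (a * w'))" by (simp add: mult.assoc)
  finally show ?thesis using assms(3) by simp
qed

locale central_division_algebra =
  fixes E D :: "'r::ring_1 set" and N :: nat
  assumes E: "division_subring E" and D: "division_subring D" and E_sub: "E \<subseteq> D"
    and E_central: "\<And>e x. e \<in> E \<Longrightarrow> x \<in> D \<Longrightarrow> e * x = x * e"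
    and center: "\<And>z. z \<in> D \<Longrightarrow> (\<And>x. x \<in> D \<Longrightarrow> z * x = x * z) \<Longrightarrow> z \<in> E"
    and dim_D: "has_dim (*) E N D"
    and two: "(2::'r) \<noteq> 0"
begin

lemma two_in_E: "2 \<in> E"
  using division_subring_add[OF E division_subring_one[OF E] division_subring_one[OF E]] by simp

lemma double_mem: "subspace_over (*) E W \<Longrightarrow> x + x \<in> W \<Longrightarrow> x \<in> W"
  using ring.subspace_over_act_cancel[OF E _ two_in_E two, of W x] by (simp add: mult_2_right)

lemma double_eq_0: "x + x = 0 \<Longrightarrow> x = (0::'r)"
  using double_mem[OF ring.subspace_over_singleton_zero, of x] by simp

lemma eq_minus_self: "x = - x \<Longrightarrow> x = (0::'r)"
  by (rule double_eq_0) (metis add.right_inverse)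

lemma half_exists:
  assumes "subspace_over (*) E W" "x \<in> W"
  obtains t where "t \<in> W" "x = t + t"
proof -
  obtain h where h: "h \<in> E" "h * 2 = 1" using division_subring_inverseE[OF E two_in_E two] .
  have "x = x * h * 2" using h(2) by (simp add: mult.assoc)
  then have "x = x * h + x * h" by (simp add: mult_2_right)
  then show thesis using that subspace_over_act[OF assms h(1)] by blast
qed

lemma has_dim_subspaceE:
  assumes "subspace_over (*) E U" "U \<subseteq> D"
  obtains m where "has_dim (*) E m U"
  using ring.has_dim_subspaceE[OF dim_D E assms] by blast

lemma has_dim_division_subringE:
  assumes "division_subring M" "E \<subseteq> M" "M \<subseteq> D"
  obtains m where "has_dim (*) E m M"
  using has_dim_subspaceE[OF division_subring_subspace[OF assms(1,2)] assms(3)] .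

lemma dim_dvd:
  assumes M: "division_subring M" "E \<subseteq> M" "has_dim (*) E m M"
    and U: "subspace_over (*) M U" "has_dim (*) E k U"
  shows "m dvd k"
proof -
  obtain t where "has_dim (*) M t U" using ring.has_dim_extend_scalarsE[OF E U(2) M(1,2) U(1)] .
  then have "has_dim (*) E (m * t) U" by (rule ring.has_dim_tower[OF E M(3,1,2)])
  then show ?thesis using ring.has_dim_unique[OF E U(2)] by auto
qed

lemma has_dim_1_eq:
  assumes "E \<subseteq> M" "has_dim (*) E 1 M" shows "M = E"
  using ring.has_dim_eqI[OF E assms(2) has_dim_self[OF E] assms(1)] by simp

lemma division_subringI:
  assumes M: "E \<subseteq> M" "M \<subseteq> D" "\<And>x y. x \<in> M \<Longrightarrow> y \<in> M \<Longrightarrow> x - y \<in> M"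
    "\<And>x y. x \<in> M \<Longrightarrow> y \<in> M \<Longrightarrow> x * y \<in> M"
  shows "division_subring M"
proof -
  have zero: "0 \<in> M" using M(1) division_subring_zero[OF E] by blast
  have "x + y \<in> M" if "x \<in> M" "y \<in> M" for x y
    using M(3)[OF that(1) M(3)[OF zero that(2)]] by simp
  then have "subspace_over (*) E M" unfolding subspace_over_def using zero M(1,4) by (simp add: subset_iff)
  then obtain m where m: "has_dim (*) E m M" using has_dim_subspaceE[OF _ M(2)] by metis
  show ?thesis
  proof (rule division_subring_of_has_dim[OF E M(1) m M(4)])
    show "y = 0" if "x \<in> M" "x \<noteq> 0" "x * y = 0" for x y
      using division_subring_mult_eq_0(1)[OF D _ that(2,3)] that(1) M(2) by blast
  qed
qed

lemma E_subset_centralizer: "E \<subseteq> B \<Longrightarrow> S \<subseteq> D \<Longrightarrow> E \<subseteq> centralizer B S"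
  using E_central by (auto simp: centralizer_def)

lemma centralizer_division_subring:
  assumes B: "division_subring B" "E \<subseteq> B" "B \<subseteq> D" and S: "S \<subseteq> D"
  shows "division_subring (centralizer B S)"
  by (rule division_subringI[OF E_subset_centralizer[OF B(2) S]])
    (use B in \<open>auto simp: centralizer_def division_subring_closed commutes_diff commutes_mult\<close>)

lemma centralizer_subset: "centralizer D S \<subseteq> D"
  by (auto simp: centralizer_def)

lemma has_dim_centralizerE:
  assumes "S \<subseteq> D" obtains q where "has_dim (*) E q (centralizer D S)"
  using has_dim_division_subringE[OF centralizer_division_subring[OF D E_sub order_refl assms]
      E_subset_centralizer[OF E_sub assms] centralizer_subset] .

lemma two_sided_relation_trivial:
  fixes b d :: "nat \<Rightarrow> 'r"
  assumes b: "independent_family (*) E n b" "\<And>i. i < n \<Longrightarrow> b i \<in> D"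
    and "\<And>i. d i \<in> D" "\<And>x. x \<in> D \<Longrightarrow> (\<Sum>i<n. d i * x * b i) = 0"
  shows "\<forall>i<n. d i = 0"
  using assms(3,4)
proof (induction "card {i. i < n \<and> d i \<noteq> 0}" arbitrary: d rule: less_induct)
  case less
  show ?case
  proof (rule ccontr)
    assume "\<not> ?thesis"
    then obtain p where p: "p < n" "d p \<noteq> 0" by blast
    obtain z where z: "z \<in> D" "z * d p = 1" using division_subring_inverseE[OF D less.prems(1) p(2)] .
    have zd: "z * d i \<in> D" for i using z(1) less.prems(1) D by (simp add: division_subring_mult)
    have relation: "(\<Sum>i<n. z * d i * x * b i) = 0" if "x \<in> D" for x
      using less.prems(2)[OF that] by (simp add: mult.assoc flip: sum_distrib_left)
    have central: "z * d i \<in> E" if i: "i < n" for i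
    proof (rule center[OF zd])
      fix y assume y: "y \<in> D"
      let ?e = "\<lambda>i. y * (z * d i) - z * d i * y"
      have "?e p = 0" "\<And>i. d i = 0 \<Longrightarrow> ?e i = 0" using z(2) by simp_all
      then have "{i. i < n \<and> ?e i \<noteq> 0} \<subset> {i. i < n \<and> d i \<noteq> 0}" using p by blast
      then have "card {i. i < n \<and> ?e i \<noteq> 0} < card {i. i < n \<and> d i \<noteq> 0}" by (intro psubset_card_mono) auto
      moreover have "?e i \<in> D" for i using zd y D by (simp add: division_subring_closed)
      moreover have "(\<Sum>i<n. ?e i * x * b i) = 0" if x: "x \<in> D" for x
      proof -
        have "(\<Sum>i<n. ?e i * x * b i) = y * (\<Sum>i<n. z * d i * x * b i) - (\<Sum>i<n. z * d i * (y * x) * b i)"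
          by (simp add: algebra_simps sum_subtractf sum_distrib_left)
        then show ?thesis using relation x y D by (simp add: division_subring_mult)
      qed
      ultimately have "\<forall>i<n. ?e i = 0" using less.hyps[of ?e] by blast
      then show "z * d i * y = y * (z * d i)" using i by simp
    qed
    let ?c = "\<lambda>i. if i < n then z * d i else 0"
    have "(\<Sum>i<n. b i * ?c i) = (\<Sum>i<n. z * d i * 1 * b i)"
      by (intro sum.cong refl) (use E_central[OF central b(2)] in auto)
    also have "\<dots> = 0" by (rule relation[OF division_subring_one[OF D]])
    finally have "?c p = 0"
      by (rule independent_familyD[OF b(1), rotated]) (use central division_subring_zero[OF E] p in auto)
    then show False using z p by simp
  qed
qed

lemma dim_D_nonzero: "N \<noteq> 0"
proof
  assume "N = 0"
  then have "D = {0}" using dim_D by (simp add: has_dim_0_iff)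
  then show False using division_subring_one[OF D] by simp
qed

lemma left_linear_system_injective_le:
  fixes a :: "nat \<Rightarrow> nat \<Rightarrow> 'r"
  assumes a: "\<And>i j. i < m \<Longrightarrow> j < n \<Longrightarrow> a i j \<in> D"
    and inj: "\<And>x. (\<And>i. x i \<in> D) \<Longrightarrow> (\<And>j. j < n \<Longrightarrow> (\<Sum>i<m. x i * a i j) = 0) \<Longrightarrow> \<forall>i<m. x i = 0"
  shows "m \<le> n"
proof -
  define f where "f x j = (if j < n then \<Sum>i<m. x i * a i j else 0)" for x :: "nat \<Rightarrow> 'r" and j
  interpret coords: right_module "pointwise_act :: (nat \<Rightarrow> 'r) \<Rightarrow> 'r \<Rightarrow> nat \<Rightarrow> 'r" by (rule right_module_pointwise_act)
  have dims: "has_dim pointwise_act E (N * k) (coordinate_space D k)" for k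
    by (rule coords.has_dim_tower[OF E dim_D D E_sub has_dim_coordinate_space[OF D]])
  have linear: "linear_over pointwise_act pointwise_act E (coordinate_space D m) f"
    unfolding linear_over_def
  proof (intro conjI ballI ext)
    fix x e j assume e: "e \<in> E"
    have "x i * e * a i j = x i * a i j * e" if "i < m" "j < n" for i
      using E_central[OF e a[OF that]] by (simp add: mult.assoc)
    then show "f (pointwise_act x e) j = pointwise_act (f x) e j"
      by (simp add: f_def pointwise_act_def sum_distrib_right)
  qed (simp add: f_def distrib_right sum.distrib)
  have range: "f ` coordinate_space D m \<subseteq> coordinate_space D n"
  proof
    fix w assume "w \<in> f ` coordinate_space D m"
    then obtain x where x: "w = f x" "x \<in> coordinate_space D m" by blast
    have "(\<Sum>i<m. x i * a i j) \<in> D" if "j < n" for j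
      by (rule subspace_over_sum[OF division_subring_subspace[OF D order_refl]])
        (use x(2) a[OF _ that] D in \<open>auto simp: coordinate_space_def intro!: division_subring_mult\<close>)
    then show "w \<in> coordinate_space D n" unfolding x(1) f_def coordinate_space_def by simp
  qed
  have "has_dim pointwise_act E (N * m) (f ` coordinate_space D m)"
  proof (rule coords.has_dim_image[OF E dims right_module_pointwise_act linear])
    fix x assume x: "x \<in> coordinate_space D m" "f x = 0"
    have "x i \<in> D" for i using x(1) division_subring_zero[OF D] by (cases "i < m") (auto simp: coordinate_space_def)
    moreover have "(\<Sum>i<m. x i * a i j) = 0" if "j < n" for j
      using fun_cong[OF x(2), of j] that by (simp add: f_def)
    ultimately have "\<forall>i<m. x i = 0" by (rule inj)
    then show "x = 0" using x(1) by (auto simp: coordinate_space_def fun_eq_iff not_less[symmetric])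
  qed
  then have "N * m \<le> N * n" by (rule coords.has_dim_mono[OF E dims _ range])
  then show ?thesis using dim_D_nonzero by simp
qed

lemma centralizer_dim_le:
  assumes M: "division_subring M" "E \<subseteq> M" "M \<subseteq> D" "has_dim (*) E m M"
    and q: "has_dim (*) E q (centralizer D M)"
  shows "m * q \<le> N"
proof -
  let ?C = "centralizer D M"
  note C = centralizer_division_subring[OF D E_sub order_refl M(3)] E_subset_centralizer[OF E_sub M(3)]
  obtain n where n: "has_dim (*) ?C n D"
    using ring.has_dim_extend_scalarsE[OF E dim_D C division_subring_subspace[OF D centralizer_subset]] .
  have N: "N = q * n" using ring.has_dim_unique[OF E ring.has_dim_tower[OF E q C n] dim_D] .
  obtain y where y: "span_family (*) ?C n y = D" "\<And>j. j < n \<Longrightarrow> y j \<in> D" using ring.has_dim_basisE[OF C(1) n] by metis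
  obtain b where b: "independent_family (*) E m b" "\<And>i. i < m \<Longrightarrow> b i \<in> M" using ring.has_dim_basisE[OF E M(4)] by metis
  have bD: "b i \<in> D" if "i < m" for i using b(2)[OF that] M(3) by blast
  have "m \<le> n"
  proof (rule left_linear_system_injective_le[of m n "\<lambda>i j. y j * b i"])
    show "y j * b i \<in> D" if "i < m" "j < n" for i j using y(2) bD that D by (simp add: division_subring_mult)
    fix x assume x: "\<And>i. x i \<in> D" "\<And>j. j < n \<Longrightarrow> (\<Sum>i<m. x i * (y j * b i)) = 0"
    show "\<forall>i<m. x i = 0"
    proof (rule two_sided_relation_trivial[OF b(1) bD x(1)])
      fix w assume "w \<in> D"
      then obtain c where c: "w = (\<Sum>j<n. y j * c j)" "\<forall>j. c j \<in> ?C" using y(1) by (metis span_familyE)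
      have "c j * b i = b i * c j" if "i < m" for i j using c(2) b(2)[OF that] by (simp add: centralizer_iff)
      then have "(\<Sum>i<m. x i * w * b i) = (\<Sum>i<m. \<Sum>j<n. x i * (y j * b i) * c j)"
        unfolding c(1) by (intro sum.cong refl) (simp add: sum_distrib_left sum_distrib_right mult.assoc)
      also have "\<dots> = (\<Sum>j<n. (\<Sum>i<m. x i * (y j * b i)) * c j)" by (subst sum.swap) (simp add: sum_distrib_right)
      finally show "(\<Sum>i<m. x i * w * b i) = 0" using x(2) by simp
    qed
  qed
  then show ?thesis using N by (simp add: mult.commute)
qed

lemma commutative_dim:
  assumes M: "division_subring M" "E \<subseteq> M" "M \<subseteq> D" "\<And>x y. x \<in> M \<Longrightarrow> y \<in> M \<Longrightarrow> x * y = y * x"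
    and m: "has_dim (*) E m M"
  shows "m * m \<le> N" and "m dvd N"
proof -
  obtain q where q: "has_dim (*) E q (centralizer D M)" using has_dim_centralizerE[OF M(3)] .
  have "M \<subseteq> centralizer D M" using M(3,4) by (auto simp: centralizer_iff)
  then have "m \<le> q" using ring.has_dim_mono[OF E q m] by blast
  then show "m * m \<le> N" using centralizer_dim_le[OF M(1-3) m q] by (meson le_trans mult_le_mono2)
  show "m dvd N" by (rule dim_dvd[OF M(1,2) m division_subring_subspace[OF D M(3)] dim_D])
qed

lemma centralizer_maximal_commutative:
  assumes M: "division_subring M" "E \<subseteq> M" "M \<subseteq> D" "\<And>x y. x \<in> M \<Longrightarrow> y \<in> M \<Longrightarrow> x * y = y * x"
    and m: "has_dim (*) E m M" "N \<le> m * m" "0 < m"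
  shows "centralizer D M = M"
proof -
  obtain q where q: "has_dim (*) E q (centralizer D M)" using has_dim_centralizerE[OF M(3)] .
  have "m * q \<le> m * m" by (rule le_trans[OF centralizer_dim_le[OF M(1-3) m(1) q] m(2)])
  then have "q \<le> m" using m(3) by simp
  moreover have "M \<subseteq> centralizer D M" using M(3,4) by (auto simp: centralizer_iff)
  ultimately show ?thesis using ring.has_dim_eqI[OF E q m(1)] by simp
qed

definition gen :: "'r set \<Rightarrow> 'r set" where
  "gen S = division_subring hull (E \<union> S)"

lemma gen_superset: "E \<subseteq> gen S" "S \<subseteq> gen S"
  using hull_subset[of "E \<union> S" division_subring] unfolding gen_def by auto

lemma gen_least: "division_subring M \<Longrightarrow> E \<subseteq> M \<Longrightarrow> S \<subseteq> M \<Longrightarrow> gen S \<subseteq> M"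
  unfolding gen_def by (rule hull_minimal) auto

lemma gen_mono: "S \<subseteq> T \<Longrightarrow> gen S \<subseteq> gen T"
  unfolding gen_def by (rule hull_mono) auto

lemma gen_subset: "S \<subseteq> D \<Longrightarrow> gen S \<subseteq> D"
  by (rule gen_least[OF D E_sub])

lemma gen_division_subring:
  assumes "S \<subseteq> D" shows "division_subring (gen S)"
  unfolding gen_def hull_def by (rule division_subring_Inter) (use D E_sub assms in auto)

lemma gen_commutes:
  assumes S: "S \<subseteq> D" and z: "z \<in> D" "\<And>s. s \<in> S \<Longrightarrow> s * z = z * s" and x: "x \<in> gen S"
  shows "x * z = z * x"
proof -
  have "gen S \<subseteq> centralizer D {z}"
  proof (rule gen_least)
    show "division_subring (centralizer D {z})"
      using centralizer_division_subring[OF D E_sub order_refl] z(1) by simp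
    show "E \<subseteq> centralizer D {z}" using E_subset_centralizer[OF E_sub] z(1) by simp
    show "S \<subseteq> centralizer D {z}" using S z(2) by (auto simp: centralizer_iff)
  qed
  then show ?thesis using x by (auto simp: centralizer_iff)
qed

lemma gen_commutative:
  assumes S: "S \<subseteq> D" "\<And>s t. s \<in> S \<Longrightarrow> t \<in> S \<Longrightarrow> s * t = t * s" and x: "x \<in> gen S" "y \<in> gen S"
  shows "x * y = y * x"
proof (rule gen_commutes[OF S(1) _ _ x(1)])
  show "s * y = y * s" if "s \<in> S" for s
    using gen_commutes[OF S(1) _ _ x(2), of s] S that by force
qed (use gen_subset[OF S(1)] x(2) in blast)

lemma gen_pair:
  assumes "a \<in> D" "b \<in> D" "b * a = a * b"
  shows "division_subring (gen {a, b})" "gen {a, b} \<subseteq> D" "a \<in> gen {a, b}" "b \<in> gen {a, b}"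
    "\<And>x y. x \<in> gen {a, b} \<Longrightarrow> y \<in> gen {a, b} \<Longrightarrow> x * y = y * x"
proof -
  have ab: "{a, b} \<subseteq> D" using assms(1,2) by simp
  show "division_subring (gen {a, b})" "gen {a, b} \<subseteq> D" by (rule gen_division_subring[OF ab] gen_subset[OF ab])+
  show "a \<in> gen {a, b}" "b \<in> gen {a, b}" using gen_superset(2)[of "{a, b}"] by simp_all
  have comm: "s * t = t * s" if "s \<in> {a, b}" "t \<in> {a, b}" for s t using that assms(3) by auto
  show "x * y = y * x" if "x \<in> gen {a, b}" "y \<in> gen {a, b}" for x y by (rule gen_commutative[OF ab comm that])
qed

lemma gen_pair_diff:
  assumes a: "a \<in> D" "b \<in> D" and t: "t \<in> gen {a}"
  shows "gen {a, b - t} = gen {a, b}"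
proof
  have tD: "t \<in> D" using t gen_subset[of "{a}"] a(1) by blast
  have G: "division_subring (gen {a, x})" "a \<in> gen {a, x}" "x \<in> gen {a, x}" "t \<in> gen {a, x}" if "x \<in> D" for x
    using gen_division_subring[of "{a, x}"] gen_superset(2)[of "{a, x}"] gen_mono[of "{a}" "{a, x}"] a(1) t that by auto
  have bt: "b - t \<in> D" by (rule division_subring_diff[OF D a(2) tD])
  have "b - t \<in> gen {a, b}" by (rule division_subring_diff[OF G(1,3,4)[OF a(2)]])
  then show "gen {a, b - t} \<subseteq> gen {a, b}" using gen_least[OF G(1)[OF a(2)] gen_superset(1)] G(2)[OF a(2)] by simp
  have "b \<in> gen {a, b - t}" by (rule division_subring_diff_cancel[OF G(1,3,4)[OF bt]])
  then show "gen {a, b} \<subseteq> gen {a, b - t}" using gen_least[OF G(1)[OF bt] gen_superset(1)] G(2)[OF bt] by simp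
qed

lemma centralizer_gen:
  assumes "S \<subseteq> D" shows "centralizer D (gen S) = centralizer D S"
proof
  show "centralizer D (gen S) \<subseteq> centralizer D S"
    using gen_superset(2) by (force simp: centralizer_def)
  show "centralizer D S \<subseteq> centralizer D (gen S)"
  proof
    fix x assume "x \<in> centralizer D S"
    then have x: "x \<in> D" "\<And>s. s \<in> S \<Longrightarrow> s * x = x * s" by (simp_all add: centralizer_iff)
    then have "g * x = x * g" if "g \<in> gen S" for g by (rule gen_commutes[OF assms _ _ that])
    then show "x \<in> centralizer D (gen S)" using x(1) by (simp add: centralizer_iff)
  qed
qed

lemma complete_square:
  assumes M: "division_subring M" "E \<subseteq> M" "has_dim (*) E m M"
    and M': "division_subring M'" "M \<subseteq> M'" "has_dim (*) E (2 * m) M'"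
    and comm: "\<And>x y. x \<in> M' \<Longrightarrow> y \<in> M' \<Longrightarrow> x * y = y * x"
    and x: "x \<in> M'" "x \<notin> M"
  obtains t where "t \<in> M" "(x - t) * (x - t) \<in> M"
proof -
  have "has_dim (*) E (m * 2) (extension M x)"
    by (rule ring.has_dim_tower[OF E M(3,1,2) has_dim_extension[OF M(1) x(2)]])
  then have "extension M x = M'"
    using ring.has_dim_eqI[OF E M'(3) _ extension_least[OF M'(1,2) x(1)]] by (simp add: mult.commute)
  then have "x * x \<in> extension M x" using x(1) M'(1) by (simp add: division_subring_mult)
  then obtain a b where ab: "x * x = a + x * b" "a \<in> M" "b \<in> M" by (rule adjoinE)
  obtain t where t: "t \<in> M" "b = t + t"
    using half_exists[OF division_subring_subspace[OF M(1,2)] ab(3)] .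
  have tx: "t * x = x * t" using comm[of x t] x(1) t M'(2) by auto
  have "(x - t) * (x - t) = x * x - x * t - t * x + t * t" by (simp add: algebra_simps)
  also have "\<dots> = a + t * t" unfolding tx ab(1) t(2) by (simp add: algebra_simps)
  finally have "(x - t) * (x - t) \<in> M" using ab t M(1) by (simp add: division_subring_closed)
  then show thesis using that t by blast
qed

definition square_central :: "'r \<Rightarrow> bool" where
  "square_central x \<longleftrightarrow> x \<in> D \<and> x \<notin> E \<and> x * x \<in> E"

context
  fixes B n a w
  assumes B: "division_subring B" "E \<subseteq> B" "B \<subseteq> D" "has_dim (*) E n B"
    and a: "a \<in> B" "a \<noteq> 0" "\<And>y. y \<in> B \<Longrightarrow> a * a * y = y * (a * a)"
    and w: "w \<in> B" "w \<noteq> 0" "w * a = - (a * w)"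
begin

lemma anticentralizer_eq_image: "anticentralizer B a = (\<lambda>c. c * w) ` centralizer B {a}"
proof (intro equalityI subsetI)
  obtain w' where w': "w' \<in> B" "w * w' = 1" "w' * w = 1" using division_subring_inverseE[OF B(1) w(1,2)] .
  fix x assume x: "x \<in> anticentralizer B a"
  have "x * w' \<in> centralizer B {a}"
    using x w' B(1) anticommuting_mult[OF _ anticommuting_inverse[OF w(3) w'(2,3)], of x]
    by (simp add: anticentralizer_iff centralizer_iff division_subring_mult)
  moreover have "x = x * w' * w" using w' by (simp add: mult.assoc)
  ultimately show "x \<in> (\<lambda>c. c * w) ` centralizer B {a}" by blast
next
  fix x assume "x \<in> (\<lambda>c. c * w) ` centralizer B {a}"
  then obtain c where c: "x = c * w" "c \<in> B" "c * a = a * c" by (auto simp: centralizer_iff)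
  have "c * w * a = - (c * a * w)" using w(3) by (simp add: mult.assoc)
  also have "\<dots> = - (a * (c * w))" unfolding c(3) by (simp add: mult.assoc)
  finally show "x \<in> anticentralizer B a"
    unfolding c(1) using c(2) w(1) B(1) by (simp add: anticentralizer_iff division_subring_mult)
qed

lemma centralizer_Int_anticentralizer: "centralizer B {a} \<inter> anticentralizer B a \<subseteq> {0}"
proof
  fix x assume "x \<in> centralizer B {a} \<inter> anticentralizer B a"
  then have "x * a = a * x" "x * a = - (a * x)" by (auto simp: centralizer_iff anticentralizer_iff)
  then have "x * a = 0" using eq_minus_self[of "x * a"] by simp
  then show "x \<in> {0}" using division_subring_mult_eq_0(2)[OF B(1) a(1,2)] by blast
qed

lemma centralizer_anticentralizer_dims:
  obtains m where "n = 2 * m" "has_dim (*) E m (centralizer B {a})" "has_dim (*) E m (anticentralizer B a)"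
    "B = centralizer B {a} + anticentralizer B a"
proof -
  have aD: "{a} \<subseteq> D" using a(1) B(3) by blast
  have C: "division_subring (centralizer B {a})" "E \<subseteq> centralizer B {a}" "centralizer B {a} \<subseteq> D"
    using centralizer_division_subring[OF B(1-3) aD] E_subset_centralizer[OF B(2) aD] B(3)
    by (auto simp: centralizer_iff)
  obtain m where m: "has_dim (*) E m (centralizer B {a})" using has_dim_division_subringE[OF C] .
  have wD: "w \<in> D" using w(1) B(3) by blast
  have A: "has_dim (*) E m (anticentralizer B a)"
    unfolding anticentralizer_eq_image
  proof (rule ring.has_dim_image[OF E m right_module_times])
    show "x = 0" if "x * w = 0" for x using division_subring_mult_eq_0(2)[OF B(1) w(1,2) that] .
    show "linear_over (*) (*) E (centralizer B {a}) (\<lambda>c. c * w)"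
      using E_central[OF _ wD] by (simp add: linear_over_def distrib_right mult.assoc)
  qed
  have sum: "has_dim (*) E (m + m) (centralizer B {a} + anticentralizer B a)"
    by (rule ring.has_dim_direct_sum[OF E m A centralizer_Int_anticentralizer])
  have sub: "centralizer B {a} + anticentralizer B a \<subseteq> B"
    by (rule subspace_over_set_plus_least[OF division_subring_subspace[OF B(1,2)]])
      (auto simp: centralizer_iff anticentralizer_iff)
  obtain k where k: "has_dim (*) E k {x \<in> B. x * a - a * x = 0}" "n \<le> k + m"
  proof (rule ring.has_dim_kernel[OF E B(4) A right_module_times])
    show "linear_over (*) (*) E B (\<lambda>x. x * a - a * x)"
      using E_central[of _ a] a(1) B(3) by (auto simp: linear_over_def algebra_simps subset_iff)
    show "(\<lambda>x. x * a - a * x) ` B \<subseteq> anticentralizer B a"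
      using commutator_anticommutes[OF a(3)] a(1) B(1) by (auto simp: anticentralizer_iff division_subring_closed)
  qed
  moreover have "{x \<in> B. x * a - a * x = 0} = centralizer B {a}" by (auto simp: centralizer_iff)
  ultimately have "n \<le> m + m" using ring.has_dim_unique[OF E m] by metis
  then have B_eq: "centralizer B {a} + anticentralizer B a = B" by (rule ring.has_dim_eqI[OF E B(4) sum sub])
  then have "n = 2 * m" using ring.has_dim_unique[OF E sum] B(4) by (metis mult_2)
  then show thesis using that[OF _ m A B_eq[symmetric]] by blast
qed

lemma commuting_decomposition:
  assumes "y \<in> B"
  obtains c d where "c \<in> centralizer B {a}" "d \<in> centralizer B {a}" "y = c + d * w"
proof -
  have "y \<in> centralizer B {a} + anticentralizer B a"
    using assms centralizer_anticentralizer_dims by metis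
  then show thesis using that unfolding anticentralizer_eq_image by (auto elim!: set_plus_elim)
qed

end

lemma square_central_anticommutingE:
  assumes x: "square_central x"
  obtains w where "w \<in> D" "w \<noteq> 0" "w * x = - (x * w)"
proof -
  have xD: "x \<in> D" "x \<notin> E" "x * x \<in> E" using x by (auto simp: square_central_def)
  obtain y where y: "y \<in> D" "y * x \<noteq> x * y" using center[OF xD(1)] xD(2) by metis
  show thesis
  proof (rule that[of "y * x - x * y"])
    show "y * x - x * y \<in> D" using y(1) xD(1) D by (simp add: division_subring_closed)
  qed (use y commutator_anticommutes[OF E_central[OF xD(3) y(1)]] in auto)
qed

lemma square_central_nonzero: "square_central x \<Longrightarrow> x \<noteq> 0"
  using division_subring_zero[OF E] by (auto simp: square_central_def)

lemma has_dim_centralizer_square_central: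
  assumes x: "square_central x"
  obtains m where "N = 2 * m" "has_dim (*) E m (centralizer D {x})"
proof -
  obtain w where w: "w \<in> D" "w \<noteq> 0" "w * x = - (x * w)" using square_central_anticommutingE[OF x] .
  have xx: "x * x * y = y * (x * x)" if "y \<in> D" for y
    using E_central[OF _ that] x by (simp add: square_central_def)
  show thesis
    using centralizer_anticentralizer_dims[OF D E_sub order_refl dim_D _ square_central_nonzero[OF x] xx w] x that
    by (metis square_central_def)
qed

end

section \<open>Involutions\<close>

locale central_division_algebra_inv = central_division_algebra E D N for E D :: "'r::ring_1 set" and N +
  fixes J :: "'r \<Rightarrow> 'r"
  assumes J_D: "\<And>x. x \<in> D \<Longrightarrow> J x \<in> D"
    and J_add: "\<And>x y. x \<in> D \<Longrightarrow> y \<in> D \<Longrightarrow> J (x + y) = J x + J y"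
    and J_mult: "\<And>x y. x \<in> D \<Longrightarrow> y \<in> D \<Longrightarrow> J (x * y) = J y * J x"
    and J_J: "\<And>x. x \<in> D \<Longrightarrow> J (J x) = x"
    and J_E: "\<And>e. e \<in> E \<Longrightarrow> J e = e"
begin

definition Sym :: "'r set" where "Sym = {x \<in> D. J x = x}"

definition Skew :: "'r set" where "Skew = {x \<in> D. J x = - x}"

lemma J_diff: "x \<in> D \<Longrightarrow> y \<in> D \<Longrightarrow> J (x - y) = J x - J y"
  using J_add[of "x - y" y] D by (simp add: division_subring_closed)

lemma J_zero: "J 0 = 0"
  by (rule J_E[OF division_subring_zero[OF E]])

lemma J_one: "J 1 = 1"
  by (rule J_E[OF division_subring_one[OF E]])

lemma J_minus: "x \<in> D \<Longrightarrow> J (- x) = - J x"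
  using J_diff[of 0 x] D by (simp add: division_subring_closed J_zero)

lemma Sym_iff: "x \<in> Sym \<longleftrightarrow> x \<in> D \<and> J x = x"
  by (simp add: Sym_def)

lemma Skew_iff: "x \<in> Skew \<longleftrightarrow> x \<in> D \<and> J x = - x"
  by (simp add: Skew_def)

lemma Sym_subset: "Sym \<subseteq> D" and Skew_subset: "Skew \<subseteq> D"
  by (auto simp: Sym_def Skew_def)

lemma E_Sym: "E \<subseteq> Sym"
  using E_sub J_E by (auto simp: Sym_iff)

lemma subspace_Sym: "subspace_over (*) E Sym"
  unfolding subspace_over_def using E_sub
  by (auto simp: Sym_iff division_subring_closed D J_zero J_add J_mult J_E E_central subset_iff)

lemma subspace_Skew: "subspace_over (*) E Skew"
  unfolding subspace_over_def using E_sub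
  by (auto simp: Skew_iff division_subring_closed D J_zero J_add J_mult J_E E_central subset_iff)

lemma Sym_Int_Skew: "x \<in> Sym \<Longrightarrow> x \<in> Skew \<Longrightarrow> x = 0"
  using eq_minus_self[of x] by (simp add: Sym_iff Skew_iff)

lemma Sym_square: "x \<in> Sym \<Longrightarrow> x * x \<in> Sym"
  by (simp add: Sym_iff division_subring_closed D J_mult)

lemma Skew_square: "x \<in> Skew \<Longrightarrow> x * x \<in> Sym"
  by (simp add: Sym_iff Skew_iff division_subring_closed D J_mult)

lemma Sym_diff: "x \<in> Sym \<Longrightarrow> y \<in> Sym \<Longrightarrow> x - y \<in> Sym"
  by (simp add: Sym_iff division_subring_closed D J_diff)

lemma add_J_Sym: "x \<in> D \<Longrightarrow> x + J x \<in> Sym"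
  using J_D by (simp add: Sym_iff division_subring_closed D J_add J_J add.commute)

lemma diff_J_Skew: "x \<in> D \<Longrightarrow> x - J x \<in> Skew"
  using J_D by (simp add: Skew_iff division_subring_closed D J_diff J_J)

lemma Sym_plus_Skew: "Sym + Skew = D"
proof
  have sum: "subspace_over (*) E (Sym + Skew)" by (rule ring.subspace_over_set_plus[OF subspace_Sym subspace_Skew])
  show "D \<subseteq> Sym + Skew"
  proof
    fix x assume x: "x \<in> D"
    have "x + x = (x + J x) + (x - J x)" by simp
    also have "\<dots> \<in> Sym + Skew" by (rule set_plus_intro[OF add_J_Sym[OF x] diff_J_Skew[OF x]])
    finally show "x \<in> Sym + Skew" by (rule double_mem[OF sum])
  qed
  show "Sym + Skew \<subseteq> D"
    by (rule subspace_over_set_plus_least[OF division_subring_subspace[OF D order_refl] Sym_subset Skew_subset])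
qed

lemma has_dim_Sym_SkewE:
  obtains r p where "has_dim (*) E r Sym" "has_dim (*) E p Skew" "r + p = N"
proof -
  obtain r where r: "has_dim (*) E r Sym" using has_dim_subspaceE[OF subspace_Sym Sym_subset] .
  obtain p where p: "has_dim (*) E p Skew" using has_dim_subspaceE[OF subspace_Skew Skew_subset] .
  have "has_dim (*) E (r + p) (Sym + Skew)"
    by (rule ring.has_dim_direct_sum[OF E r p]) (use Sym_Int_Skew in blast)
  then show thesis using that r p ring.has_dim_unique[OF E dim_D] unfolding Sym_plus_Skew by blast
qed

lemma gen_Sym:
  assumes S: "S \<subseteq> Sym" "\<And>x y. x \<in> S \<Longrightarrow> y \<in> S \<Longrightarrow> x * y = y * x"
  shows "gen S \<subseteq> Sym"
proof -
  have SD: "S \<subseteq> D" using S(1) Sym_subset by blast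
  note G = gen_division_subring[OF SD] gen_subset[OF SD]
  have "gen S \<subseteq> gen S \<inter> Sym"
  proof (rule gen_least)
    show "division_subring (gen S \<inter> Sym)"
    proof (rule division_subringI)
      show "E \<subseteq> gen S \<inter> Sym" using gen_superset(1) E_Sym by blast
      show "x - y \<in> gen S \<inter> Sym" if "x \<in> gen S \<inter> Sym" "y \<in> gen S \<inter> Sym" for x y
        using that Sym_diff division_subring_diff[OF G(1)] by blast
      show "x * y \<in> gen S \<inter> Sym" if "x \<in> gen S \<inter> Sym" "y \<in> gen S \<inter> Sym" for x y
        using that division_subring_mult[OF G(1)] gen_commutative[OF SD S(2), of x y]
        by (simp add: Sym_iff J_mult division_subring_mult[OF D])
    qed (use G(2) in blast)
  qed (use gen_superset E_Sym S(1) in blast)+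
  then show ?thesis by blast
qed

text \<open>If a module over a noncommutative division ring had no symmetric elements, the involution
  would be given there by conjugation, which reverses products only if they commute.\<close>

lemma symmetric_element:
  assumes x: "x \<in> M" "x \<noteq> 0" "M \<subseteq> D" and M: "\<And>x. x \<in> M \<Longrightarrow> J x \<in> M" "\<And>x y. x \<in> M \<Longrightarrow> y \<in> M \<Longrightarrow> x + y \<in> M"
    and Q: "Q \<subseteq> D" "\<And>q x. q \<in> Q \<Longrightarrow> x \<in> M \<Longrightarrow> q * x \<in> M" "\<And>p q. p \<in> Q \<Longrightarrow> q \<in> Q \<Longrightarrow> p * q \<in> Q"
    and noncomm: "\<exists>p\<in>Q. \<exists>q\<in>Q. p * q \<noteq> q * p"
  shows "\<exists>s\<in>M. s \<noteq> 0 \<and> J s = s"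
proof (rule ccontr)
  assume no: "\<not> ?thesis"
  have skew: "J y = - y" if "y \<in> M" for y
  proof -
    have "y + J y \<in> M" "J (y + J y) = y + J y" using M that add_J_Sym x(3) by (auto simp: Sym_iff)
    then have "y + J y = 0" using no by blast
    then show ?thesis by (simp add: eq_neg_iff_add_eq_0 add.commute)
  qed
  have xD: "x \<in> D" using x by blast
  have conj: "q * x = x * J q" if "q \<in> Q" for q
    using skew[OF Q(2)[OF that x(1)]] skew[OF x(1)] J_mult[of q x] Q(1) that xD by auto
  have "p * q = q * p" if pq: "p \<in> Q" "q \<in> Q" for p q
  proof -
    have D': "p \<in> D" "q \<in> D" using pq Q(1) by auto
    have "p * q * x = x * J q * J p" using conj[OF Q(3)[OF pq]] D' by (simp add: J_mult mult.assoc)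
    also have "\<dots> = q * (x * J p)" unfolding conj[OF pq(2), symmetric] by (simp add: mult.assoc)
    also have "\<dots> = q * p * x" unfolding conj[OF pq(1), symmetric] by (simp add: mult.assoc)
    finally have "(p * q - q * p) * x = 0" by (simp add: left_diff_distrib)
    then have "p * q - q * p = 0" by (rule division_subring_mult_eq_0(2)[OF D xD x(2)])
    then show ?thesis by simp
  qed
  then show False using noncomm by blast
qed

lemma Sym_anticommutingE:
  assumes x: "square_central x" "J x = - x" and N: "4 < N"
  obtains w where "w \<in> Sym" "w \<noteq> 0" "w * x = - (x * w)"
proof -
  have xD: "x \<in> D" using x by (simp add: square_central_def)
  let ?C = "centralizer D {x}"
  have C: "division_subring ?C" "E \<subseteq> ?C"
    using centralizer_division_subring[OF D E_sub order_refl] E_subset_centralizer[OF E_sub] xD by auto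
  obtain w where w: "w \<in> D" "w \<noteq> 0" "w * x = - (x * w)" using square_central_anticommutingE[OF x(1)] .
  obtain m where m: "N = 2 * m" "has_dim (*) E m ?C" using has_dim_centralizer_square_central[OF x(1)] .
  have noncomm: "\<exists>p\<in>?C. \<exists>q\<in>?C. p * q \<noteq> q * p"
  proof (rule ccontr)
    assume "\<not> ?thesis"
    then have "m * m \<le> 2 * m" using commutative_dim(1)[OF C centralizer_subset _ m(2)] m(1) by blast
    then show False using N m(1) by simp
  qed
  have "\<exists>s\<in>anticentralizer D x. s \<noteq> 0 \<and> J s = s"
  proof (rule symmetric_element[OF _ w(2) _ _ _ centralizer_subset _ _ noncomm])
    show "w \<in> anticentralizer D x" using w by (simp add: anticentralizer_iff)
    show "J y \<in> anticentralizer D x" if "y \<in> anticentralizer D x" for y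
    proof -
      have y: "y \<in> D" "y * x = - (x * y)" using that by (auto simp: anticentralizer_iff)
      then have "J (y * x) = J (- (x * y))" by simp
      then have "J y * x = - (x * J y)" using y(1) xD x(2) D by (simp add: J_mult J_minus division_subring_mult)
      then show ?thesis using J_D[OF y(1)] by (simp add: anticentralizer_iff)
    qed
    show "q * y \<in> anticentralizer D x" if "q \<in> ?C" "y \<in> anticentralizer D x" for q y
      using that D by (simp add: anticentralizer_iff centralizer_iff division_subring_mult)
        (metis mult.assoc mult_minus_right)
    show "p * q \<in> ?C" if "p \<in> ?C" "q \<in> ?C" for p q using division_subring_mult[OF C(1)] that .
  qed (auto simp: anticentralizer_iff D division_subring_add distrib_left distrib_right)
  then show thesis using that by (auto simp: Sym_iff anticentralizer_iff)
qed

lemma has_dim_Sym_centralizer: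
  assumes B: "division_subring B" "E \<subseteq> B" "B \<subseteq> D" "has_dim (*) E n B" "\<And>x. x \<in> B \<Longrightarrow> J x \<in> B"
    and a: "a \<in> B" "a \<noteq> 0" "a * a \<in> E" "J a = a" and w: "w \<in> B" "w \<noteq> 0" "w * a = - (a * w)"
    and r: "has_dim (*) E r (Sym \<inter> B)"
  obtains k where "has_dim (*) E k (Sym \<inter> centralizer B {a})" "4 * r \<le> 4 * k + n"
proof -
  have aD: "a \<in> D" using a(1) B(3) by blast
  obtain m where m: "n = 2 * m" "has_dim (*) E m (anticentralizer B a)"
    using centralizer_anticentralizer_dims[OF B(1-4) a(1,2) _ w] E_central[OF a(3)] B(3) by (metis subsetD)
  let ?S = "Sym \<inter> anticentralizer B a" and ?K = "Skew \<inter> anticentralizer B a"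
  have sK: "subspace_over (*) E ?K" by (rule subspace_over_Int[OF subspace_Skew ring.has_dim_subspace[OF m(2) E]])
  obtain d where d: "has_dim (*) E d ?K" using ring.has_dim_subspaceE[OF m(2) E sK] by blast
  have swap: "(*) a ` ?K \<subseteq> ?S"
    using a(1,4) aD B(1) D by (auto simp: Skew_iff Sym_iff anticentralizer_iff J_mult division_subring_mult mult.assoc)
  have aK: "has_dim (*) E d ((*) a ` ?K)"
    by (rule ring.has_dim_image[OF E d right_module_times])
      (use division_subring_mult_eq_0(1)[OF B(1) a(1,2)] in \<open>auto simp: linear_over_def algebra_simps\<close>)
  have "has_dim (*) E (d + d) (?K + (*) a ` ?K)"
    by (rule ring.has_dim_direct_sum[OF E d aK]) (use swap Sym_Int_Skew in blast)
  moreover have "?K + (*) a ` ?K \<subseteq> anticentralizer B a"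
    by (rule subspace_over_set_plus_least[OF ring.has_dim_subspace[OF m(2) E]]) (use swap in auto)
  ultimately have "d + d \<le> m" using ring.has_dim_mono[OF E m(2)] by blast
  moreover obtain k where k: "has_dim (*) E k {x \<in> Sym \<inter> B. x * a - a * x = 0}" "r \<le> k + d"
  proof (rule ring.has_dim_kernel[OF E r d right_module_times])
    show "linear_over (*) (*) E (Sym \<inter> B) (\<lambda>x. x * a - a * x)"
      using E_central[OF _ aD] by (simp add: linear_over_def algebra_simps)
    show "(\<lambda>x. x * a - a * x) ` (Sym \<inter> B) \<subseteq> ?K"
    proof
      fix y assume "y \<in> (\<lambda>x. x * a - a * x) ` (Sym \<inter> B)"
      then obtain x where x: "y = x * a - a * x" "x \<in> D" "J x = x" "x \<in> B" by (auto simp: Sym_iff)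
      have "y * a = - (a * y)" unfolding x(1) by (rule commutator_anticommutes[OF E_central[OF a(3) x(2)]])
      then show "y \<in> ?K"
        unfolding x(1) using x a(1,4) aD B(1) D
        by (simp add: Skew_iff anticentralizer_iff J_diff J_mult division_subring_closed)
    qed
  qed
  moreover have "{x \<in> Sym \<inter> B. x * a - a * x = 0} = Sym \<inter> centralizer B {a}" by (auto simp: centralizer_iff)
  ultimately show thesis using that m(1) by simp
qed

end

section \<open>Symplectic involutions in degree 8\<close>

lemma (in central_division_algebra) commutative_dim_64:
  assumes "division_subring M" "E \<subseteq> M" "M \<subseteq> D" "\<And>x y. x \<in> M \<Longrightarrow> y \<in> M \<Longrightarrow> x * y = y * x"
    and "has_dim (*) E m M" and N: "N = 64"
  shows "m \<in> {1, 2, 4, 8}"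
proof -
  have "m * m \<le> 64" "m dvd 64" using commutative_dim[OF assms(1-5)] N by auto
  moreover have "m < 9"
  proof (rule ccontr)
    assume "\<not> m < 9"
    then have "9 * 9 \<le> m * m" by (intro mult_le_mono) auto
    then show False using \<open>m * m \<le> 64\<close> by simp
  qed
  then have "m \<in> {0, 1, 2, 3, 4, 5, 6, 7, 8}" by auto
  ultimately show ?thesis by auto
qed

locale symplectic_degree_8 = central_division_algebra_inv E D 64 J for E D :: "'r::ring_1 set" and J +
  assumes dim_Skew_ge: "has_dim (*) E p Skew \<Longrightarrow> 36 \<le> p"
begin

text \<open>The inner derivation of a symmetric element maps skew elements to symmetric ones, and
  there are more skew than symmetric elements.\<close>

lemma Skew_centralizer_dim:
  assumes s: "s \<in> Sym"
  obtains k where "has_dim (*) E k (Skew \<inter> centralizer D {s})" "8 \<le> k"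
proof -
  have sD: "s \<in> D" "J s = s" using s by (auto simp: Sym_iff)
  obtain r p where r: "has_dim (*) E r Sym" and p: "has_dim (*) E p Skew" "r + p = 64" using has_dim_Sym_SkewE .
  obtain k where k: "has_dim (*) E k {x \<in> Skew. s * x - x * s = 0}" "p \<le> k + r"
  proof (rule ring.has_dim_kernel[OF E p(1) r right_module_times])
    show "linear_over (*) (*) E Skew (\<lambda>x. s * x - x * s)"
      using E_central[OF _ sD(1)] by (simp add: linear_over_def algebra_simps)
    show "(\<lambda>x. s * x - x * s) ` Skew \<subseteq> Sym"
      using sD by (auto simp: Sym_iff Skew_iff division_subring_closed D J_diff J_mult)
  qed
  moreover have "{x \<in> Skew. s * x - x * s = 0} = Skew \<inter> centralizer D {s}"
    by (auto simp: centralizer_iff Skew_iff)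
  ultimately show thesis using that p(2) dim_Skew_ge[OF p(1)] by simp
qed

lemma ex_nonzero_Skew_centralizer:
  assumes "s \<in> Sym" obtains x where "x \<in> Skew" "x \<in> centralizer D {s}" "x \<noteq> 0"
proof -
  obtain k where k: "has_dim (*) E k (Skew \<inter> centralizer D {s})" "8 \<le> k"
    using Skew_centralizer_dim[OF assms] .
  have "0 < k" using k(2) by simp
  then obtain x where "x \<in> Skew \<inter> centralizer D {s}" "x \<noteq> 0" by (rule ring.ex_nonzero_of_dim_pos[OF E k(1)])
  then show thesis using that by blast
qed

lemma gen_Sym_singleton:
  assumes "s \<in> Sym" shows "gen {s} \<subseteq> Sym"
  by (rule gen_Sym) (use assms in simp_all)

lemma gen_singleton:
  assumes "s \<in> D"
  shows "division_subring (gen {s})" "gen {s} \<subseteq> D" "\<And>x y. x \<in> gen {s} \<Longrightarrow> y \<in> gen {s} \<Longrightarrow> x * y = y * x"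
    "centralizer D (gen {s}) = centralizer D {s}"
proof -
  have s: "{s} \<subseteq> D" using assms by simp
  show "division_subring (gen {s})" by (rule gen_division_subring[OF s])
  show "gen {s} \<subseteq> D" by (rule gen_subset[OF s])
  show "x * y = y * x" if "x \<in> gen {s}" "y \<in> gen {s}" for x y
    by (rule gen_commutative[OF s _ that]) simp
  show "centralizer D (gen {s}) = centralizer D {s}" by (rule centralizer_gen[OF s])
qed

lemma degree_Sym:
  assumes s: "s \<in> Sym" and m: "has_dim (*) E m (gen {s})"
  shows "m \<in> {1, 2, 4}"
proof -
  have sD: "s \<in> D" using s by (simp add: Sym_iff)
  note G = gen_singleton[OF sD]
  have "m \<noteq> 8"
  proof
    assume "m = 8"
    then have "centralizer D {s} = gen {s}"
      using centralizer_maximal_commutative[OF G(1) gen_superset(1) G(2,3)] m G(4) by simp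
    then show False using ex_nonzero_Skew_centralizer[OF s] gen_Sym_singleton[OF s] Sym_Int_Skew by blast
  qed
  then show ?thesis using commutative_dim_64[OF G(1) gen_superset(1) G(2,3) m] by auto
qed

lemma degree_Sym_casesE:
  assumes s: "s \<in> Sym" "s \<notin> E"
  obtains "has_dim (*) E 2 (gen {s})" | "has_dim (*) E 4 (gen {s})"
proof -
  have sD: "s \<in> D" using s by (simp add: Sym_iff)
  obtain m where m: "has_dim (*) E m (gen {s})"
    using has_dim_division_subringE[OF gen_singleton(1)[OF sD] gen_superset(1) gen_singleton(2)[OF sD]] .
  have "m \<noteq> 1" using has_dim_1_eq[OF gen_superset(1)[of "{s}"]] m s(2) gen_superset(2)[of "{s}"] by blast
  then show thesis using degree_Sym[OF s(1) m] m that by auto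
qed

lemma square_central_of_degree_2:
  assumes s: "s \<in> Sym" "s \<notin> E" and m: "has_dim (*) E 2 (gen {s})"
  shows "\<exists>x\<in>Sym. square_central x"
proof -
  have sD: "s \<in> D" using s by (simp add: Sym_iff)
  note G = gen_singleton[OF sD]
  obtain t where t: "t \<in> E" "(s - t) * (s - t) \<in> E"
    using complete_square[OF E order_refl has_dim_self[OF E] G(1) gen_superset(1) _ G(3) _ s(2)] m gen_superset(2)[of "{s}"] by auto
  have "s - t \<in> Sym" using Sym_diff s(1) t(1) E_Sym by blast
  moreover have "s - t \<notin> E" using division_subring_diff_cancel[OF E _ t(1), of s] s(2) by blast
  ultimately show ?thesis using t by (auto simp: square_central_def Sym_iff)
qed

lemma Skew_anticommutes:
  assumes s: "s \<in> Sym" and r: "r \<in> Sym" "r * s = s * r" "r * r \<in> gen {s}"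
    and C: "centralizer D {s, r} \<subseteq> Sym" and x: "x \<in> Skew" "x * s = s * x"
  shows "x * r = - (r * x)"
proof -
  have D': "s \<in> D" "r \<in> D" "x \<in> D" and J': "J r = r" "J x = - x" using s r x by (auto simp: Sym_iff Skew_iff)
  let ?y = "x * r + r * x"
  have "r * r * x = x * (r * r)" using gen_commutes[of "{s}", OF _ D'(3) _ r(3)] D'(1) x(2) by simp
  then have "?y * r = r * ?y" by (simp add: algebra_simps)
  moreover have "?y * s = s * ?y" by (intro commutes_add commutes_mult x(2) r(2))
  moreover have yD: "?y \<in> D" using D' D by (simp add: division_subring_closed)
  ultimately have "?y \<in> Sym" using C by (auto simp: centralizer_iff)
  moreover have "?y \<in> Skew"
    using yD D' J' D by (simp add: Skew_iff J_add J_mult division_subring_closed)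
  ultimately have "?y = 0" by (rule Sym_Int_Skew)
  then show ?thesis by (simp add: eq_neg_iff_add_eq_0)
qed

lemma centralizer_Sym_pair_neq_gen:
  assumes s: "s \<in> Sym" and q: "has_dim (*) E q (centralizer D {s})" "q \<le> 16"
    and r: "r \<in> Sym" "r * s = s * r" "r * r \<in> gen {s}" "r \<noteq> 0"
    and M: "has_dim (*) E 8 (gen {s, r})"
  shows "centralizer D {s, r} \<noteq> gen {s, r}"
proof
  assume eq: "centralizer D {s, r} = gen {s, r}"
  let ?Q = "centralizer D {s}" and ?M = "gen {s, r}"
  let ?K = "Skew \<inter> ?Q"
  have D': "s \<in> D" "r \<in> D" using s r by (auto simp: Sym_iff)
  have Q: "division_subring ?Q" using centralizer_division_subring[OF D E_sub order_refl] D'(1) by simp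
  have MSym: "?M \<subseteq> Sym" by (rule gen_Sym) (use s r in auto)
  have M_div: "division_subring ?M" using gen_division_subring D' by simp
  have rM: "r \<in> ?M" using gen_superset(2)[of "{s, r}"] by simp
  obtain k where k: "has_dim (*) E k ?K" "8 \<le> k" using Skew_centralizer_dim[OF s] .
  have anti: "x * r = - (r * x)" if "x \<in> ?K" for x
    using Skew_anticommutes[OF s r(1-3)] eq MSym that by (simp add: centralizer_iff)
  have rK: "has_dim (*) E k ((*) r ` ?K)"
    by (rule ring.has_dim_image[OF E k(1) right_module_times])
      (use division_subring_mult_eq_0(1)[OF D D'(2) r(4)] in \<open>auto simp: linear_over_def distrib_left mult.assoc\<close>)
  have rKSym: "(*) r ` ?K \<subseteq> Sym"
    using anti r(1) by (auto simp: Sym_iff Skew_iff J_mult division_subring_mult D)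
  have "?M \<inter> (*) r ` ?K \<subseteq> {0}"
  proof
    obtain r' where r': "r' \<in> ?M" "r' * r = 1" using division_subring_inverseE[OF M_div rM r(4)] .
    fix z assume "z \<in> ?M \<inter> (*) r ` ?K"
    then obtain x where x: "x \<in> ?K" "z = r * x" "z \<in> ?M" by blast
    have "x = r' * z" using r' x by (simp flip: mult.assoc)
    then have "x \<in> ?M" using division_subring_mult[OF M_div r'(1) x(3)] by simp
    then have "x = 0" using MSym x Sym_Int_Skew by blast
    then show "z \<in> {0}" using x by simp
  qed
  then have sum: "has_dim (*) E (8 + k) (?M + (*) r ` ?K)" by (rule ring.has_dim_direct_sum[OF E M rK])
  have "?M + (*) r ` ?K \<subseteq> ?Q"
  proof (rule subspace_over_set_plus_least[OF division_subring_subspace[OF Q order_refl]])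
    show "?M \<subseteq> ?Q" unfolding eq[symmetric] by (auto simp: centralizer_iff)
    then show "(*) r ` ?K \<subseteq> ?Q" using rM division_subring_mult[OF Q] by auto
  qed
  then have "?Q = ?M + (*) r ` ?K" using ring.has_dim_eqI[OF E q(1) sum] q(2) k(2) by simp
  also have "\<dots> \<subseteq> Sym" by (rule subspace_over_set_plus_least[OF subspace_Sym MSym rKSym])
  finally show False using ex_nonzero_Skew_centralizer[OF s] Sym_Int_Skew by blast
qed

lemma Sym_centralizer:
  assumes s: "s \<in> Sym" and m: "has_dim (*) E 4 (gen {s})"
  shows "Sym \<inter> centralizer D {s} \<subseteq> gen {s}"
proof (intro subsetI, rule ccontr)
  fix x assume "x \<in> Sym \<inter> centralizer D {s}" and xG: "x \<notin> gen {s}"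
  then have x: "x \<in> Sym" "x \<in> D" "x * s = s * x" by (auto simp: Sym_iff centralizer_iff)
  have sD: "s \<in> D" using s by (simp add: Sym_iff)
  note G = gen_singleton[OF sD]
  let ?M = "gen {s, x}"
  note M = gen_pair[OF sD x(2,3)]
  have GM: "gen {s} \<subseteq> ?M" by (rule gen_mono) auto
  obtain n where n: "has_dim (*) E n ?M" using has_dim_division_subringE[OF M(1) gen_superset(1) M(2)] .
  have "\<not> n \<le> 4" using ring.has_dim_eqI[OF E n m GM] xG M(4) by blast
  then have n8: "has_dim (*) E 8 ?M"
    using commutative_dim_64[OF M(1) gen_superset(1) M(2,5) n] n by auto
  obtain t where t: "t \<in> gen {s}" "(x - t) * (x - t) \<in> gen {s}"
    using complete_square[OF G(1) gen_superset(1) m M(1) GM _ M(5) M(4) xG] n8 by auto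
  let ?r = "x - t"
  have rG: "?r \<notin> gen {s}" using division_subring_diff_cancel[OF G(1) _ t(1)] xG by blast
  have rM: "?r \<in> ?M" by (rule division_subring_diff[OF M(1,4)]) (use t(1) GM in blast)
  have eq: "gen {s, ?r} = ?M" by (rule gen_pair_diff[OF sD x(2) t(1)])
  have "centralizer D ?M = ?M"
    using centralizer_maximal_commutative[OF M(1) gen_superset(1) M(2,5) n8] by simp
  then have CM: "centralizer D {s, ?r} = gen {s, ?r}" using centralizer_gen[of "{s, ?r}"] sD rM M(2) eq by auto
  have MSym: "?M \<subseteq> Sym" by (rule gen_Sym) (use s x in auto)
  obtain q where q: "has_dim (*) E q (centralizer D {s})" using has_dim_centralizerE[of "{s}"] sD by blast
  have "q \<le> 16" using centralizer_dim_le[OF G(1) gen_superset(1) G(2) m] q G(4) by simp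
  then have "centralizer D {s, ?r} \<noteq> gen {s, ?r}"
  proof (rule centralizer_Sym_pair_neq_gen[OF s q _ _ _ t(2)])
    show "?r \<in> Sym" using rM MSym by blast
    show "?r * s = s * ?r" by (rule M(5)[OF rM M(3)])
    show "?r \<noteq> 0" using rG gen_superset(1)[of "{s}"] division_subring_zero[OF E] by auto
    show "has_dim (*) E 8 (gen {s, ?r})" unfolding eq by (rule n8)
  qed
  then show False using CM by blast
qed

lemma square_central_Sym_of_anticommuting:
  assumes y: "y \<in> Sym" "y \<noteq> 0" and z: "z \<in> D" "z \<noteq> 0" and yz: "y * z = - (z * y)"
  shows "\<exists>x\<in>Sym. square_central x"
proof -
  have yD: "y \<in> D" using y by (simp add: Sym_iff)
  have nc: "y * z \<noteq> z * y"
  proof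
    assume "y * z = z * y"
    then have "y * z = 0" using eq_minus_self[of "y * z"] yz by simp
    then show False using division_subring_mult_eq_0(1)[OF D yD y(2)] z by blast
  qed
  have yE: "y \<notin> E" using E_central[of y z] z nc by auto
  show ?thesis
  proof (cases "y * y \<in> E")
    case True
    then show ?thesis using y yD yE by (auto simp: square_central_def)
  next
    case False
    have y2: "y * y \<in> Sym" using Sym_square y by blast
    have y2D: "y * y \<in> D" using y2 by (simp add: Sym_iff)
    have yG: "y \<in> gen {y}" using gen_superset(2)[of "{y}"] by simp
    have sub: "gen {y * y} \<subseteq> gen {y}"
      by (rule gen_least[OF gen_singleton(1)[OF yD] gen_superset(1)])
        (use division_subring_mult[OF gen_singleton(1)[OF yD] yG yG] in simp)
    have "y * y * z = z * (y * y)" using yz by (metis minus_minus mult.assoc mult_minus_left mult_minus_right)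
    then have "y \<notin> gen {y * y}" using gen_commutes[of "{y * y}" z y] y2D z(1) nc by auto
    then have ne: "gen {y * y} \<noteq> gen {y}" using yG by blast
    from y2 False show ?thesis
    proof (cases rule: degree_Sym_casesE)
      case 1
      then show ?thesis using square_central_of_degree_2[OF y2 False] by blast
    next
      case 2
      from y(1) yE have "has_dim (*) E 2 (gen {y}) \<or> has_dim (*) E 4 (gen {y})" by (metis degree_Sym_casesE)
      then have "gen {y * y} = gen {y}" using ring.has_dim_eqI[OF E _ 2 sub] by auto
      then show ?thesis using ne by blast
    qed
  qed
qed

lemma square_central_Sym_of_square_central:
  assumes x: "square_central x"
  shows "\<exists>y\<in>Sym. square_central y"
proof -
  have xD: "x \<in> D" "x * x \<in> E" and x0: "x \<noteq> 0"
    using x square_central_nonzero[OF x] by (auto simp: square_central_def)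
  have "J x = - x" if "x + J x = 0" using that by (simp add: eq_neg_iff_add_eq_0 add.commute)
  then consider "J x = - x" | "J x = x" | "x + J x \<noteq> 0" "x - J x \<noteq> 0" by fastforce
  then show ?thesis
  proof cases
    case 1
    obtain w where w: "w \<in> Sym" "w \<noteq> 0" "w * x = - (x * w)" using Sym_anticommutingE[OF x 1] by auto
    show ?thesis by (rule square_central_Sym_of_anticommuting[OF w(1,2) xD(1) x0 w(3)])
  next
    case 2
    then show ?thesis using x xD by (auto simp: Sym_iff)
  next
    case 3
    have "J x * J x = x * x" using J_mult[OF xD(1) xD(1)] J_E[OF xD(2)] by simp
    then have "(x + J x) * (x - J x) = - ((x - J x) * (x + J x))" by (simp add: algebra_simps)
    moreover have "x - J x \<in> D" using diff_J_Skew[OF xD(1)] by (simp add: Skew_iff)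
    ultimately show ?thesis using square_central_Sym_of_anticommuting[OF add_J_Sym[OF xD(1)] 3(1) _ 3(2)] by blast
  qed
qed

lemma square_central_Sym_of_quadratic:
  assumes z: "z \<in> Sym" "z \<notin> E" and d: "d \<in> E" "z * (d - z) \<in> E"
  shows "\<exists>x\<in>Sym. square_central x"
proof -
  have zD: "z \<in> D" using z(1) by (simp add: Sym_iff)
  obtain f where f: "f \<in> E" "d = f + f" using half_exists[OF division_subring_subspace[OF E order_refl] d(1)] .
  have "(z - f) * (z - f) = f * f - z * (d - z)"
    unfolding f(2) using E_central[OF f(1) zD] by (simp add: algebra_simps)
  then have "(z - f) * (z - f) \<in> E" using f(1) d(2) E by (simp add: division_subring_closed)
  moreover have "z - f \<in> Sym" using Sym_diff z(1) f(1) E_Sym by blast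
  moreover have "z - f \<notin> E" using division_subring_diff_cancel[OF E _ f(1)] z(2) by blast
  ultimately show ?thesis by (auto simp: square_central_def Sym_iff)
qed

text \<open>The hypotheses say that \<open>u + s v\<close> with \<open>s\<^sup>2 = a\<close> has square in \<open>E(s)\<close>.\<close>

lemma square_central_Sym_descent:
  assumes u: "u \<in> Sym" and v: "v \<in> Sym" and a: "a \<in> E" "a \<noteq> 0"
    and norm: "u * u + a * (v * v) \<in> E" and trace: "u * v + v * u \<in> E" and n: "\<not> (u \<in> E \<and> v \<in> E)"
  shows "\<exists>x\<in>Sym. square_central x"
proof (cases "u * u \<in> E")
  case True
  have av: "a * (v * v) \<in> E" using division_subring_diff[OF E norm True] by simp
  obtain b where b: "b \<in> E" "b * a = 1" using division_subring_inverseE[OF E a] .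
  have "b * (a * (v * v)) \<in> E" by (rule division_subring_mult[OF E b(1) av])
  then have "v * v \<in> E" using b(2) by (simp flip: mult.assoc)
  then show ?thesis using n u v True by (auto simp: square_central_def Sym_iff)
next
  case False
  have D': "u \<in> D" "v \<in> D" using u v by (auto simp: Sym_iff)
  define z where "z = u * u"
  have z: "z \<in> Sym" "z \<in> D" "z \<notin> E" using Sym_square[OF u] False by (auto simp: z_def Sym_iff)
  define d where "d = z + a * (v * v)"
  have d: "d \<in> E" using norm by (simp add: d_def z_def)
  have av: "a * (v * v) = d - z" by (simp add: d_def)
  from z(1,3) show ?thesis
  proof (cases rule: degree_Sym_casesE)
    case 1
    then show ?thesis using square_central_of_degree_2[OF z(1,3)] by blast
  next
    case 2
    have "u * z = z * u" by (simp add: z_def mult.assoc)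
    moreover have "v * z = z * v"
    proof -
      have "z = d - a * (v * v)" using av by simp
      moreover have "v * (a * (v * v)) = a * (v * v) * v" using E_central[OF a(1) D'(2)] by (metis mult.assoc)
      ultimately show ?thesis using E_central[OF d D'(2)] by (simp add: left_diff_distrib right_diff_distrib)
    qed
    ultimately have "u \<in> gen {z}" "v \<in> gen {z}"
      using Sym_centralizer[OF z(1) 2] u v D' by (auto simp: centralizer_iff)
    then have uv: "u * v = v * u" using gen_singleton(3)[OF z(2)] by blast
    then have uvE: "u * v \<in> E" using double_mem[OF division_subring_subspace[OF E order_refl], of "u * v"] trace by simp
    have "z * (d - z) = a * (z * (v * v))"
      unfolding av[symmetric] using E_central[OF a(1) z(2)] by (metis mult.assoc)
    also have "z * (v * v) = (u * v) * (u * v)" unfolding z_def using uv by (metis mult.assoc)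
    finally have "z * (d - z) \<in> E" using a(1) uvE E by (simp add: division_subring_mult)
    then show ?thesis by (rule square_central_Sym_of_quadratic[OF z(1,3) d])
  qed
qed

context
  assumes sqrt: "\<And>e. e \<in> E \<Longrightarrow> \<exists>f\<in>E. f * f = e"
begin

text \<open>With respect to a basis of \<open>E(s)\<close> over \<open>E\<close>, squaring skew elements that commute with \<open>s\<close> is given by
  four quadratic forms, three of which have a common zero in dimension \<open>8 = 2\<^sup>3\<close>.\<close>

lemma square_central_Sym_of_degree_4:
  assumes s: "s \<in> Sym" and m: "has_dim (*) E 4 (gen {s})"
  shows "\<exists>x\<in>Sym. square_central x"
proof -
  have sD: "s \<in> D" using s by (simp add: Sym_iff)
  let ?K = "Skew \<inter> centralizer D {s}"
  have C: "division_subring (centralizer D {s})" using centralizer_division_subring[OF D E_sub order_refl] sD by simp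
  obtain k where k: "has_dim (*) E k ?K" "8 \<le> k" using Skew_centralizer_dim[OF s] .
  have "\<exists>v\<in>?K. v \<noteq> 0 \<and> v * v + v * v \<in> E"
  proof (rule ring.symmetric_bilinear_map_isotropic[where s = "\<lambda>x y. x * y + y * x", OF E sqrt right_module_times
        has_dim_self[OF E] _ gen_superset(1) k(1)])
    show "has_dim (*) E (1 + 3) (gen {s})" using m by simp
    show "x * y + y * x \<in> gen {s}" if "x \<in> ?K" "y \<in> ?K" for x y
    proof -
      have "x * y + y * x \<in> Sym"
        using that by (simp add: Skew_iff Sym_iff J_add J_mult D division_subring_closed add.commute)
      moreover have "x * y + y * x \<in> centralizer D {s}"
        using that by (intro division_subring_add[OF C] division_subring_mult[OF C]) auto
      ultimately show ?thesis using Sym_centralizer[OF s m] by blast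
    qed
    show "linear_over (*) (*) E ?K (\<lambda>y. x * y + y * x)" if "x \<in> ?K" for x
      using that E_central[of _ x] by (auto simp: linear_over_def Skew_iff algebra_simps)
  qed (use k(2) in \<open>auto simp: add.commute\<close>)
  then obtain v where v: "v \<in> ?K" "v \<noteq> 0" "v * v \<in> E"
    using double_mem[OF division_subring_subspace[OF E order_refl]] by blast
  moreover have "v \<notin> E" using v E_Sym Sym_Int_Skew by blast
  ultimately show ?thesis using square_central_Sym_of_square_central by (auto simp: square_central_def Skew_iff)
qed

lemma square_central_Sym_of_square_roots: "\<exists>x\<in>Sym. square_central x"
proof (cases "Sym \<subseteq> E")
  case True
  obtain x where x: "x \<in> Skew" "x \<noteq> 0"
    using ex_nonzero_Skew_centralizer[of 0] subspace_over_zero[OF subspace_Sym] by blast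
  then have "x * x \<in> E" "x \<notin> E" using True Skew_square E_Sym Sym_Int_Skew by blast+
  then show ?thesis using square_central_Sym_of_square_central x by (auto simp: square_central_def Skew_iff)
next
  case False
  then obtain s where s: "s \<in> Sym" "s \<notin> E" by blast
  then show ?thesis
    by (rule degree_Sym_casesE) (use square_central_of_degree_2[OF s] square_central_Sym_of_degree_4[OF s(1)] in blast)+
qed

end

end

section \<open>Scalar extensions of a division algebra\<close>

text \<open>The \<open>F\<close>-span of \<open>b\<close> is the division algebra, and its scalar extensions to the fields between \<open>F\<close>
  and \<open>'w\<close> are all realized inside the split algebra \<open>'r\<close>.\<close>

locale split_symplectic_algebra = scalar: division_ring_hom sc
  for sc :: "'w::field \<Rightarrow> 'r::ring_1" +
  fixes b :: "nat \<Rightarrow> 'r" and F :: "'w set" and J :: "'r \<Rightarrow> 'r"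
  assumes sc_central: "sc e * x = x * sc e"
    and center_sc: "(\<And>y. z * y = y * z) \<Longrightarrow> z \<in> range sc"
    and span: "span_family (*) (range sc) 64 b = UNIV"
    and independent: "independent_family (*) (range sc) 64 b"
    and F: "division_subring F" and F_span: "division_subring (span_family (*) (sc ` F) 64 b)"
    and J_add: "J (x + y) = J x + J y" and J_mult: "J (x * y) = J y * J x"
    and J_J: "J (J x) = x" and J_sc: "J (sc e) = sc e"
    and J_F_span: "J ` span_family (*) (sc ` F) 64 b \<subseteq> span_family (*) (sc ` F) 64 b"
    and J_b: "i < 36 \<Longrightarrow> J (b i) = - b i"
    and two: "(2::'w) \<noteq> 0"
    and sqrt: "\<exists>y::'w. y * y = e"
begin

definition scalar_extension :: "'w set \<Rightarrow> 'r set" where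
  "scalar_extension E = span_family (*) (sc ` E) 64 b"

lemma scalar_extension_mono: "E \<subseteq> E' \<Longrightarrow> scalar_extension E \<subseteq> scalar_extension E'"
  unfolding scalar_extension_def by (intro span_family_mono image_mono)

lemma independent_over: "independent_family (*) (sc ` E) 64 b"
  by (rule independent_family_mono[OF independent]) auto

context
  fixes E
  assumes E: "division_subring E" "F \<subseteq> E"
begin

lemma division_subring_scalars: "division_subring (sc ` E)"
  by (rule scalar.division_subring_image[OF E(1)])

lemma subspace_scalar_extension: "subspace_over (*) (sc ` E) (scalar_extension E)"
  unfolding scalar_extension_def by (rule ring.subspace_over_span_family[OF division_subring_scalars])

lemma basis_mem_scalar_extension: "i < 64 \<Longrightarrow> b i \<in> scalar_extension E"
  unfolding scalar_extension_def by (rule ring.span_family_base[OF division_subring_scalars])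

lemma sc_mem_scalar_extension: "e \<in> E \<Longrightarrow> sc e \<in> scalar_extension E"
proof -
  assume e: "e \<in> E"
  have "1 \<in> scalar_extension F" unfolding scalar_extension_def by (rule division_subring_one[OF F_span])
  then have "1 * sc e \<in> scalar_extension E"
    using scalar_extension_mono[OF E(2)] e by (intro subspace_over_act[OF subspace_scalar_extension]) auto
  then show ?thesis by simp
qed

lemma sc_mem_scalar_extension_iff: "sc x \<in> scalar_extension E \<longleftrightarrow> x \<in> E"
proof
  assume "sc x \<in> scalar_extension E"
  then obtain e where e: "sc x = (\<Sum>k<64. b k * sc (e k))" "\<forall>k. e k \<in> E"
    unfolding scalar_extension_def by (rule scalar.span_family_imageE)
  obtain f where f: "1 = (\<Sum>k<64. b k * sc (f k))" "\<forall>k. f k \<in> F"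
    using division_subring_one[OF F_span] by (rule scalar.span_family_imageE)
  have "sc x = (\<Sum>k<64. b k * sc (f k)) * sc x" by (simp flip: f(1))
  then have "(\<Sum>k<64. b k * sc (e k - f k * x)) = 0"
    using e(1) by (simp add: scalar.hom_diff scalar.hom_mult right_diff_distrib sum_subtractf sum_distrib_right mult.assoc)
  then have "e k - f k * x = 0" if "k < 64" for k
    using scalar.independent_family_imageD[OF independent, of "\<lambda>k. e k - f k * x", OF UNIV_I _ that] by blast
  then have ef: "e k = f k * x" if "k < 64" for k using that by simp
  obtain k where k: "k < 64" "f k \<noteq> 0"
  proof -
    have "(\<Sum>k<64. b k * sc (f k)) \<noteq> 0" using f(1) by (metis zero_neq_one)
    then have "\<exists>k<64. f k \<noteq> 0" by (rule contrapos_np) (simp add: scalar.hom_zero)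
    then show thesis using that by blast
  qed
  obtain g where g: "g \<in> E" "f k * g = 1"
    using division_subring_inverseE[OF E(1) _ k(2)] f(2) E(2) by blast
  have "x = e k * g" using ef[OF k(1)] g(2) by (simp add: mult.commute mult.left_commute)
  then show "x \<in> E" using e(2) g(1) E(1) by (simp add: division_subring_mult)
qed (rule sc_mem_scalar_extension)

lemma J_scalar_extension:
  assumes "x \<in> scalar_extension E" shows "J x \<in> scalar_extension E"
proof -
  note sE = subspace_scalar_extension
  obtain c where c: "x = (\<Sum>i<64. b i * sc (c i))" "\<forall>i. c i \<in> E"
    using assms unfolding scalar_extension_def by (rule scalar.span_family_imageE)
  have J_sum: "J (sum f I) = (\<Sum>i\<in>I. J (f i))" for f and I :: "nat set"
    using J_add[of 0 0] by (induction I rule: infinite_finite_induct) (auto simp: J_add)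
  have Jb: "J (b i) \<in> scalar_extension E" if "i < 64" for i
  proof -
    have "J (b i) \<in> scalar_extension F"
      using J_F_span ring.span_family_base[OF scalar.division_subring_image[OF F] that, of b]
      unfolding scalar_extension_def by blast
    then show ?thesis using scalar_extension_mono[OF E(2)] by blast
  qed
  have "J x = (\<Sum>i<64. J (b i) * sc (c i))" unfolding c(1) J_sum by (simp add: J_mult J_sc sc_central)
  also have "\<dots> \<in> scalar_extension E"
    by (intro subspace_over_sum[OF sE] subspace_over_act[OF sE Jb]) (use c(2) in auto)
  finally show ?thesis .
qed

lemma central_division_algebra_scalar_extension:
  assumes D: "division_subring (scalar_extension E)"
  shows "central_division_algebra (sc ` E) (scalar_extension E) 64"
proof
  show "division_subring (sc ` E)" by (rule division_subring_scalars)
  show "division_subring (scalar_extension E)" by (rule D)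
  show "sc ` E \<subseteq> scalar_extension E" using sc_mem_scalar_extension by blast
  show "e * x = x * e" if "e \<in> sc ` E" for e x using that sc_central by blast
  show "has_dim (*) (sc ` E) 64 (scalar_extension E)"
    unfolding scalar_extension_def by (rule ring.has_dim_span_family[OF division_subring_scalars independent_over])
  show "(2::'r) \<noteq> 0" by (rule scalar.hom_two_nonzero[OF two])
  fix z assume z: "z \<in> scalar_extension E" "\<And>x. x \<in> scalar_extension E \<Longrightarrow> z * x = x * z"
  have "z * y = y * z" for y
  proof -
    have "y \<in> span_family (*) (range sc) 64 b" using span by blast
    then obtain c where c: "y = (\<Sum>i<64. b i * sc (c i))" by (rule scalar.span_family_imageE)
    have "z * (b i * sc (c i)) = b i * sc (c i) * z" if "i < 64" for i
      using z(2)[OF basis_mem_scalar_extension[OF that]] sc_central[of "c i" z] by (metis mult.assoc)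
    then show ?thesis unfolding c by (simp add: sum_distrib_left sum_distrib_right)
  qed
  then obtain x where "z = sc x" using center_sc by blast
  then show "z \<in> sc ` E" using sc_mem_scalar_extension_iff z(1) by blast
qed

lemma symplectic_scalar_extension:
  assumes D: "division_subring (scalar_extension E)"
  shows "symplectic_degree_8 (sc ` E) (scalar_extension E) J"
proof -
  interpret C: central_division_algebra "sc ` E" "scalar_extension E" 64
    by (rule central_division_algebra_scalar_extension[OF D])
  interpret I: central_division_algebra_inv "sc ` E" "scalar_extension E" 64 J
    by unfold_locales (use J_scalar_extension in \<open>auto simp: J_add J_mult J_J J_sc\<close>)
  show ?thesis
  proof
    fix p assume p: "has_dim (*) (sc ` E) p I.Skew"
    have "has_dim (*) (sc ` E) 36 (span_family (*) (sc ` E) 36 b)"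
      by (intro ring.has_dim_span_family ring.independent_family_prefix[OF _ _ independent_over] division_subring_scalars) simp
    moreover have "span_family (*) (sc ` E) 36 b \<subseteq> I.Skew"
      by (rule span_family_least[OF I.subspace_Skew]) (simp add: I.Skew_iff basis_mem_scalar_extension J_b)
    ultimately show "36 \<le> p" using ring.has_dim_mono[OF division_subring_scalars p] by blast
  qed
qed

end

definition has_square_central_Sym :: "'w set \<Rightarrow> bool" where
  "has_square_central_Sym E \<longleftrightarrow> (\<exists>x\<in>scalar_extension E. J x = x \<and> x \<notin> sc ` E \<and> x * x \<in> sc ` E)"

definition obstructed :: "'w set \<Rightarrow> bool" where
  "obstructed E \<longleftrightarrow> division_subring E \<and> F \<subseteq> E \<and> division_subring (scalar_extension E) \<and> \<not> has_square_central_Sym E"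

lemma obstructedD:
  assumes "obstructed E"
  shows "division_subring E" "F \<subseteq> E" "symplectic_degree_8 (sc ` E) (scalar_extension E) J" "\<not> has_square_central_Sym E"
proof -
  show E: "division_subring E" "F \<subseteq> E" "\<not> has_square_central_Sym E" using assms unfolding obstructed_def by blast+
  have "division_subring (scalar_extension E)" using assms unfolding obstructed_def by blast
  then show "symplectic_degree_8 (sc ` E) (scalar_extension E) J" by (rule symplectic_scalar_extension[OF E(1,2)])
qed

lemma has_square_central_SymI:
  assumes E: "symplectic_degree_8 (sc ` E) (scalar_extension E) J"
    and x: "\<exists>x\<in>central_division_algebra_inv.Sym (scalar_extension E) J.
      central_division_algebra.square_central (sc ` E) (scalar_extension E) x"
  shows "has_square_central_Sym E"
proof -
  interpret symplectic_degree_8 "sc ` E" "scalar_extension E" J by (rule E)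
  show ?thesis using x unfolding has_square_central_Sym_def by (auto simp: Sym_iff square_central_def)
qed

lemma scalar_extension_Union_chain:
  assumes ne: "\<C> \<noteq> {}" and chain: "subset.chain UNIV \<C>" and zero: "\<And>E. E \<in> \<C> \<Longrightarrow> 0 \<in> E"
  shows "scalar_extension (\<Union>\<C>) = (\<Union>E\<in>\<C>. scalar_extension E)"
proof (intro equalityI subsetI)
  fix x assume "x \<in> scalar_extension (\<Union>\<C>)"
  then obtain c where c: "x = (\<Sum>i<64. b i * sc (c i))" "\<forall>i. c i \<in> \<Union>\<C>"
    unfolding scalar_extension_def by (rule scalar.span_family_imageE)
  have "finite (c ` {..<64})" "c ` {..<64} \<subseteq> \<Union>\<C>" using c(2) by auto
  then obtain E where E: "E \<in> \<C>" "c ` {..<64} \<subseteq> E" using finite_subset_Union_chain[OF _ _ ne chain] by blast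
  have "x = (\<Sum>i<64. b i * sc (if i < 64 then c i else 0))" unfolding c(1) by (intro sum.cong) auto
  also have "\<dots> \<in> scalar_extension E"
    unfolding scalar_extension_def by (rule scalar.span_family_imageI) (use E zero in auto)
  finally show "x \<in> (\<Union>E\<in>\<C>. scalar_extension E)" using E(1) by blast
next
  fix x assume "x \<in> (\<Union>E\<in>\<C>. scalar_extension E)"
  then show "x \<in> scalar_extension (\<Union>\<C>)" using scalar_extension_mono[OF Union_upper] by blast
qed

lemma obstructed_Union_chain:
  assumes ne: "\<C> \<noteq> {}" and chain: "subset.chain {E. obstructed E} \<C>"
  shows "obstructed (\<Union>\<C>)"
proof -
  have obstructed: "obstructed E" if "E \<in> \<C>" for E using chain that unfolding subset.chain_def by auto
  have chain': "subset.chain UNIV \<C>" using chain unfolding subset.chain_def by blast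
  have union: "scalar_extension (\<Union>\<C>) = \<Union>(scalar_extension ` \<C>)"
    using scalar_extension_Union_chain[OF ne chain'] obstructed division_subring_zero unfolding obstructed_def by blast
  have "subset.chain UNIV (scalar_extension ` \<C>)"
    unfolding subset_chain_def
  proof (intro conjI ballI)
    fix A B assume "A \<in> scalar_extension ` \<C>" "B \<in> scalar_extension ` \<C>"
    then obtain E E' where E: "E \<in> \<C>" "A = scalar_extension E" "E' \<in> \<C>" "B = scalar_extension E'" by blast
    then have "E \<subseteq> E' \<or> E' \<subseteq> E" using chain' by (simp add: subset_chain_def)
    then show "A \<subseteq> B \<or> B \<subseteq> A" using E scalar_extension_mono by blast
  qed simp
  then have "division_subring (scalar_extension (\<Union>\<C>))"
    unfolding union by (rule division_subring_Union_chain[rotated]) (use ne obstructed in \<open>auto simp: obstructed_def\<close>)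
  moreover have "division_subring (\<Union>\<C>)"
    by (rule division_subring_Union_chain[OF ne chain']) (use obstructed in \<open>auto simp: obstructed_def\<close>)
  moreover have "F \<subseteq> \<Union>\<C>" using ne obstructed unfolding obstructed_def by blast
  moreover have "\<not> has_square_central_Sym (\<Union>\<C>)"
  proof
    assume "has_square_central_Sym (\<Union>\<C>)"
    then obtain x e where x: "x \<in> scalar_extension (\<Union>\<C>)" "J x = x" "x \<notin> sc ` \<Union>\<C>" "x * x = sc e" "e \<in> \<Union>\<C>"
      unfolding has_square_central_Sym_def by blast
    obtain E1 E2 where E12: "E1 \<in> \<C>" "x \<in> scalar_extension E1" "E2 \<in> \<C>" "e \<in> E2"
      using x(1,5) unfolding union by blast
    have "E1 \<subseteq> E2 \<or> E2 \<subseteq> E1" using chain' E12 by (simp add: subset_chain_def)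
    then obtain E where E: "E \<in> \<C>" "x \<in> scalar_extension E" "e \<in> E"
      using E12 scalar_extension_mono by blast
    have "has_square_central_Sym E" unfolding has_square_central_Sym_def using x E by blast
    then show False using obstructed[OF E(1)] unfolding obstructed_def by blast
  qed
  ultimately show ?thesis unfolding obstructed_def by blast
qed

lemma scalar_extension_extension:
  assumes E: "division_subring E" "F \<subseteq> E" and E': "division_subring (extension E s)"
  shows "scalar_extension (extension E s) = extension (scalar_extension E) (sc s)"
proof (intro equalityI subsetI)
  fix x assume "x \<in> scalar_extension (extension E s)"
  then obtain c where c: "x = (\<Sum>i<64. b i * sc (c i))" "\<forall>i. c i \<in> extension E s"
    unfolding scalar_extension_def by (rule scalar.span_family_imageE)
  then have "\<forall>i. \<exists>a a'. c i = a + s * a' \<and> a \<in> E \<and> a' \<in> E" by (meson adjoinE)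
  then obtain a a' where a: "\<And>i. c i = a i + s * a' i" "\<And>i. a i \<in> E" "\<And>i. a' i \<in> E" by metis
  have "b i * sc (c i) = b i * sc (a i) + sc s * (b i * sc (a' i))" for i
    unfolding a(1) scalar.hom_add scalar.hom_mult using sc_central[of s "b i"]
    by (simp add: distrib_left mult.assoc[symmetric])
  then have "x = (\<Sum>i<64. b i * sc (a i)) + sc s * (\<Sum>i<64. b i * sc (a' i))"
    unfolding c(1) by (simp add: sum.distrib sum_distrib_left)
  also have "\<dots> \<in> extension (scalar_extension E) (sc s)"
    unfolding scalar_extension_def by (intro adjoinI scalar.span_family_imageI a)
  finally show "x \<in> extension (scalar_extension E) (sc s)" .
next
  have sub: "E \<subseteq> extension E s" "F \<subseteq> extension E s" using extension_superset[OF E(1)] E(2) by auto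
  note sE = subspace_scalar_extension[OF E' sub(2)]
  fix x assume "x \<in> extension (scalar_extension E) (sc s)"
  then obtain u v where x: "x = u + sc s * v" "u \<in> scalar_extension E" "v \<in> scalar_extension E" by (rule adjoinE)
  then have "u \<in> scalar_extension (extension E s)" "v \<in> scalar_extension (extension E s)"
    using scalar_extension_mono[OF sub(1)] by auto
  then have "u + v * sc s \<in> scalar_extension (extension E s)"
    using extension_new[OF E(1)] by (intro subspace_over_add[OF sE] subspace_over_act[OF sE]) auto
  then show "x \<in> scalar_extension (extension E s)" using x(1) sc_central by simp
qed

lemma square_add_sc_mult:
  "(u + sc s * v) * (u + sc s * v) = (u * u + sc (s * s) * (v * v)) + sc s * (u * v + v * u)"
proof -
  have "u * (sc s * v) = sc s * (u * v)" using sc_central[of s u] by (metis mult.assoc)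
  moreover have "sc s * v * (sc s * v) = sc (s * s) * (v * v)"
    using sc_central[of s v] unfolding scalar.hom_mult by (metis mult.assoc)
  ultimately show ?thesis by (simp add: algebra_simps)
qed

lemma has_square_central_Sym_descent:
  assumes E: "division_subring E" "F \<subseteq> E" "symplectic_degree_8 (sc ` E) (scalar_extension E) J"
    and s: "s \<notin> E" "s * s \<in> E" and E': "division_subring (extension E s)" "has_square_central_Sym (extension E s)"
  shows "has_square_central_Sym E"
proof -
  interpret S: symplectic_degree_8 "sc ` E" "scalar_extension E" J by (rule E(3))
  note D = S.D
  obtain x f where x: "x \<in> extension (scalar_extension E) (sc s)" "J x = x" "x \<notin> sc ` extension E s"
    "x * x = sc f" "f \<in> extension E s"
    using E'(2) unfolding has_square_central_Sym_def scalar_extension_extension[OF E(1,2) E'(1)] by blast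
  obtain u v where u: "x = u + sc s * v" "u \<in> scalar_extension E" "v \<in> scalar_extension E" using x(1) by (rule adjoinE)
  obtain f1 f2 where f: "f = f1 + s * f2" "f1 \<in> E" "f2 \<in> E" using x(5) by (rule adjoinE)
  have "sc s \<notin> scalar_extension E" using sc_mem_scalar_extension_iff[OF E(1,2)] s(1) by blast
  then have unique: "y = 0 \<and> z = 0"
    if "y \<in> scalar_extension E" "z \<in> scalar_extension E" "y + sc s * z = 0" for y z
    using ring.adjoin_unique_zero[OF D division_subring_subspace[OF D order_refl] _ that] by blast
  have "J x = J u + sc s * J v" unfolding u(1) by (simp add: J_add J_mult J_sc sc_central)
  moreover have "(J u - u) + sc s * (J v - v) = (J u + sc s * J v) - (u + sc s * v)" by (simp add: algebra_simps)
  ultimately have "(J u - u) + sc s * (J v - v) = 0" using x(2) unfolding u(1) by simp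
  then have "J u - u = 0 \<and> J v - v = 0"
    by (intro unique division_subring_diff[OF D] S.J_D u)
  then have Sym: "u \<in> S.Sym" "v \<in> S.Sym" using u by (auto simp: S.Sym_iff)
  have "x * x = (u * u + sc (s * s) * (v * v)) + sc s * (u * v + v * u)" unfolding u(1) by (rule square_add_sc_mult)
  moreover have "x * x = sc f1 + sc s * sc f2" unfolding x(4) f(1) by (simp add: scalar.hom_add scalar.hom_mult)
  ultimately have "(u * u + sc (s * s) * (v * v) - sc f1) + sc s * (u * v + v * u - sc f2) = 0"
    by (simp add: algebra_simps)
  moreover have "u * u + sc (s * s) * (v * v) - sc f1 \<in> scalar_extension E" "u * v + v * u - sc f2 \<in> scalar_extension E"
    using u f s(2) sc_mem_scalar_extension[OF E(1,2)] D by (simp_all add: division_subring_closed)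
  ultimately have norm: "u * u + sc (s * s) * (v * v) = sc f1" and trace: "u * v + v * u = sc f2"
    using unique by (metis right_minus_eq)+
  have "\<not> (u \<in> sc ` E \<and> v \<in> sc ` E)"
  proof
    assume "u \<in> sc ` E \<and> v \<in> sc ` E"
    then obtain y z where yz: "u = sc y" "v = sc z" "y \<in> E" "z \<in> E" by blast
    have "x = sc (y + s * z)" unfolding u(1) yz by (simp add: scalar.hom_add scalar.hom_mult)
    then show False using x(3) adjoinI[OF yz(3,4), of "(*)" s] by blast
  qed
  moreover have "s * s \<noteq> 0" using s(1) division_subring_zero[OF E(1)] by auto
  then have "sc (s * s) \<in> sc ` E" "sc (s * s) \<noteq> 0" using s(2) unfolding scalar.hom_eq_0_iff by auto
  ultimately have "\<exists>x\<in>S.Sym. S.square_central x"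
    using norm trace f by (intro S.square_central_Sym_descent[OF Sym]) auto
  then show ?thesis by (rule has_square_central_SymI[OF E(3)])
qed

lemma maximal_obstructed_sqrt:
  assumes obstructed: "obstructed E" and max: "\<And>E'. obstructed E' \<Longrightarrow> E \<subseteq> E' \<Longrightarrow> E' = E" and e: "e \<in> E"
  shows "\<exists>s\<in>E. s * s = e"
proof (rule ccontr)
  assume no_root: "\<not> ?thesis"
  note E = obstructedD[OF obstructed]
  interpret S: symplectic_degree_8 "sc ` E" "scalar_extension E" J by (rule E(3))
  obtain s where s: "s * s = e" using sqrt by blast
  have sE: "s \<notin> E" using no_root s by blast
  have E': "division_subring (extension E s)"
    using quadratic_extension_division_subring[OF E(1), of s] no_root s e by (auto simp: mult.commute)
  have "z * z \<noteq> sc s * sc s" if z: "z \<in> scalar_extension E" for z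
  proof
    assume "z * z = sc s * sc s"
    then have zz: "z * z = sc e" by (simp add: s flip: scalar.hom_mult)
    have "z \<notin> sc ` E"
    proof
      assume "z \<in> sc ` E"
      then obtain y where "z = sc y" "y \<in> E" by blast
      then show False using zz no_root by (simp add: scalar.hom_eq_iff flip: scalar.hom_mult)
    qed
    then have "S.square_central z" using z zz e by (simp add: S.square_central_def)
    then show False
      using S.square_central_Sym_of_square_central has_square_central_SymI[OF E(3)] E(4) by blast
  qed
  moreover have "sc s * sc s \<in> scalar_extension E"
    unfolding scalar.hom_mult[symmetric] s by (rule sc_mem_scalar_extension[OF E(1,2) e])
  ultimately have "division_subring (extension (scalar_extension E) (sc s))"
    using sc_central[symmetric] by (intro quadratic_extension_division_subring[OF S.D])
  then have "division_subring (scalar_extension (extension E s))"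
    unfolding scalar_extension_extension[OF E(1,2) E'] .
  moreover have "\<not> obstructed (extension E s)"
    using max[OF _ extension_superset[OF E(1)]] sE extension_new[OF E(1), of s] by blast
  moreover have "F \<subseteq> extension E s" using E(2) extension_superset[OF E(1)] by blast
  ultimately have "has_square_central_Sym (extension E s)" using E' unfolding obstructed_def by blast
  then show False using has_square_central_Sym_descent[OF E(1-3) sE _ E'] s e E(4) by simp
qed

theorem has_square_central_Sym_base: "has_square_central_Sym F"
proof (rule ccontr)
  assume "\<not> ?thesis"
  then have "obstructed F" using F F_span by (simp add: obstructed_def scalar_extension_def)
  then obtain E where obstructed: "obstructed E" and max: "\<And>E'. obstructed E' \<Longrightarrow> E \<subseteq> E' \<Longrightarrow> E' = E"
    using subset_Zorn_nonempty[of "{E. obstructed E}"] obstructed_Union_chain by (metis (no_types, lifting) empty_iff mem_Collect_eq)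
  note E = obstructedD[OF obstructed]
  interpret S: symplectic_degree_8 "sc ` E" "scalar_extension E" J by (rule E(3))
  have "\<exists>f\<in>sc ` E. f * f = e" if "e \<in> sc ` E" for e
    using that maximal_obstructed_sqrt[OF obstructed max] by (metis (no_types, lifting) image_iff scalar.hom_mult)
  then show False
    using S.square_central_Sym_of_square_roots has_square_central_SymI[OF E(3)] E(4) by blast
qed

end

section \<open>Square matrices as a ring\<close>

typedef ('k, 'n::finite) sqmat = "UNIV :: ('k^'n^'n) set" ..

setup_lifting type_definition_sqmat

instantiation sqmat :: (field, finite) ring_1
begin

lift_definition zero_sqmat :: "('a, 'b) sqmat" is 0 .
lift_definition one_sqmat :: "('a, 'b) sqmat" is "mat 1" .
lift_definition plus_sqmat :: "('a, 'b) sqmat \<Rightarrow> ('a, 'b) sqmat \<Rightarrow> ('a, 'b) sqmat" is "(+)" .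
lift_definition minus_sqmat :: "('a, 'b) sqmat \<Rightarrow> ('a, 'b) sqmat \<Rightarrow> ('a, 'b) sqmat" is "(-)" .
lift_definition uminus_sqmat :: "('a, 'b) sqmat \<Rightarrow> ('a, 'b) sqmat" is "uminus" .
lift_definition times_sqmat :: "('a, 'b) sqmat \<Rightarrow> ('a, 'b) sqmat \<Rightarrow> ('a, 'b) sqmat" is "(**)" .

instance
proof
  have "(mat 1 :: 'a^'b^'b) \<noteq> 0"
  proof
    assume "(mat 1 :: 'a^'b^'b) = 0"
    then have "vec_nth (vec_nth (mat 1 :: 'a^'b^'b) undefined) undefined = 0" by simp
    then show False by (simp add: mat_def)
  qed
  then show "(0::('a, 'b) sqmat) \<noteq> 1" by transfer auto
  fix a b c :: "('a, 'b) sqmat"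
  show "a * b * c = a * (b * c)" by transfer (simp add: matrix_mul_assoc)
  show "(a + b) * c = a * c + b * c"
    by transfer (simp add: matrix_matrix_mult_def vec_eq_iff sum.distrib distrib_right)
  show "a * (b + c) = a * b + a * c" by transfer (simp add: matrix_add_ldistrib)
  show "a + b + c = a + (b + c)" by transfer (simp add: add.assoc)
  show "a + b = b + a" by transfer (simp add: add.commute)
qed (transfer; simp)+

end

lift_definition scal :: "'k::field \<Rightarrow> ('k, 'n::finite) sqmat" is mat .
lift_definition ent :: "('k::field, 'n::finite) sqmat \<Rightarrow> 'n \<Rightarrow> 'n \<Rightarrow> 'k" is "\<lambda>A i j. vec_nth (vec_nth A i) j" .
lift_definition tr :: "('k::field, 'n::finite) sqmat \<Rightarrow> ('k, 'n) sqmat" is transpose .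
lift_definition sqtrace :: "('k::field, 'n::finite) sqmat \<Rightarrow> 'k" is trace .
lift_definition unit :: "'n \<Rightarrow> 'n \<Rightarrow> ('k::field, 'n::finite) sqmat" is
  "\<lambda>a b. \<chi> i j. if i = a \<and> j = b then 1 else 0" .
lift_definition sqmat_of :: "('a \<Rightarrow> 'k::field) \<Rightarrow> 'a^'n^'n \<Rightarrow> ('k, 'n::finite) sqmat" is map_matrix .

lemma sqmat_eqI: "(\<And>i j. ent A i j = ent B i j) \<Longrightarrow> A = B"
  by transfer (simp add: vec_eq_iff)

lemma ent_simps [simp]:
  "ent 0 i j = 0" "ent (A + B) i j = ent A i j + ent B i j" "ent (A - B) i j = ent A i j - ent B i j"
  "ent (- A) i j = - ent A i j" "ent (tr A) i j = ent A j i"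
  "ent (unit a b) i j = (if i = a \<and> j = b then 1 else 0)" "ent (scal c) i j = (if i = j then c else 0)"
  "ent (sqmat_of f M) i j = f (vec_nth (vec_nth M i) j)"
  by (transfer, simp add: transpose_def mat_def)+

lemma ent_mult: "ent (A * B) i j = (\<Sum>k\<in>UNIV. ent A i k * ent B k j)"
  by transfer (simp add: matrix_matrix_mult_def)

lemma ent_sum: "ent (sum f I) i j = (\<Sum>x\<in>I. ent (f x) i j)"
  by (induction I rule: infinite_finite_induct) auto

lemma ent_scal_left [simp]: "ent (scal c * A) i j = c * ent A i j"
  unfolding ent_mult by (simp add: if_distrib[of "\<lambda>x. x * _"] sum.delta cong: if_cong)

lemma ent_scal_right [simp]: "ent (A * scal c) i j = ent A i j * c"
  unfolding ent_mult by (simp add: if_distrib[of "\<lambda>x. _ * x"] sum.delta' cong: if_cong)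

lemma scal_central: "scal c * A = A * scal c"
  by (rule sqmat_eqI) (simp add: mult.commute)

interpretation scal: division_ring_hom "scal :: 'k::field \<Rightarrow> ('k, 'n::finite) sqmat"
proof
  show "scal 1 = (1 :: ('k, 'n) sqmat)" by transfer simp
  show "scal (x + y) = (scal x + scal y :: ('k, 'n) sqmat)" for x y by (rule sqmat_eqI) simp
  show "scal (x * y) = (scal x * scal y :: ('k, 'n) sqmat)" for x y by (rule sqmat_eqI) simp
qed

lemma division_subring_scal: "division_subring (range (scal :: 'k::field \<Rightarrow> ('k, 'n::finite) sqmat))"
  by (rule scal.division_subring_image[OF division_subring_UNIV])

lemma tr_mult: "tr (A * B) = tr B * tr A"
  by transfer (rule matrix_transpose_mul)

lemma tr_tr [simp]: "tr (tr A) = A"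
  and tr_scal [simp]: "tr (scal c) = scal c"
  and tr_add: "tr (A + B) = tr A + tr B"
  by (rule sqmat_eqI; simp)+

lemma tr_one [simp]: "tr 1 = 1"
  using tr_scal[of 1] by (simp add: scal.hom_one)

lemma sqtrace_mult_commute: "sqtrace (A * B) = sqtrace (B * A)"
  by transfer (rule trace_mul_sym)

lemma sqtrace_add: "sqtrace (A + B) = sqtrace A + sqtrace B"
  by transfer (rule trace_add)

lemma sqtrace_zero: "sqtrace 0 = 0"
  by transfer (simp add: trace_def)

lemma sqtrace_scal_right: "sqtrace (A * scal c) = sqtrace A * c"
  by transfer (simp add: trace_def matrix_matrix_mult_def mat_def sum_distrib_right
      if_distrib[of "\<lambda>x. _ * x"] sum.delta' cong: if_cong)

lemma sqtrace_tr: "sqtrace (tr A) = sqtrace A"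
  by transfer (simp add: trace_def transpose_def)

lemma sqmat_center:
  assumes "\<And>A. Z * A = A * Z"
  shows "Z \<in> range scal"
proof -
  have entry: "ent Z i a = (if i = a then ent Z b b else 0)" for i a b
  proof -
    have "ent (Z * unit a b) i b = ent Z i a"
      unfolding ent_mult by (simp add: if_distrib[of "\<lambda>x. _ * x"] cong: if_cong)
    moreover have "ent (unit a b * Z) i b = (if i = a then ent Z b b else 0)"
      unfolding ent_mult by (simp add: if_distrib[of "\<lambda>x. x * _"] cong: if_cong conj_cong)
    ultimately show ?thesis using assms[of "unit a b"] by simp
  qed
  have "Z = scal (ent Z undefined undefined)" by (rule sqmat_eqI) (subst entry[of _ _ undefined], simp)
  then show ?thesis by blast
qed

lemma sqmat_eq_sum_unit: "A = (\<Sum>a\<in>UNIV. \<Sum>b\<in>UNIV. unit a b * scal (ent A a b))"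
proof (rule sqmat_eqI)
  fix i j
  have "ent (\<Sum>a\<in>UNIV. \<Sum>b\<in>UNIV. unit a b * scal (ent A a b)) i j
    = (\<Sum>a\<in>UNIV. \<Sum>b\<in>UNIV. if a = i then (if b = j then ent A a b else 0) else 0)"
    unfolding ent_sum ent_scal_right by (intro sum.cong refl) simp
  also have "\<dots> = (\<Sum>a\<in>UNIV. if a = i then ent A a j else 0)" by (intro sum.cong refl) simp
  also have "\<dots> = ent A i j" by simp
  finally show "ent A i j = ent (\<Sum>a\<in>UNIV. \<Sum>b\<in>UNIV. unit a b * scal (ent A a b)) i j" by simp
qed

definition supported :: "('n \<times> 'n) set \<Rightarrow> ('k::field, 'n::finite) sqmat set" where
  "supported P = {A. \<forall>i j. (i, j) \<notin> P \<longrightarrow> ent A i j = 0}"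

lemma has_dim_supported: "has_dim (*) (range scal) (card P) (supported P :: ('k::field, 'n::finite) sqmat set)"
proof (induction P rule: finite_induct[OF finite])
  case 1
  have "supported {} = {0 :: ('k, 'n) sqmat}" unfolding supported_def by (auto intro: sqmat_eqI)
  then show ?case by (simp add: has_dim_0)
next
  case (2 p P)
  obtain a b where p: "p = (a, b)" by fastforce
  let ?u = "unit a b :: ('k, 'n) sqmat"
  have "?u \<notin> supported P"
  proof
    assume "?u \<in> supported P"
    then have "ent ?u a b = 0" using 2(2) p unfolding supported_def by blast
    then show False by simp
  qed
  moreover have "adjoin (*) (range scal) (supported P) ?u = supported (insert p P)"
  proof (intro equalityI subsetI)
    fix A :: "('k, 'n) sqmat" assume A: "A \<in> supported (insert p P)"
    have "A = (A - ?u * scal (ent A a b)) + ?u * scal (ent A a b)" by simp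
    also have "\<dots> \<in> adjoin (*) (range scal) (supported P) ?u"
      by (rule adjoinI) (use A in \<open>auto simp: supported_def p\<close>)
    finally show "A \<in> adjoin (*) (range scal) (supported P) ?u" .
  next
    fix A :: "('k, 'n) sqmat" assume "A \<in> adjoin (*) (range scal) (supported P) ?u"
    then obtain B c where "A = B + ?u * scal c" "B \<in> supported P" by (auto elim!: adjoinE)
    then show "A \<in> supported (insert p P)" by (auto simp: supported_def p)
  qed
  ultimately show ?case using has_dim_Suc[OF 2(3), of ?u] 2(1,2) by simp
qed

lemma has_dim_sqmat: "has_dim (*) (range scal) (CARD('n) * CARD('n)) (UNIV :: ('k::field, 'n::finite) sqmat set)"
proof -
  have UNIV: "UNIV = (supported UNIV :: ('k, 'n) sqmat set)" by (simp add: supported_def)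
  show ?thesis unfolding UNIV card_prod[symmetric] by (rule has_dim_supported)
qed

lemma dim_alternating_le:
  assumes two: "(2::'k::field) \<noteq> 0" and W: "W \<subseteq> {A :: ('k, 'n::finite) sqmat. tr A = - A}"
    and m: "has_dim (*) (range scal) m W"
  shows "2 * m + CARD('n) \<le> CARD('n) * CARD('n)"
proof -
  obtain g :: "'n \<Rightarrow> nat" where g: "inj g"
    using finite_imp_inj_to_nat_seg[of "UNIV :: 'n set"] by auto
  define U L where "U = {(i, j). g i < g j}" and "L = {(i, j). g j \<le> g i}"
  have "U \<union> L = UNIV" "U \<inter> L = {}" unfolding U_def L_def by auto
  then have "card U + card L = CARD('n) * CARD('n)" using card_Un_disjoint[of U L] by (simp add: card_prod)
  moreover have "card L = card U + CARD('n)"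
  proof -
    have "L = U\<inverse> \<union> range (\<lambda>i. (i, i))" unfolding U_def L_def using g by (auto simp: inj_def le_less)
    moreover have "U\<inverse> \<inter> range (\<lambda>i. (i, i)) = {}" unfolding U_def by auto
    ultimately have "card L = card (U\<inverse>) + card (range (\<lambda>i::'n. (i, i)))" by (simp add: card_Un_disjoint)
    then show ?thesis by (simp add: card_inverse card_image inj_on_def)
  qed
  moreover have "has_dim (*) (range scal) (m + card L) (W + supported L)"
  proof (rule ring.has_dim_direct_sum[OF division_subring_scal m has_dim_supported], rule subsetI)
    fix A assume "A \<in> W \<inter> supported L"
    then have A: "tr A = - A" "\<And>i j. g i < g j \<Longrightarrow> ent A i j = 0" using W by (auto simp: supported_def L_def)
    have skew: "ent A j i = - ent A i j" for i j using arg_cong[OF A(1), of "\<lambda>B. ent B i j"] by simp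
    have "ent A i j = 0" for i j
    proof (cases "g i" "g j" rule: linorder_cases)
      case equal
      then have "i = j" using g by (simp add: inj_def)
      then have "ent A i j + ent A i j = 0" using skew[of i i] by (metis add.right_inverse)
      then have "2 * ent A i j = 0" by (simp only: mult_2)
      then show ?thesis using two by simp
    qed (use A(2) skew[of i j] in auto)
    then show "A \<in> {0}" by (auto intro: sqmat_eqI)
  qed
  then have "m + card L \<le> CARD('n) * CARD('n)"
    by (rule ring.has_dim_mono[OF division_subring_scal has_dim_sqmat _ subset_UNIV])
  ultimately show ?thesis by linarith
qed

lemma sqmat_of_add:
  "(\<And>x y. f (x + y) = f x + f y) \<Longrightarrow> sqmat_of f (M + N) = sqmat_of f M + sqmat_of f N"
  by (rule sqmat_eqI) simp

lemma sqmat_of_mult: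
  assumes "unital_ring_hom f" shows "sqmat_of f (M ** N) = sqmat_of f M * sqmat_of f N"
proof -
  interpret unital_ring_hom f by fact
  show ?thesis by (rule sqmat_eqI) (simp add: ent_mult matrix_matrix_mult_def hom_sum hom_mult)
qed

lemma sqmat_of_mat: "f 0 = 0 \<Longrightarrow> sqmat_of f (mat c) = scal (f c)"
  by (rule sqmat_eqI) (simp add: mat_def)

lemma sqmat_of_transpose: "sqmat_of f (transpose M) = tr (sqmat_of f M)"
  by (rule sqmat_eqI) (simp add: transpose_def)

lemma twisted_transpose_involution:
  assumes A: "tr A = - A" "A * A' = 1" "A' * A = 1"
  defines "J \<equiv> \<lambda>B. A' * tr B * A"
  shows "J (B + C) = J B + J C" "J (B * C) = J C * J B" "J (J B) = B" "J (scal c) = scal c"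
proof -
  show "J (B + C) = J B + J C" unfolding J_def by (simp add: tr_add algebra_simps)
  have "J C * J B = A' * tr C * (A * A') * tr B * A" unfolding J_def by (simp only: mult.assoc)
  then show "J (B * C) = J C * J B" unfolding A(2) J_def tr_mult by (simp add: mult.assoc)
  have "tr A' = tr A' * (A * A')" using A(2) by simp
  also have "\<dots> = - (tr (A * A') * A')" unfolding tr_mult A(1) by (simp add: mult.assoc)
  also have "\<dots> = - A'" using A(2) by simp
  finally have A': "tr A' = - A'" .
  have "J (J B) = A' * tr A * B * tr A' * A" unfolding J_def tr_mult tr_tr by (simp only: mult.assoc)
  also have "\<dots> = (A' * A) * B * (A' * A)" unfolding A(1) A' by (simp add: mult.assoc)
  finally show "J (J B) = B" unfolding A(3) by simp
  have "J (scal c) = scal c * (A' * A)" unfolding J_def tr_scal using scal_central[of c A'] by (simp flip: mult.assoc)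
  then show "J (scal c) = scal c" unfolding A(3) by simp
qed

section \<open>Split division algebras of degree 8\<close>

lemma (in unital_ring_hom) image_span_family:
  "f ` span_family (*) E n b = span_family (*) (f ` E) n (\<lambda>i. f (b i))"
proof (intro equalityI subsetI)
  fix y assume "y \<in> f ` span_family (*) E n b"
  then obtain c where "y = f (\<Sum>i<n. b i * c i)" "\<forall>i. c i \<in> E" by (auto elim!: span_familyE)
  then show "y \<in> span_family (*) (f ` E) n (\<lambda>i. f (b i))"
    using span_family_imageI[of c E "\<lambda>i. f (b i)" n] by (simp add: hom_sum hom_mult)
next
  fix y assume "y \<in> span_family (*) (f ` E) n (\<lambda>i. f (b i))"
  then obtain c where c: "y = (\<Sum>i<n. f (b i) * f (c i))" "\<forall>i. c i \<in> E" by (rule span_family_imageE)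
  have "(\<Sum>i<n. b i * c i) \<in> span_family (*) E n b" by (rule span_familyI) (use c(2) in simp)
  moreover have "y = f (\<Sum>i<n. b i * c i)" unfolding c(1) by (simp add: hom_sum hom_mult)
  ultimately show "y \<in> f ` span_family (*) E n b" by blast
qed

lemma has_dim_of_algebra_dim:
  assumes "central_algebra_hom \<iota>" and dim: "algebra_dim \<iota> m"
  shows "has_dim (*) (range \<iota>) m UNIV"
proof -
  have \<iota>: "\<iota> 1 = 1" "\<iota> (x + y) = \<iota> x + \<iota> y" "\<iota> (x * y) = \<iota> x * \<iota> y" "\<iota> x * z = z * \<iota> x" for x y z
    using assms(1) unfolding central_algebra_hom_def by blast+
  interpret division_ring_hom \<iota> by unfold_locales (rule \<iota>)+
  obtain e where e: "\<And>d. \<exists>!c. (\<forall>i\<ge>m. c i = 0) \<and> d = (\<Sum>i<m. \<iota> (c i) * e i)"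
    using dim unfolding algebra_dim_def by blast
  have commute: "(\<Sum>i<m. \<iota> (c i) * e i) = (\<Sum>i<m. e i * \<iota> (c i))" for c by (simp add: \<iota>(4))
  have "independent_family (*) (range \<iota>) m e"
  proof (rule independent_family_imageI)
    fix c i assume c: "(\<Sum>i<m. e i * \<iota> (c i)) = 0" and i: "i < m"
    let ?c = "\<lambda>i. if i < m then c i else 0"
    have "(\<Sum>i<m. \<iota> (?c i) * e i) = 0" using c unfolding commute[symmetric] by simp
    moreover have "(\<Sum>i<m. \<iota> ((\<lambda>_. 0) i) * e i) = 0" by (simp add: hom_zero)
    moreover obtain c0 where "\<And>c. \<forall>i\<ge>m. c i = 0 \<Longrightarrow> 0 = (\<Sum>i<m. \<iota> (c i) * e i) \<Longrightarrow> c = c0"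
      using e[of 0] by (rule ex1E) blast
    ultimately have "?c = c0" "(\<lambda>_. 0) = c0" by simp_all
    then have "?c = (\<lambda>_. 0)" by simp
    then show "c i = 0" using i by metis
  qed
  moreover have "x \<in> span_family (*) (range \<iota>) m e" for x
  proof -
    obtain c where "x = (\<Sum>i<m. \<iota> (c i) * e i)" using e[of x] by blast
    then show ?thesis unfolding commute by (auto intro: span_familyI[where act = "(*)"])
  qed
  then have "span_family (*) (range \<iota>) m e = UNIV" by blast
  ultimately show ?thesis
    using ring.has_dim_span_family[OF division_subring_image[OF division_subring_UNIV]] by metis
qed

locale split_orthogonal_algebra =
  fixes \<iota> :: "'a::field \<Rightarrow> 'd::division_ring" and \<gamma> :: "'d \<Rightarrow> 'd"
    and \<kappa> :: "'a \<Rightarrow> 'k::field" and \<phi> :: "'d \<Rightarrow> 'k^8^8"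
  assumes char: "(2::'a) \<noteq> 0"
    and central: "central_division_algebra_deg8 \<iota>"
    and involution: "F_linear_involution \<iota> \<gamma>"
    and splitting: "splitting_deg8 \<iota> \<kappa> \<phi>"
    and orthogonal: "orthogonal_wrt \<phi> \<gamma>"
begin

sublocale iota: division_ring_hom \<iota>
  by unfold_locales
    (use central in \<open>auto simp: central_division_algebra_deg8_def central_algebra_hom_def\<close>)

abbreviation F :: "'d set" where "F \<equiv> range \<iota>"

lemma center_eq_F: "{z. \<forall>d. z * d = d * z} = F"
  using central unfolding central_division_algebra_deg8_def central_algebra_hom_def by blast

sublocale central_division_algebra F "UNIV :: 'd set" 64
proof
  show "division_subring F" by (rule iota.division_subring_image[OF division_subring_UNIV])
  show "division_subring (UNIV :: 'd set)" by (rule division_subring_UNIV)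
  show "has_dim (*) F 64 (UNIV :: 'd set)"
    using has_dim_of_algebra_dim central unfolding central_division_algebra_deg8_def by blast
  show "(2::'d) \<noteq> 0" by (rule iota.hom_two_nonzero[OF char])
qed (use center_eq_F in auto)

sublocale central_division_algebra_inv F "UNIV :: 'd set" 64 \<gamma>
proof
  show mult: "\<gamma> (x * y) = \<gamma> y * \<gamma> x" and inv: "\<gamma> (\<gamma> x) = x" for x y
    using involution unfolding F_linear_involution_def by blast+
  have "\<gamma> 1 = 1" using mult[of "\<gamma> 1" 1] by (simp add: inv)
  moreover have "\<gamma> (\<iota> a * 1) = \<iota> a * \<gamma> 1" for a using involution unfolding F_linear_involution_def by blast
  ultimately show "\<gamma> e = e" if "e \<in> F" for e using that by auto
qed (use involution in \<open>auto simp: F_linear_involution_def\<close>)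

sublocale kappa: division_ring_hom \<kappa>
  by unfold_locales (use splitting in \<open>auto simp: splitting_deg8_def\<close>)

interpretation to_ac: division_ring_hom "to_ac :: 'k \<Rightarrow> 'k alg_closure"
  by unfold_locales auto

definition \<Psi> :: "'d \<Rightarrow> ('k alg_closure, 8) sqmat" where
  "\<Psi> d = sqmat_of to_ac (\<phi> d)"

lemma Psi_iota: "\<Psi> (\<iota> a) = scal (to_ac (\<kappa> a))"
  using splitting unfolding \<Psi>_def splitting_deg8_def by (simp add: sqmat_of_mat)

sublocale Psi: division_ring_hom \<Psi>
proof
  show "\<Psi> 1 = 1" using Psi_iota[of 1] by (simp add: iota.hom_one kappa.hom_one scal.hom_one)
  show "\<Psi> (x + y) = \<Psi> x + \<Psi> y" for x y
    using splitting unfolding \<Psi>_def splitting_deg8_def by (simp add: sqmat_of_add)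
  show "\<Psi> (x * y) = \<Psi> x * \<Psi> y" for x y
    using splitting unfolding \<Psi>_def splitting_deg8_def by (simp add: sqmat_of_mult to_ac.unital_ring_hom_axioms)
qed

abbreviation F0 :: "'k alg_closure set" where "F0 \<equiv> range (\<lambda>a. to_ac (\<kappa> a))"

lemma Psi_F: "\<Psi> ` F = scal ` F0"
  by (simp add: image_image Psi_iota)

lemma division_subring_F0: "division_subring F0"
  using to_ac.division_subring_image[OF kappa.division_subring_image[OF division_subring_UNIV]]
  by (simp add: image_image)

lemma Psi_range_spans:
  assumes V: "subspace_over (*) (range scal) V" and Psi: "range \<Psi> \<subseteq> V"
  shows "V = UNIV"
proof -
  have sqmat_of_V: "sqmat_of to_ac M \<in> V" for M :: "'k^8^8"
  proof -
    obtain n and k :: "nat \<Rightarrow> 'k" and d :: "nat \<Rightarrow> 'd" where M: "M = (\<Sum>i<n. mat (k i) ** \<phi> (d i))"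
      using splitting unfolding splitting_deg8_def by blast
    have "sqmat_of to_ac (sum f I) = (\<Sum>i\<in>I. sqmat_of to_ac (f i))" for f :: "nat \<Rightarrow> 'k^8^8" and I
      by (rule sqmat_eqI) (simp add: ent_sum to_ac.hom_sum)
    then have "sqmat_of to_ac M = (\<Sum>i<n. sqmat_of to_ac (mat (k i) ** \<phi> (d i)))" unfolding M .
    also have "\<dots> = (\<Sum>i<n. \<Psi> (d i) * scal (to_ac (k i)))"
      by (intro sum.cong refl) (simp add: \<Psi>_def sqmat_of_mult to_ac.unital_ring_hom_axioms sqmat_of_mat scal_central)
    also have "\<dots> \<in> V" using Psi by (intro subspace_over_sum[OF V] subspace_over_act[OF V]) auto
    finally show ?thesis .
  qed
  have "A \<in> V" for A
  proof -
    have "unit a b = sqmat_of to_ac (\<chi> i j. if i = a \<and> j = b then 1 else 0)" for a b by (rule sqmat_eqI) simp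
    then have unit: "unit a b \<in> V" for a b using sqmat_of_V by metis
    show ?thesis
      by (subst sqmat_eq_sum_unit, intro subspace_over_sum[OF V] subspace_over_act[OF V unit]) simp
  qed
  then show ?thesis by blast
qed

lemma Psi_basis:
  assumes z: "span_family (*) F 64 z = UNIV"
  shows "span_family (*) (range scal) 64 (\<lambda>i. \<Psi> (z i)) = UNIV" "independent_family (*) (range scal) 64 (\<lambda>i. \<Psi> (z i))"
proof -
  have "range \<Psi> = span_family (*) (scal ` F0) 64 (\<lambda>i. \<Psi> (z i))"
    using Psi.image_span_family[of F 64 z] unfolding z Psi_F .
  also have "\<dots> \<subseteq> span_family (*) (range scal) 64 (\<lambda>i. \<Psi> (z i))" by (rule span_family_mono) auto
  finally show span: "span_family (*) (range scal) 64 (\<lambda>i. \<Psi> (z i)) = UNIV"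
    by (rule Psi_range_spans[OF ring.subspace_over_span_family[OF division_subring_scal]])
  have "has_dim (*) (range scal) 64 (UNIV :: ('k alg_closure, 8) sqmat set)"
    using has_dim_sqmat[where ?'k = "'k alg_closure" and ?'n = 8] by simp
  then show "independent_family (*) (range scal) 64 (\<lambda>i. \<Psi> (z i))"
    by (rule ring.independent_family_of_spanning[OF division_subring_scal]) (simp add: span)
qed

lemma Psi_independent:
  assumes z: "independent_family (*) F n z"
  shows "independent_family (*) (range scal) n (\<lambda>i. \<Psi> (z i))"
proof -
  have "n \<le> 64" using ring.has_dim_mono[OF E dim_D ring.has_dim_span_family[OF E z]] by simp
  then have "has_dim (*) F (n + (64 - n)) UNIV" using dim_D by simp
  then obtain b where b: "\<And>i. i < n \<Longrightarrow> b i = z i" "span_family (*) F (n + (64 - n)) b = UNIV"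
    by (rule ring.basis_extension[OF E _ z UNIV_I]) (rule that)
  have "independent_family (*) (range scal) n (\<lambda>i. \<Psi> (b i))"
    by (rule ring.independent_family_prefix[OF division_subring_scal \<open>n \<le> 64\<close> Psi_basis(2)]) (use b(2) \<open>n \<le> 64\<close> in simp)
  moreover have "independent_family (*) (range scal) n (\<lambda>i. \<Psi> (b i)) = independent_family (*) (range scal) n (\<lambda>i. \<Psi> (z i))"
    by (rule independent_family_cong) (simp add: b(1))
  ultimately show ?thesis by blast
qed

lemma form_matrixE:
  obtains S T where "tr S = S" "S * T = 1" "T * S = 1" "\<And>d. \<Psi> (\<gamma> d) = T * tr (\<Psi> d) * S"
proof -
  obtain S :: "'k^8^8" where S: "transpose S = S" "invertible S" "\<And>d. \<phi> (\<gamma> d) = matrix_inv S ** transpose (\<phi> d) ** S"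
    using orthogonal unfolding orthogonal_wrt_def by blast
  note sqmat_of = sqmat_of_mult[OF to_ac.unital_ring_hom_axioms]
  have "S ** matrix_inv S = mat 1 \<and> matrix_inv S ** S = mat 1"
    using S(2) unfolding invertible_def matrix_inv_def by (rule someI_ex)
  then have "sqmat_of to_ac S * sqmat_of to_ac (matrix_inv S) = 1" "sqmat_of to_ac (matrix_inv S) * sqmat_of to_ac S = 1"
    by (simp_all add: sqmat_of_mat scal.hom_one flip: sqmat_of)
  moreover have "tr (sqmat_of to_ac S) = sqmat_of to_ac S" using S(1) by (simp flip: sqmat_of_transpose)
  moreover have "\<Psi> (\<gamma> d) = sqmat_of to_ac (matrix_inv S) * tr (\<Psi> d) * sqmat_of to_ac S" for d
    unfolding \<Psi>_def S(3) sqmat_of sqmat_of_transpose ..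
  ultimately show thesis using that by blast
qed

text \<open>By the choice of \<open>S\<close>, the matrices \<open>S \<Psi>(x)\<close> with \<open>x\<close> skew are alternating.\<close>

lemma dim_Skew_le:
  assumes k: "has_dim (*) F k Skew" shows "k \<le> 28"
proof -
  obtain S T where S: "tr S = S" "S * T = 1" "T * S = 1" "\<And>d. \<Psi> (\<gamma> d) = T * tr (\<Psi> d) * S" by (rule form_matrixE) (rule that)
  obtain z where z: "independent_family (*) F k z" "\<And>i. i < k \<Longrightarrow> z i \<in> Skew" using ring.has_dim_basisE[OF E k] by metis
  let ?V = "span_family (*) (range scal) k (\<lambda>i. \<Psi> (z i))"
  let ?A = "{B. tr (S * B) = - (S * B)}"
  have "subspace_over (*) (range scal) ?A"
    unfolding subspace_over_def
  proof (intro conjI ballI)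
    fix B e assume B: "B \<in> ?A" and "e \<in> range (scal :: 'k alg_closure \<Rightarrow> ('k alg_closure, 8) sqmat)"
    then obtain c where e: "e = scal c" by blast
    have "tr (S * (B * e)) = scal c * tr (S * B)" unfolding e mult.assoc[symmetric] tr_mult[of _ "scal c"] tr_scal ..
    then show "B * e \<in> ?A" using B scal_central[of c "S * B"] by (simp add: e mult.assoc)
  next
    show "0 \<in> ?A" by (simp add: sqmat_eqI)
  qed (simp add: tr_add distrib_left)
  moreover have "\<Psi> (z i) \<in> ?A" if "i < k" for i
  proof -
    have "tr (S * \<Psi> (z i)) = S * (T * tr (\<Psi> (z i)) * S)" unfolding tr_mult S(1) using S(2) by (simp flip: mult.assoc)
    also have "\<dots> = - (S * \<Psi> (z i))" using z(2)[OF that] by (simp add: Skew_iff Psi.hom_minus flip: S(4))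
    finally show ?thesis by simp
  qed
  ultimately have "?V \<subseteq> ?A" by (rule span_family_least)
  then have alternating: "(*) S ` ?V \<subseteq> {A. tr A = - A}" by blast
  have dim: "has_dim (*) (range scal) k ((*) S ` ?V)"
  proof (rule ring.has_dim_image[OF division_subring_scal _ right_module_times])
    show "has_dim (*) (range scal) k ?V" by (rule ring.has_dim_span_family[OF division_subring_scal Psi_independent[OF z(1)]])
    show "B = 0" if "S * B = 0" for B using arg_cong[OF that, of "(*) T"] S(3) by (simp flip: mult.assoc)
  qed (simp add: linear_over_def distrib_left mult.assoc)
  have "2 * k + CARD(8) \<le> CARD(8) * CARD(8)"
    by (rule dim_alternating_le[OF to_ac.hom_two_nonzero[OF kappa.hom_two_nonzero[OF char]] alternating dim])
  then show ?thesis by simp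
qed

lemma Skew_nonzeroE:
  obtains c where "\<gamma> c = - c" "c \<noteq> 0"
proof -
  have "\<not> (\<forall>c. \<gamma> c = - c \<longrightarrow> c = 0)"
  proof
    assume no: "\<forall>c. \<gamma> c = - c \<longrightarrow> c = 0"
    have "\<gamma> x = x" for x :: 'd
    proof -
      have "\<gamma> (\<gamma> x - x) = - (\<gamma> x - x)" using J_diff[of "\<gamma> x" x] J_J[of x] by simp
      then have "\<gamma> x - x = 0" using no by blast
      then show ?thesis by simp
    qed
    then have "x * y = y * x" for x y :: 'd using J_mult[of x y] by simp
    then have "(64::nat) * 64 \<le> 64" by (rule commutative_dim(1)[OF D E_sub order_refl _ dim_D])
    then show False by simp
  qed
  then show thesis using that by blast
qed

text \<open>For a skew unit \<open>c\<close>, the involution \<open>x \<mapsto> c\<^sup>-\<^sup>1 \<gamma>(x) c\<close> is symplectic.\<close>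

lemma twisted_skew_basisE:
  assumes c: "\<gamma> c = - c" "c \<noteq> 0"
  obtains z where "\<And>i. i < 36 \<Longrightarrow> inverse c * \<gamma> (z i) * c = - z i" "span_family (*) F 64 z = UNIV"
proof -
  obtain r p where r: "has_dim (*) F r Sym" "has_dim (*) F p Skew" "r + p = 64" using has_dim_Sym_SkewE .
  have "36 \<le> r" using dim_Skew_le[OF r(2)] r(3) by simp
  let ?W = "(*) (inverse c) ` Sym"
  have W: "has_dim (*) F r ?W"
    by (rule ring.has_dim_image[OF E r(1) right_module_times]) (use c(2) in \<open>auto simp: linear_over_def distrib_left mult.assoc\<close>)
  have W_skew: "inverse c * \<gamma> x * c = - x" if "x \<in> ?W" for x
  proof -
    obtain s where s: "\<gamma> s = s" "x = inverse c * s" using \<open>x \<in> ?W\<close> by (auto simp: Sym_iff)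
    have "\<gamma> (inverse c) * c = - (\<gamma> (inverse c) * \<gamma> c)" unfolding c(1) by simp
    also have "\<dots> = - \<gamma> (c * inverse c)" by (simp add: J_mult)
    also have "\<dots> = - 1" using c(2) J_one by simp
    finally have "\<gamma> x * c = - s" unfolding s(2) using s(1) by (simp add: J_mult mult.assoc)
    then show ?thesis unfolding s(2) by (simp add: mult.assoc)
  qed
  obtain y where y: "independent_family (*) F r y" "\<And>i. i < r \<Longrightarrow> y i \<in> ?W" using ring.has_dim_basisE[OF E W] by metis
  have "has_dim (*) F (36 + 28) UNIV" using dim_D by simp
  then obtain z where z: "\<And>i. i < 36 \<Longrightarrow> z i = y i" "span_family (*) F (36 + 28) z = UNIV"
    by (rule ring.basis_extension[OF E _ ring.independent_family_prefix[OF E \<open>36 \<le> r\<close> y(1)] UNIV_I]) (rule that)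
  show thesis
  proof (rule that)
    show "inverse c * \<gamma> (z i) * c = - z i" if "i < 36" for i
      unfolding z(1)[OF that] by (rule W_skew[OF y(2)]) (use that \<open>36 \<le> r\<close> in simp)
    show "span_family (*) F 64 z = UNIV" using z(2) by simp
  qed
qed

lemma alternating_form_matrixE:
  assumes c: "\<gamma> c = - c" "c \<noteq> 0"
  obtains A A' where "tr A = - A" "A * A' = 1" "A' * A = 1" "\<And>d. A' * tr (\<Psi> d) * A = \<Psi> (inverse c * \<gamma> d * c)"
proof -
  obtain S T where S: "tr S = S" "S * T = 1" "T * S = 1" "\<And>d. \<Psi> (\<gamma> d) = T * tr (\<Psi> d) * S" by (rule form_matrixE) (rule that)
  let ?A = "S * \<Psi> c" and ?A' = "\<Psi> (inverse c) * T"
  have cc: "\<Psi> c * \<Psi> (inverse c) = 1" "\<Psi> (inverse c) * \<Psi> c = 1"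
    using c(2) by (simp_all add: Psi.hom_one flip: Psi.hom_mult)
  show thesis
  proof (rule that)
    have "tr ?A = S * (T * tr (\<Psi> c) * S)" unfolding tr_mult S(1) using S(2) by (simp flip: mult.assoc)
    then show "tr ?A = - ?A" unfolding S(4)[symmetric] c(1) by (simp add: Psi.hom_minus)
    have "?A * ?A' = S * (\<Psi> c * \<Psi> (inverse c)) * T" by (simp add: mult.assoc)
    then show "?A * ?A' = 1" using cc S by simp
    have "?A' * ?A = \<Psi> (inverse c) * (T * S) * \<Psi> c" by (simp add: mult.assoc)
    then show "?A' * ?A = 1" using cc S by simp
    show "?A' * tr (\<Psi> d) * ?A = \<Psi> (inverse c * \<gamma> d * c)" for d
      unfolding Psi.hom_mult S(4) by (simp add: mult.assoc)
  qed
qed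

theorem ex_square_central: "\<exists>x. square_central x"
proof -
  obtain c where c: "\<gamma> c = - c" "c \<noteq> 0" by (rule Skew_nonzeroE)
  obtain z where z: "\<And>i. i < 36 \<Longrightarrow> inverse c * \<gamma> (z i) * c = - z i" "span_family (*) F 64 z = UNIV"
    by (rule twisted_skew_basisE[OF c]) (rule that)
  obtain A A' where A: "tr A = - A" "A * A' = 1" "A' * A = 1"
    and J_Psi: "\<And>d. A' * tr (\<Psi> d) * A = \<Psi> (inverse c * \<gamma> d * c)"
    by (rule alternating_form_matrixE[OF c]) (rule that)
  let ?J = "\<lambda>B. A' * tr B * A" and ?b = "\<lambda>i. \<Psi> (z i)"
  note J = twisted_transpose_involution[OF A]
  have span: "span_family (*) (scal ` F0) 64 ?b = range \<Psi>" using Psi.image_span_family[of F 64 z] unfolding z(2) Psi_F by simp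
  interpret symplectic: split_symplectic_algebra scal ?b F0 ?J
  proof
    show "\<exists>y::'k alg_closure. y * y = e" for e using nth_root_exists[of 2 e] by (auto simp: power2_eq_square)
    show "division_subring (span_family (*) (scal ` F0) 64 ?b)"
      unfolding span by (rule Psi.division_subring_image[OF division_subring_UNIV])
    show "?J ` span_family (*) (scal ` F0) 64 ?b \<subseteq> span_family (*) (scal ` F0) 64 ?b" unfolding span using J_Psi by auto
    show "?J (?b i) = - ?b i" if "i < 36" for i unfolding J_Psi z(1)[OF that] by (rule Psi.hom_minus)
    show "(2::'k alg_closure) \<noteq> 0" by (rule to_ac.hom_two_nonzero[OF kappa.hom_two_nonzero[OF char]])
    show "Z \<in> range scal" if "\<And>B. Z * B = B * Z" for Z :: "('k alg_closure, 8) sqmat" by (rule sqmat_center[OF that])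
  qed (fact J Psi_basis[OF z(2)] division_subring_F0 scal_central)+
  obtain d where d: "\<Psi> d \<notin> \<Psi> ` F" "\<Psi> d * \<Psi> d \<in> \<Psi> ` F"
    using symplectic.has_square_central_Sym_base
    unfolding symplectic.has_square_central_Sym_def symplectic.scalar_extension_def span Psi_F by blast
  have "d * d \<in> F" using d(2) by (auto simp: Psi.hom_eq_iff simp flip: Psi.hom_mult)
  then show ?thesis using d(1) by (auto simp: square_central_def)
qed

lemma sqtrace_Psi_gamma: "sqtrace (\<Psi> (\<gamma> x)) = sqtrace (\<Psi> x)"
proof -
  obtain S T where S: "S * T = 1" "\<And>d. \<Psi> (\<gamma> d) = T * tr (\<Psi> d) * S" by (rule form_matrixE) (rule that)
  have "sqtrace (\<Psi> (\<gamma> x)) = sqtrace (S * (T * tr (\<Psi> x)))" unfolding S(2) by (rule sqtrace_mult_commute)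
  also have "S * (T * tr (\<Psi> x)) = tr (\<Psi> x)" using S(1) by (simp flip: mult.assoc)
  finally show ?thesis by (simp add: sqtrace_tr)
qed

lemma sqtrace_Psi_nonzero: "\<exists>d. sqtrace (\<Psi> d) \<noteq> 0"
proof (rule ccontr)
  assume "\<not> ?thesis"
  then have "range \<Psi> \<subseteq> {A. sqtrace A = 0}" by blast
  moreover have "subspace_over (*) (range scal) {A :: ('k alg_closure, 8) sqmat. sqtrace A = 0}"
    unfolding subspace_over_def by (auto simp: sqtrace_zero sqtrace_add sqtrace_scal_right)
  ultimately have "{A :: ('k alg_closure, 8) sqmat. sqtrace A = 0} = UNIV" by (rule Psi_range_spans[rotated])
  then have "sqtrace (unit 0 0 :: ('k alg_closure, 8) sqmat) = 0" by blast
  then show False by transfer (simp add: trace_def)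
qed

definition invariant_trace :: "('d \<Rightarrow> 'd) \<Rightarrow> bool" where
  "invariant_trace l \<longleftrightarrow> linear_over (*) (*) F UNIV l \<and> range l \<subseteq> F \<and> (\<forall>x y. l (x * y) = l (y * x)) \<and>
     (\<forall>x. l (\<gamma> x) = l x) \<and> (\<exists>x. l x \<noteq> 0)"

lemma invariant_traceD:
  assumes "invariant_trace l"
  shows "linear_over (*) (*) F UNIV l" "range l \<subseteq> F" "l (x * y) = l (y * x)" "l (\<gamma> x) = l x" "\<exists>x. l x \<noteq> 0"
  using assms unfolding invariant_trace_def by blast+

lemma ex_invariant_trace: "\<exists>l. invariant_trace l"
proof -
  let ?t = "\<lambda>d. sqtrace (\<Psi> d)"
  have t_add: "?t (x + y) = ?t x + ?t y" for x y by (simp add: Psi.hom_add sqtrace_add)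
  let ?K = "{d. ?t d = 0}"
  have K: "subspace_over (*) F ?K"
    unfolding subspace_over_def by (auto simp: Psi.hom_zero sqtrace_zero t_add Psi.hom_mult Psi_iota sqtrace_scal_right)
  have "?K \<noteq> UNIV" using sqtrace_Psi_nonzero by blast
  then obtain l where l: "linear_over (*) (*) F UNIV l" "range l \<subseteq> F" "\<And>x. x \<in> ?K \<Longrightarrow> l x = 0"
    "has_dim (*) F 63 {x \<in> UNIV. l x = 0}"
    using ring.functional_vanishing_on[OF E _ K, of 63 UNIV] dim_D by auto
  have eq: "l x = l y" if "?t x = ?t y" for x y
  proof -
    have "?t (x - y) = 0" using t_add[of "x - y" y] that by simp
    then show ?thesis
      using l(3) ring.linear_over_diff[OF E division_subring_subspace[OF D E_sub] l(1), of x y] by simp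
  qed
  have "l (x * y) = l (y * x)" for x y by (rule eq) (simp add: Psi.hom_mult sqtrace_mult_commute)
  moreover have "l (\<gamma> x) = l x" for x by (rule eq[OF sqtrace_Psi_gamma])
  moreover have "\<exists>x. l x \<noteq> 0"
  proof (rule ccontr)
    assume "\<not> ?thesis"
    then have "{x \<in> UNIV. l x = 0} = UNIV" by blast
    then show False using ring.has_dim_unique[OF E dim_D, of 63] l(4) by simp
  qed
  ultimately show ?thesis unfolding invariant_trace_def using l(1,2) by blast
qed

end

section \<open>Biquadratic subfields\<close>

context central_division_algebra
begin

lemma division_subring_extension:
  assumes B: "division_subring B" "E \<subseteq> B" "B \<subseteq> D" and v: "v \<in> D" "v * v \<in> B"
    and conj: "\<And>b. b \<in> B \<Longrightarrow> \<exists>b'\<in>B. b * v = v * b'"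
  shows "division_subring (extension B v)"
proof (rule division_subringI)
  show "E \<subseteq> extension B v" using extension_superset[OF B(1)] B(2) by blast
  show "extension B v \<subseteq> D" by (rule extension_least[OF D B(3) v(1)])
  show "x * y \<in> extension B v" if "x \<in> extension B v" "y \<in> extension B v" for x y
    by (rule extension_mult_closed[OF B(1) v(2) conj that])
  show "x - y \<in> extension B v" if "x \<in> extension B v" "y \<in> extension B v" for x y
    by (rule ring.subspace_over_diff[OF B(1) ring.subspace_over_adjoin[OF B(1) division_subring_subspace[OF B(1) order_refl]] that])
qed

lemma has_dim_extension_tower:
  assumes "division_subring B" "E \<subseteq> B" "has_dim (*) E n B" "v \<notin> B"
  shows "has_dim (*) E (2 * n) (extension B v)"
  using ring.has_dim_tower[OF E assms(3,1,2) has_dim_extension[OF assms(1,4)]] by (simp add: mult.commute)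

lemma noncommutative_of_dim:
  assumes B: "division_subring B" "E \<subseteq> B" "B \<subseteq> D" "has_dim (*) E n B" and n: "N < n * n"
  shows "\<exists>p\<in>B. \<exists>q\<in>B. p * q \<noteq> q * p"
proof (rule ccontr)
  assume "\<not> ?thesis"
  then have "n * n \<le> N" by (intro commutative_dim(1)[OF B(1-3) _ B(4)]) blast
  then show False using n by simp
qed

end

locale division_algebra_64 = central_division_algebra F "UNIV :: 'd set" 64 for F :: "'d::division_ring set"
begin

abbreviation Cent :: "'d set \<Rightarrow> 'd set" where "Cent S \<equiv> centralizer UNIV S"

lemma division_subring_Cent: "division_subring (Cent S)"
  by (rule centralizer_division_subring[OF D E_sub order_refl subset_UNIV])

lemma F_subset_Cent: "F \<subseteq> Cent S"
  by (rule E_subset_centralizer[OF E_sub subset_UNIV])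

lemma subspace_F: "subspace_over (*) F F"
  by (rule division_subring_subspace[OF E order_refl])

lemma F_commutes: "c \<in> F \<Longrightarrow> c * x = x * c"
  using E_central by blast

lemma has_dim_Cent_square_central:
  assumes "square_central i" shows "has_dim (*) F 32 (Cent {i})"
  by (rule has_dim_centralizer_square_central[OF assms]) simp

lemma division_subring_quadratic:
  assumes "square_central i" shows "division_subring (extension F i)"
  by (rule division_subring_extension[OF E order_refl E_sub UNIV_I])
    (use assms F_commutes in \<open>auto simp: square_central_def\<close>)

lemma has_dim_quadratic: "square_central i \<Longrightarrow> has_dim (*) F 2 (extension F i)"
  by (rule has_dim_extension[OF E]) (simp add: square_central_def)

lemma quadratic_commutes: "x \<in> extension F i \<Longrightarrow> i * z = z * i \<Longrightarrow> x * z = z * x"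
  by (rule extension_commutes[OF F_commutes])

lemma intertwiningE:
  assumes a: "square_central a" and b: "b * b = a * a"
  obtains x where "x \<noteq> 0" "a * x = x * b"
proof -
  have aF: "a \<notin> F" "a * a \<in> F" using a by (auto simp: square_central_def)
  have "\<exists>y. a * y + y * b \<noteq> 0"
  proof (rule ccontr)
    assume "\<not> ?thesis"
    then have all: "a * y + y * b = 0" for y by blast
    from all[of 1] have "b = - a" by (simp add: eq_neg_iff_add_eq_0 add.commute)
    then have "a * y = y * a" for y using all[of y] by simp
    then show False using center[of a] aF(1) by blast
  qed
  then obtain y where y: "a * y + y * b \<noteq> 0" by blast
  have "a * (a * y + y * b) = (a * y + y * b) * b"
    using F_commutes[OF aF(2), of y] b by (simp add: algebra_simps)
  then show thesis using that y by blast
qed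

end

locale division_algebra_64_inv = division_algebra_64 F + central_division_algebra_inv F "UNIV :: 'd set" 64 \<sigma>
  for F :: "'d::division_ring set" and \<sigma>
begin

lemma J_inverse:
  assumes "x \<noteq> 0" shows "\<sigma> (inverse x) = inverse (\<sigma> x)"
proof -
  have "\<sigma> x * \<sigma> (inverse x) = 1" using J_mult[of "inverse x" x] assms J_one by simp
  then show ?thesis using inverse_unique by metis
qed

lemma conjugate_involution:
  assumes x: "x \<noteq> 0" "\<sigma> x = x \<or> \<sigma> x = - x"
  shows "division_algebra_64_inv F (\<lambda>d. x * \<sigma> d * inverse x)"
proof
  fix d e :: 'd
  show "x * \<sigma> (d + e) * inverse x = x * \<sigma> d * inverse x + x * \<sigma> e * inverse x"
    by (simp add: J_add distrib_left distrib_right)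
  have "inverse x * (x * z) = z" for z using x(1) by (simp flip: mult.assoc)
  then show "x * \<sigma> (d * e) * inverse x = x * \<sigma> e * inverse x * (x * \<sigma> d * inverse x)"
    by (simp add: J_mult mult.assoc)
  have "\<sigma> (x * \<sigma> d * inverse x) = inverse (\<sigma> x) * d * \<sigma> x"
    using x(1) by (simp add: J_mult J_J J_inverse mult.assoc)
  also have "\<dots> = inverse x * d * x" using x(2) by auto
  finally have "x * \<sigma> (x * \<sigma> d * inverse x) * inverse x = (x * inverse x) * d * (x * inverse x)"
    by (simp only: mult.assoc)
  then show "x * \<sigma> (x * \<sigma> d * inverse x) * inverse x = d" using x(1) by simp
  show "x * \<sigma> d * inverse x = d" if "d \<in> F"
    using x(1) J_E[OF that] F_commutes[OF that, of x] by (metis mult.assoc mult.right_neutral right_inverse)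
qed auto

lemma fixed_extension:
  assumes "\<And>b. b \<in> B \<Longrightarrow> \<sigma> b = b" "\<sigma> v = v" "\<And>b. b \<in> B \<Longrightarrow> b * v = v * b" "k \<in> extension B v"
  shows "\<sigma> k = k"
proof -
  obtain c d where "k = c + v * d" "c \<in> B" "d \<in> B" using assms(4) by (rule adjoinE)
  then show ?thesis using assms by (simp add: J_add J_mult)
qed

lemma skew_extension:
  assumes B: "division_subring B" "\<And>b. b \<in> B \<Longrightarrow> \<sigma> b = b"
    and v: "\<sigma> v = - v" "\<And>b. b \<in> B \<Longrightarrow> b * v = v * b" and k: "k \<in> extension B v"
  shows "\<sigma> k \<in> extension B v" "k + \<sigma> k \<in> B" "\<sigma> k = k \<Longrightarrow> k \<in> B"
proof -
  obtain c d where cd: "k = c + v * d" "c \<in> B" "d \<in> B" using k by (rule adjoinE)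
  have \<sigma>k: "\<sigma> k = c - v * d" unfolding cd(1) using B(2) v cd(2,3) by (simp add: J_add J_mult)
  have "c + v * (- d) \<in> extension B v" by (rule adjoinI[OF cd(2) division_subring_minus[OF B(1) cd(3)]])
  then show "\<sigma> k \<in> extension B v" unfolding \<sigma>k by simp
  show "k + \<sigma> k \<in> B" using \<sigma>k cd division_subring_add[OF B(1) cd(2,2)] by simp
  show "k \<in> B" if "\<sigma> k = k"
  proof -
    have "v * d + v * d = k - \<sigma> k" using \<sigma>k cd(1) by simp
    then have "v * d + v * d = 0" using that by simp
    then have "v * d = 0" by (rule double_eq_0)
    then show ?thesis using cd(1,2) by (simp only: add_0_right)
  qed
qed

lemma conjugatorE:
  assumes i: "square_central i" and e: "e = i \<or> e = - i"
  obtains x where "x \<noteq> 0" "\<sigma> x = x \<or> \<sigma> x = - x" "x * \<sigma> i * inverse x = e"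
proof -
  have iF: "i * i \<in> F" and e_sq: "e * e = i * i" using i e by (auto simp: square_central_def)
  have e': "square_central e"
    using i e division_subring_minus[OF E, of "- i"] unfolding square_central_def by auto
  have "\<sigma> i * \<sigma> i = e * e" unfolding e_sq using J_mult[of i i] J_E[OF iF] by simp
  then obtain x where x: "x \<noteq> 0" "e * x = x * \<sigma> i" using intertwiningE[OF e'] by metis
  have \<sigma>x: "e * \<sigma> x = \<sigma> x * \<sigma> i"
  proof -
    have "\<sigma> (e * x) = \<sigma> (x * \<sigma> i)" using x(2) by simp
    then have "\<sigma> x * \<sigma> e = i * \<sigma> x" by (simp add: J_mult J_J)
    then show ?thesis using e by (auto simp: J_minus) (metis minus_minus)
  qed
  obtain y where y: "y \<noteq> 0" "\<sigma> y = y \<or> \<sigma> y = - y" "e * y = y * \<sigma> i"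
  proof (cases "x + \<sigma> x = 0")
    case True
    then have "\<sigma> x = - x" by (simp add: eq_neg_iff_add_eq_0 add.commute)
    then show ?thesis using that x by blast
  next
    case False
    have "e * (x + \<sigma> x) = (x + \<sigma> x) * \<sigma> i" using x(2) \<sigma>x by (simp add: distrib_left distrib_right)
    then show ?thesis using that[OF False] add_J_Sym[of x] by (simp add: Sym_iff)
  qed
  have "y * \<sigma> i * inverse y = e" unfolding y(3)[symmetric] using y(1) by (simp add: mult.assoc)
  then show thesis using that y by blast
qed

lemma Skew_centralizer_square_centralE:
  assumes i: "square_central i" "\<sigma> i = i"
  obtains t where "t * i = i * t" "t \<noteq> 0" "\<sigma> t = - t"
proof -
  have "\<exists>t. t * i = i * t \<and> t \<noteq> 0 \<and> \<sigma> t = - t"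
  proof (rule ccontr)
    assume no: "\<not> ?thesis"
    have fixed: "\<sigma> x = x" if "x \<in> Cent {i}" for x
    proof -
      have xi: "x * i = i * x" using that unfolding centralizer_iff by simp
      then have "\<sigma> (x * i) = \<sigma> (i * x)" by simp
      then have "\<sigma> x * i = i * \<sigma> x" by (simp add: J_mult i(2))
      then have "(\<sigma> x - x) * i = i * (\<sigma> x - x)" using xi by (rule commutes_diff)
      moreover have "\<sigma> (\<sigma> x - x) = - (\<sigma> x - x)" by (simp add: J_diff J_J)
      ultimately have "\<sigma> x - x = 0" using no by blast
      then show ?thesis by simp
    qed
    obtain p q where pq: "p \<in> Cent {i}" "q \<in> Cent {i}" "p * q \<noteq> q * p"
      using noncommutative_of_dim[OF division_subring_Cent F_subset_Cent subset_UNIV has_dim_Cent_square_central[OF i(1)]] by auto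
    have "\<sigma> (p * q) = p * q" by (rule fixed[OF division_subring_mult[OF division_subring_Cent pq(1,2)]])
    then show False using fixed[OF pq(1)] fixed[OF pq(2)] pq(3) by (simp add: J_mult)
  qed
  then show thesis using that by blast
qed

lemma square_in_quadraticE:
  assumes i: "square_central i" "\<sigma> i = i"
  obtains x where "x * i = i * x" "x \<notin> extension F i" "x * x \<in> extension F i"
proof -
  let ?K = "extension F i"
  note K = division_subring_quadratic[OF i(1)] has_dim_quadratic[OF i(1)] extension_superset[OF E, of i]
  obtain t where t: "t * i = i * t" "t \<noteq> 0" "\<sigma> t = - t" using Skew_centralizer_square_centralE[OF i] .
  have not_fixed: "\<sigma> t \<noteq> t" using t(2,3) eq_minus_self[of t] by auto
  then have tK: "t \<notin> ?K" using fixed_extension[OF J_E i(2) F_commutes] by blast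
  show thesis
  proof (cases "t * t \<in> ?K")
    case True
    then show ?thesis using that t(1) tK by blast
  next
    case False
    let ?u = "t * t"
    have u: "?u * i = i * ?u" "\<sigma> ?u = ?u" using commutes_mult[OF t(1,1)] t(3) by (simp_all add: J_mult)
    let ?M = "gen {i, t}" and ?M' = "gen {i, ?u}"
    note M = gen_pair[OF UNIV_I UNIV_I t(1)] and M' = gen_pair[OF UNIV_I UNIV_I u(1)]
    have "?M' \<subseteq> Sym" by (rule gen_Sym) (use i(2) u in \<open>auto simp: Sym_iff\<close>)
    then have tM': "t \<notin> ?M'" using not_fixed by (auto simp: Sym_iff)
    have KM': "?K \<subseteq> ?M'" by (rule extension_least[OF M'(1) gen_superset(1) M'(3)])
    have M'M: "?M' \<subseteq> ?M" by (rule gen_least[OF M(1) gen_superset(1)]) (use M(3) division_subring_mult[OF M(1,4,4)] in blast)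
    obtain m where m: "has_dim (*) F m ?M" using has_dim_division_subringE[OF M(1) gen_superset(1) M(2)] .
    obtain m' where m': "has_dim (*) F m' ?M'" using has_dim_division_subringE[OF M'(1) gen_superset(1) M'(2)] .
    have "m \<in> {1, 2, 4, 8}" by (rule commutative_dim_64[OF M(1) gen_superset(1) M(2,5) m refl])
    moreover have "m' \<in> {1, 2, 4, 8}" by (rule commutative_dim_64[OF M'(1) gen_superset(1) M'(2,5) m' refl])
    moreover have "\<not> m' \<le> 2" using ring.has_dim_eqI[OF E m' K(2) KM'] False M'(4) by blast
    moreover have "\<not> m \<le> m'" using ring.has_dim_eqI[OF E m m' M'M] M(4) tM' by blast
    ultimately have "m' = 2 * 2" by auto
    then obtain s where s: "s \<in> ?K" "(?u - s) * (?u - s) \<in> ?K"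
      using complete_square[OF K(1,3,2) M'(1) KM' _ M'(5,4) False] m' by metis
    show thesis
    proof (rule that)
      show "(?u - s) * i = i * (?u - s)" by (rule commutes_diff[OF u(1) quadratic_commutes[OF s(1) refl]])
      show "?u - s \<notin> ?K" using division_subring_diff_cancel[OF K(1) _ s(1)] False by blast
    qed (rule s(2))
  qed
qed

context
  fixes i x
  assumes i: "square_central i" "\<sigma> i = - i"
    and x: "x * i = i * x" "x \<notin> extension F i" "x * x \<in> extension F i"
begin

lemma skew_quadratic:
  assumes "k \<in> extension F i"
  shows "\<sigma> k \<in> extension F i" "k + \<sigma> k \<in> F" "\<sigma> k = k \<Longrightarrow> k \<in> F"
  by (rule skew_extension[OF E J_E i(2) F_commutes assms]; assumption)+

lemma J_commutes: "\<sigma> x * i = i * \<sigma> x"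
proof -
  have "\<sigma> (x * i) = \<sigma> (i * x)" using x(1) by simp
  then show ?thesis by (simp add: J_mult i(2))
qed

lemma J_square: "\<sigma> x * \<sigma> x = \<sigma> (x * x)"
  by (simp add: J_mult)

text \<open>The element \<open>m = x \<sigma>(x) + \<sigma>(x) x\<close> is symmetric and commutes with \<open>i\<close>, \<open>x\<close> and \<open>\<sigma>(x)\<close>. The three
  cases are \<open>m \<in> F(i)\<close> and \<open>F(i, m)\<close> of degree 4 or 2 over \<open>F(i)\<close>.\<close>

lemma second_square_central_of_trace:
  assumes "x * \<sigma> x + \<sigma> x * x \<in> extension F i"
  shows "\<exists>j. j * i = i * j \<and> j \<notin> extension F i \<and> j * j \<in> F"
proof -
  let ?K = "extension F i" and ?m = "x * \<sigma> x + \<sigma> x * x"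
  note K = division_subring_quadratic[OF i(1)]
  have ii: "i * i \<in> F" "i \<noteq> 0" using i(1) square_central_nonzero by (auto simp: square_central_def)
  have m: "?m \<in> F" using skew_quadratic(3)[OF assms] by (simp add: J_add J_mult J_J)
  have norms: "x * x + \<sigma> x * \<sigma> x \<in> F" unfolding J_square by (rule skew_quadratic(2)[OF x(3)])
  let ?y = "x + \<sigma> x" and ?z = "x - \<sigma> x"
  have yi: "?y * i = i * ?y" by (rule commutes_add[OF x(1) J_commutes])
  have zi: "?z * i = i * ?z" by (rule commutes_diff[OF x(1) J_commutes])
  have "?y * ?y = (x * x + \<sigma> x * \<sigma> x) + ?m" by (simp add: algebra_simps)
  then have yy: "?y * ?y \<in> F" using division_subring_add[OF E norms m] by simp
  have "i * ?z * (i * ?z) = (i * i) * (?z * ?z)" using zi by (metis mult.assoc)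
  also have "?z * ?z = (x * x + \<sigma> x * \<sigma> x) - ?m" by (simp add: algebra_simps)
  also have "i * i * \<dots> \<in> F" by (rule division_subring_mult[OF E ii(1) division_subring_diff[OF E norms m]])
  finally have zz: "i * ?z * (i * ?z) \<in> F" .
  have "?y \<notin> ?K \<or> i * ?z \<notin> ?K"
  proof (rule ccontr)
    assume "\<not> ?thesis"
    then have y: "?y \<in> ?K" and iz: "i * ?z \<in> ?K" by auto
    have "inverse i * (i * ?z) \<in> ?K"
      by (rule division_subring_mult[OF K division_subring_inverse[OF K extension_new[OF E]] iz])
    then have "?z \<in> ?K" using ii(2) by (simp flip: mult.assoc)
    then have "?y + ?z \<in> ?K" by (rule division_subring_add[OF K y])
    then have "x + x \<in> ?K" by (simp add: algebra_simps)
    then show False using double_mem[OF division_subring_subspace[OF K extension_superset[OF E]]] x(2) by blast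
  qed
  moreover have "i * ?z * i = i * (i * ?z)" using zi by (simp add: mult.assoc)
  ultimately show ?thesis using yi yy zz by blast
qed

lemma second_square_central_of_maximal:
  assumes m: "x * \<sigma> x + \<sigma> x * x \<notin> extension F i" and M: "has_dim (*) F 8 (gen {i, x * \<sigma> x + \<sigma> x * x})"
  shows "\<exists>j. j * i = i * j \<and> j \<notin> extension F i \<and> j * j \<in> F"
proof -
  let ?K = "extension F i" and ?m = "x * \<sigma> x + \<sigma> x * x"
  note K = division_subring_quadratic[OF i(1)]
  have mi: "?m * i = i * ?m" by (intro commutes_add commutes_mult x(1) J_commutes)
  have \<sigma>x: "\<sigma> (x * x) \<in> ?K" by (rule skew_quadratic(1)[OF x(3)])
  have mx: "?m * x = x * ?m"
  proof -
    have "x * x * \<sigma> x = \<sigma> x * (x * x)" by (rule quadratic_commutes[OF x(3) J_commutes[symmetric]])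
    then show ?thesis by (simp add: algebra_simps)
  qed
  have mx': "?m * \<sigma> x = \<sigma> x * ?m"
  proof -
    have "\<sigma> x * \<sigma> x * x = x * (\<sigma> x * \<sigma> x)" unfolding J_square by (rule quadratic_commutes[OF \<sigma>x x(1)[symmetric]])
    then show ?thesis by (simp add: algebra_simps)
  qed
  note G = gen_pair[OF UNIV_I UNIV_I mi]
  have "Cent (gen {i, ?m}) = gen {i, ?m}"
    by (rule centralizer_maximal_commutative[OF G(1) gen_superset(1) G(2,5) M]) simp_all
  moreover have "x \<in> Cent {i, ?m}" "\<sigma> x \<in> Cent {i, ?m}"
    using x(1) J_commutes mx[symmetric] mx'[symmetric] unfolding centralizer_iff by blast+
  ultimately have "x \<in> gen {i, ?m}" "\<sigma> x \<in> gen {i, ?m}" unfolding centralizer_gen[OF subset_UNIV] by simp_all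
  then have xx: "x * \<sigma> x = \<sigma> x * x" by (rule G(5))
  let ?n = "x * x * \<sigma> (x * x)"
  have "?n \<in> ?K" by (rule division_subring_mult[OF K x(3) \<sigma>x])
  moreover have "\<sigma> ?n = ?n" by (simp add: J_mult J_J mult.assoc)
  ultimately have nF: "?n \<in> F" by (rule skew_quadratic(3))
  have "x * \<sigma> x * (x * \<sigma> x) = ?n" unfolding J_square[symmetric] using xx by (metis mult.assoc)
  then have "?m * ?m = ?n + ?n + ?n + ?n" unfolding xx[symmetric] by (simp only: distrib_left distrib_right add.assoc)
  then have "?m * ?m \<in> F" using nF E by (simp add: division_subring_add)
  then show ?thesis using mi m by blast
qed

lemma second_square_central_of_quadratic:
  assumes m: "x * \<sigma> x + \<sigma> x * x \<notin> extension F i" and M: "has_dim (*) F 4 (gen {i, x * \<sigma> x + \<sigma> x * x})"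
  shows "\<exists>j. j * i = i * j \<and> j \<notin> extension F i \<and> j * j \<in> F"
proof -
  let ?K = "extension F i" and ?m = "x * \<sigma> x + \<sigma> x * x"
  let ?M = "gen {i, ?m}"
  note K = division_subring_quadratic[OF i(1)] extension_superset[OF E, of i]
  have mi: "?m * i = i * ?m" by (intro commutes_add commutes_mult x(1) J_commutes)
  note G = gen_pair[OF UNIV_I UNIV_I mi]
  have \<sigma>m: "\<sigma> ?m = ?m" by (simp add: J_add J_mult J_J)
  have "has_dim (*) F (2 * 2) (extension ?K ?m)"
    by (rule has_dim_extension_tower[OF K has_dim_quadratic[OF i(1)] m])
  moreover have "extension ?K ?m \<subseteq> ?M"
    by (rule extension_least[OF G(1) extension_least[OF G(1) gen_superset(1) G(3)] G(4)])
  ultimately have "extension ?K ?m = ?M" using ring.has_dim_eqI[OF E M] by simp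
  then have "?m * ?m \<in> extension ?K ?m" using division_subring_mult[OF G(1,4,4)] by simp
  then obtain a b where ab: "?m * ?m = a + ?m * b" "a \<in> ?K" "b \<in> ?K" by (rule adjoinE)
  have "\<sigma> b * ?m = ?m * \<sigma> b" by (rule quadratic_commutes[OF skew_quadratic(1)[OF ab(3)] mi[symmetric]])
  then have "\<sigma> (?m * ?m) = \<sigma> a + ?m * \<sigma> b" unfolding ab(1) using \<sigma>m by (simp add: J_add J_mult)
  moreover have "\<sigma> (?m * ?m) = a + ?m * b" unfolding ab(1)[symmetric] using \<sigma>m by (simp only: J_mult UNIV_I)
  moreover have "(\<sigma> a - a) + ?m * (\<sigma> b - b) = (\<sigma> a + ?m * \<sigma> b) - (a + ?m * b)"
    unfolding right_diff_distrib by simp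
  ultimately have "(\<sigma> a - a) + ?m * (\<sigma> b - b) = 0" by simp
  then have "\<sigma> a - a = 0 \<and> \<sigma> b - b = 0"
    by (intro ring.adjoin_unique_zero[OF K(1) division_subring_subspace[OF K(1) order_refl] m]
        division_subring_diff[OF K(1)] skew_quadratic(1) ab)
  then have abF: "a \<in> F" "b \<in> F" using skew_quadratic(3) ab by auto
  obtain h where h: "h \<in> F" "b = h + h" using half_exists[OF subspace_F abF(2)] .
  let ?j = "?m - h"
  have "?j * ?j = ?m * ?m - ?m * h - h * ?m + h * h" by (simp add: algebra_simps)
  also have "\<dots> = a + h * h" unfolding F_commutes[OF h(1), of ?m] ab(1) h(2) distrib_left[of ?m h h] by simp
  finally have "?j * ?j \<in> F" using abF h(1) E by (simp add: division_subring_closed)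
  moreover have "?j * i = i * ?j" by (rule commutes_diff[OF mi F_commutes[OF h(1)]])
  moreover have "?j \<notin> ?K" using division_subring_diff_cancel[OF K(1), of ?m h] h(1) K(2) m by blast
  ultimately show ?thesis by blast
qed

lemma second_square_central_of_skew: "\<exists>j. j * i = i * j \<and> j \<notin> extension F i \<and> j * j \<in> F"
proof (cases "x * \<sigma> x + \<sigma> x * x \<in> extension F i")
  case False
  let ?m = "x * \<sigma> x + \<sigma> x * x"
  let ?M = "gen {i, ?m}"
  have mi: "?m * i = i * ?m" by (intro commutes_add commutes_mult x(1) J_commutes)
  note M = gen_pair[OF UNIV_I UNIV_I mi]
  obtain n where n: "has_dim (*) F n ?M" using has_dim_division_subringE[OF M(1) gen_superset(1) M(2)] .
  have "n \<in> {1, 2, 4, 8}" by (rule commutative_dim_64[OF M(1) gen_superset(1) M(2,5) n refl])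
  moreover have "\<not> n \<le> 2"
    using ring.has_dim_eqI[OF E n has_dim_quadratic[OF i(1)] extension_least[OF M(1) gen_superset(1) M(3)]] False M(4) by blast
  ultimately consider "n = 8" | "n = 4" by auto
  then show ?thesis
    by cases (use second_square_central_of_maximal[OF False] second_square_central_of_quadratic[OF False] n in auto)
qed (rule second_square_central_of_trace)

end

theorem second_square_central:
  assumes i: "square_central i"
  obtains j where "j * i = i * j" "j \<notin> extension F i" "j * j \<in> F"
proof -
  obtain a where a: "a \<noteq> 0" "\<sigma> a = a \<or> \<sigma> a = - a" "a * \<sigma> i * inverse a = i"
    using conjugatorE[OF i] by blast
  obtain b where b: "b \<noteq> 0" "\<sigma> b = b \<or> \<sigma> b = - b" "b * \<sigma> i * inverse b = - i"
    using conjugatorE[OF i, of "- i"] by blast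
  obtain x where x: "x * i = i * x" "x \<notin> extension F i" "x * x \<in> extension F i"
    using division_algebra_64_inv.square_in_quadraticE[OF conjugate_involution[OF a(1,2)] i a(3)] .
  show thesis
    using division_algebra_64_inv.second_square_central_of_skew[OF conjugate_involution[OF b(1,2)] i b(3) x] that by blast
qed

end

lemma quotient_commutes:
  fixes w :: "'d::division_ring"
  assumes w: "w \<noteq> 0" and xw: "x * a = a * x \<and> w * a = a * w \<or> x * a = - (a * x) \<and> w * a = - (a * w)"
  shows "x * inverse w * a = a * (x * inverse w)"
  using xw
proof
  assume "x * a = a * x \<and> w * a = a * w"
  then show ?thesis by (intro commutes_mult mult_commute_imp_mult_inverse_commute) auto
next
  assume "x * a = - (a * x) \<and> w * a = - (a * w)"
  then have "x * a = - (a * x)" and "w * a = - (a * w)" by blast+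
  then show ?thesis using anticommuting_inverse[OF _ right_inverse[OF w] left_inverse[OF w]] by (intro anticommuting_mult)
qed

locale biquadratic = division_algebra_64 F for F :: "'d::division_ring set" +
  fixes i j :: 'd
  assumes i: "square_central i" and ji: "j * i = i * j" and j: "j \<notin> extension F i" "j * j \<in> F"
begin

definition K1 :: "'d set" where "K1 = extension F i"
definition K2 :: "'d set" where "K2 = extension K1 j"
definition Q :: "'d set" where "Q = Cent {i, j}"

lemma i_props: "i \<notin> F" "i * i \<in> F" "i \<noteq> 0"
  using i square_central_nonzero[OF i] by (auto simp: square_central_def)

lemma division_subring_K1: "division_subring K1"
  and has_dim_K1: "has_dim (*) F 2 K1"
  and F_subset_K1: "F \<subseteq> K1"
  and i_mem_K1: "i \<in> K1"
  unfolding K1_def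
  by (rule division_subring_quadratic[OF i] has_dim_quadratic[OF i] extension_superset[OF E] extension_new[OF E])+

lemma K1_commutes:
  assumes "x \<in> K1" "z * i = i * z" shows "x * z = z * x"
  using assms(1) unfolding K1_def by (rule quadratic_commutes) (rule assms(2)[symmetric])

lemma j_notin_K1: "j \<notin> K1"
  using j(1) by (simp add: K1_def)

lemma j_nonzero: "j \<noteq> 0"
  using j_notin_K1 division_subring_zero[OF division_subring_K1] by auto

lemma division_subring_K2: "division_subring K2"
  unfolding K2_def
proof (rule division_subring_extension[OF division_subring_K1 F_subset_K1 subset_UNIV UNIV_I])
  show "j * j \<in> K1" using j(2) F_subset_K1 by blast
  show "\<exists>b'\<in>K1. b * j = j * b'" if "b \<in> K1" for b using K1_commutes[OF that ji] that by blast
qed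

lemma K1_subset_K2: "K1 \<subseteq> K2"
  and j_mem_K2: "j \<in> K2"
  unfolding K2_def by (rule extension_superset extension_new; rule division_subring_K1)+

lemma F_subset_K2: "F \<subseteq> K2" and i_mem_K2: "i \<in> K2"
  using F_subset_K1 i_mem_K1 K1_subset_K2 by auto

lemma has_dim_K2: "has_dim (*) F 4 K2"
  using has_dim_extension_tower[OF division_subring_K1 F_subset_K1 has_dim_K1 j_notin_K1] by (simp add: K2_def)

lemma K2_least: "division_subring M \<Longrightarrow> F \<subseteq> M \<Longrightarrow> i \<in> M \<Longrightarrow> j \<in> M \<Longrightarrow> K2 \<subseteq> M"
  unfolding K2_def K1_def by (intro extension_least)

lemma Q_iff: "x \<in> Q \<longleftrightarrow> x * i = i * x \<and> x * j = j * x"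
  by (auto simp: Q_def centralizer_iff)

lemma Q_eq: "Q = centralizer (Cent {i}) {j}"
  by (auto simp: Q_def centralizer_iff)

lemma division_subring_Q: "division_subring Q" and F_subset_Q: "F \<subseteq> Q"
  unfolding Q_def by (rule division_subring_Cent F_subset_Cent)+

lemma K2_subset_Q: "K2 \<subseteq> Q"
  by (rule K2_least[OF division_subring_Q F_subset_Q]) (simp_all add: Q_iff ji)

lemma K2_commutes: "k \<in> K2 \<Longrightarrow> x \<in> Q \<Longrightarrow> k * x = x * k"
  unfolding K2_def by (rule extension_commutes[OF K1_commutes]) (simp_all add: Q_iff)

lemma K2_commutative: "x \<in> K2 \<Longrightarrow> y \<in> K2 \<Longrightarrow> x * y = y * x"
  using K2_commutes K2_subset_Q by blast

lemma anticommuting_with_jE: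
  obtains w where "w \<noteq> 0" "w * i = i * w" "w * j = - (j * w)"
proof -
  have "\<exists>y. y * i = i * y \<and> y * j \<noteq> j * y"
  proof (rule ccontr)
    assume no: "\<not> ?thesis"
    have "Cent {i} \<subseteq> Cent K2"
    proof
      fix x assume "x \<in> Cent {i}"
      then have "x \<in> Q" using no by (auto simp: Q_iff centralizer_iff)
      then show "x \<in> Cent K2" using K2_commutes[symmetric] by (simp add: centralizer_iff)
    qed
    moreover obtain q where q: "has_dim (*) F q (Cent K2)" using has_dim_centralizerE[OF subset_UNIV] .
    ultimately have "32 \<le> q" using ring.has_dim_mono[OF E q has_dim_Cent_square_central[OF i]] by simp
    moreover have "4 * q \<le> 64" by (rule centralizer_dim_le[OF division_subring_K2 F_subset_K2 subset_UNIV has_dim_K2 q])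
    ultimately show False by simp
  qed
  then obtain y where y: "y * i = i * y" "y * j \<noteq> j * y" by blast
  show thesis
  proof (rule that)
    show "y * j - j * y \<noteq> 0" using y(2) by simp
    show "(y * j - j * y) * i = i * (y * j - j * y)" by (intro commutes_diff commutes_mult y(1) ji)
    show "(y * j - j * y) * j = - (j * (y * j - j * y))" by (rule commutator_anticommutes[OF F_commutes[OF j(2)]])
  qed
qed

context
  fixes w assumes w: "w \<noteq> 0" "w * i = i * w" "w * j = - (j * w)"
begin

lemma w_mem_Cent: "w \<in> Cent {i}" and j_mem_Cent: "j \<in> Cent {i}"
  using w(2) ji by (auto simp: centralizer_iff)

lemma Cent_decompositionE:
  assumes "y * i = i * y"
  obtains c d where "c \<in> Q" "d \<in> Q" "y = c + d * w"
proof -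
  have y: "y \<in> Cent {i}" using assms by (simp add: centralizer_iff)
  show thesis
    using commuting_decomposition[OF division_subring_Cent F_subset_Cent subset_UNIV has_dim_Cent_square_central[OF i]
        j_mem_Cent j_nonzero F_commutes[OF j(2)] w_mem_Cent w(1,3) y] that unfolding Q_eq by blast
qed

end

lemma has_dim_Q: "has_dim (*) F 16 Q"
proof -
  obtain w where w: "w \<noteq> 0" "w * i = i * w" "w * j = - (j * w)" using anticommuting_with_jE .
  obtain m where "32 = 2 * m" "has_dim (*) F m (centralizer (Cent {i}) {j})"
    using centralizer_anticentralizer_dims[OF division_subring_Cent F_subset_Cent subset_UNIV
        has_dim_Cent_square_central[OF i] j_mem_Cent[OF w] j_nonzero F_commutes[OF j(2)] w_mem_Cent[OF w] w(1,3)] .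
  then show ?thesis unfolding Q_eq by simp
qed

lemma Q_noncommutative: "\<exists>p\<in>Q. \<exists>q\<in>Q. p * q \<noteq> q * p"
  by (rule noncommutative_of_dim[OF division_subring_Q F_subset_Q subset_UNIV has_dim_Q]) simp

lemma Q_not_subset:
  assumes "has_dim (*) F n M" "n < 16" obtains y where "y \<in> Q" "y \<notin> M"
proof -
  have "\<not> Q \<subseteq> M" using ring.has_dim_mono[OF E assms(1) has_dim_Q] assms(2) by auto
  then show thesis using that by blast
qed

lemma complete_square_Q:
  assumes x: "x \<in> Q" "x \<notin> K2"
  obtains t where "t \<in> K2" "(x - t) * (x - t) \<in> K2" "x - t \<in> Q" "x - t \<notin> K2"
proof -
  let ?M = "gen {i, j, x}"
  have comm: "a * b = b * a" if "a \<in> {i, j, x}" "b \<in> {i, j, x}" for a b using that ji x(1) by (auto simp: Q_iff)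
  note M = gen_division_subring[OF subset_UNIV, of "{i, j, x}"] gen_superset(1)
  have M_comm: "\<And>a b. a \<in> ?M \<Longrightarrow> b \<in> ?M \<Longrightarrow> a * b = b * a" by (rule gen_commutative[OF subset_UNIV comm])
  have mem: "i \<in> ?M" "j \<in> ?M" "x \<in> ?M" using gen_superset(2)[of "{i, j, x}"] by auto
  have K2M: "K2 \<subseteq> ?M" by (rule K2_least[OF M mem(1,2)])
  obtain m where m: "has_dim (*) F m ?M" using has_dim_division_subringE[OF M subset_UNIV] .
  have "m \<in> {1, 2, 4, 8}" by (rule commutative_dim_64[OF M subset_UNIV M_comm m refl])
  moreover have "\<not> m \<le> 4" using ring.has_dim_eqI[OF E m has_dim_K2 K2M] x(2) mem(3) by blast
  ultimately have "m = 2 * 4" by auto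
  then obtain t where t: "t \<in> K2" "(x - t) * (x - t) \<in> K2"
    using complete_square[OF division_subring_K2 F_subset_K2 has_dim_K2 M(1) K2M _ M_comm mem(3) x(2)] m by metis
  moreover have "x - t \<in> Q" by (rule division_subring_diff[OF division_subring_Q x(1)]) (use t(1) K2_subset_Q in blast)
  moreover have "x - t \<notin> K2" using division_subring_diff_cancel[OF division_subring_K2 _ t(1)] x(2) by blast
  ultimately show thesis using that by blast
qed

abbreviation K3 :: "'d \<Rightarrow> 'd set" where "K3 q \<equiv> extension K2 q"

context
  fixes q assumes q: "q \<in> Q" "q \<notin> K2" "q * q \<in> K2"
begin

lemma q_nonzero: "q \<noteq> 0"
  using q(2) division_subring_zero[OF division_subring_K2] by auto

lemma division_subring_K3: "division_subring (K3 q)"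
  by (rule division_subring_extension[OF division_subring_K2 F_subset_K2 subset_UNIV UNIV_I q(3)])
    (use K2_commutes[OF _ q(1)] in blast)

lemma K2_subset_K3: "K2 \<subseteq> K3 q"
  and q_mem_K3: "q \<in> K3 q"
  by (rule extension_superset extension_new; rule division_subring_K2)+

lemma F_subset_K3: "F \<subseteq> K3 q"
  using F_subset_K2 K2_subset_K3 by blast

lemma has_dim_K3: "has_dim (*) F 8 (K3 q)"
  using has_dim_extension_tower[OF division_subring_K2 F_subset_K2 has_dim_K2 q(2)] by simp

lemma mem_K3I:
  assumes "x \<in> Q" "x * q = q * x" shows "x \<in> K3 q"
proof -
  have "y * x = x * y" if "y \<in> K3 q" for y
    by (rule extension_commutes[OF K2_commutes[OF _ assms(1)] assms(2)[symmetric] that])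
  then have "x \<in> Cent (K3 q)" by (simp add: centralizer_iff)
  moreover have "Cent (K3 q) = K3 q"
    by (rule centralizer_maximal_commutative[OF division_subring_K3 F_subset_K3 subset_UNIV _ has_dim_K3])
      (simp_all add: extension_commutative[OF K2_commutative K2_commutes[OF _ q(1)]])
  ultimately show ?thesis by simp
qed

lemma anticommuting_QE:
  obtains v where "v \<in> Q" "v \<noteq> 0" "v * q = - (q * v)"
proof -
  obtain y where y: "y \<in> Q" "y \<notin> K3 q" by (rule Q_not_subset[OF has_dim_K3]) simp_all
  show thesis
  proof (rule that)
    show "y * q - q * y \<in> Q" using y(1) q(1) division_subring_Q by (simp add: division_subring_closed)
    show "y * q - q * y \<noteq> 0" using mem_K3I[OF y(1)] y(2) by auto
    show "(y * q - q * y) * q = - (q * (y * q - q * y))" by (rule commutator_anticommutes[OF K2_commutes[OF q(3) y(1)]])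
  qed
qed

context
  fixes v assumes v: "v \<in> Q" "v \<noteq> 0" "v * q = - (q * v)"
begin

lemma quaternion_decompositionE:
  assumes y: "y \<in> Q"
  obtains a b c d where "a \<in> K2" "b \<in> K2" "c \<in> K2" "d \<in> K2" "y = a + q * b + (c + q * d) * v"
proof -
  obtain c d where cd: "c \<in> centralizer Q {q}" "d \<in> centralizer Q {q}" "y = c + d * v"
    using commuting_decomposition[OF division_subring_Q F_subset_Q subset_UNIV has_dim_Q q(1) q_nonzero
        K2_commutes[OF q(3)] v y] .
  have "c \<in> K3 q" "d \<in> K3 q" using cd(1,2) by (simp_all add: centralizer_iff mem_K3I)
  then show thesis using cd(3) that by (metis adjoinE)
qed

lemma anticommuting_square_mem_K2: "v * v \<in> K2"
proof -
  have "v * v * q = q * (v * v)" by (rule anticommuting_mult[OF v(3,3)])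
  then have "v * v \<in> K3 q" by (rule mem_K3I[OF division_subring_mult[OF division_subring_Q v(1,1)]])
  then obtain a b where ab: "v * v = a + q * b" "a \<in> K2" "b \<in> K2" by (rule adjoinE)
  have va: "v * a = a * v" "v * b = b * v" using K2_commutes[OF ab(2) v(1)] K2_commutes[OF ab(3) v(1)] by simp_all
  have "v * (a + q * b) = (a + q * b) * v" unfolding ab(1)[symmetric] by (simp add: mult.assoc)
  then have "v * q * b = q * b * v" using va(1) by (simp add: distrib_left distrib_right mult.assoc)
  then have "q * b * v = - (q * b * v)" unfolding v(3) using va(2) by (simp add: mult.assoc)
  then have "q * b * v = 0" by (rule eq_minus_self)
  then have "q * b = 0" using v(2) by simp
  then show ?thesis using ab(1,2) by (simp only: add_0_right)
qed

end

end

lemma i_notin_extension: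
  assumes "v \<notin> K1" shows "i \<notin> extension F v"
proof
  assume "i \<in> extension F v"
  then obtain a b where ab: "i = a + v * b" "a \<in> F" "b \<in> F" by (rule adjoinE)
  then have "b \<noteq> 0" using i_props(1) by auto
  then have "v = v * b * inverse b" by (simp add: mult.assoc)
  also have "v * b = i - a" using ab(1) by simp
  finally have "v = (i - a) * inverse b" .
  also have "\<dots> \<in> K1"
    using F_subset_K1 ab(2,3) i_mem_K1 division_subring_K1
    by (intro division_subring_mult division_subring_diff division_subring_inverse) auto
  finally show False using assms by simp
qed

lemma biquadratic_swap: "biquadratic F j i"
proof
  show "square_central j" using j j_notin_K1 F_subset_K1 by (auto simp: square_central_def)
  show "i \<notin> extension F j" by (rule i_notin_extension[OF j_notin_K1])
qed (simp_all add: i_props ji)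

lemma biquadratic_mult: "biquadratic F (i * j) i"
proof
  have ij: "i * j \<notin> K1"
  proof
    assume "i * j \<in> K1"
    then have "inverse i * (i * j) \<in> K1"
      by (rule division_subring_mult[OF division_subring_K1 division_subring_inverse[OF division_subring_K1 i_mem_K1]])
    then show False using j_notin_K1 i_props(3) by (simp flip: mult.assoc)
  qed
  have "i * j * (i * j) = (i * i) * (j * j)" using ji by (metis mult.assoc)
  then have "i * j * (i * j) \<in> F" using division_subring_mult[OF E i_props(2) j(2)] by simp
  then show "square_central (i * j)" using ij F_subset_K1 by (auto simp: square_central_def)
  show "i * (i * j) = i * j * i" using ji by (simp add: mult.assoc)
  show "i \<notin> extension F (i * j)" by (rule i_notin_extension[OF ij])
qed (rule i_props)

end

locale biquadratic_inv = division_algebra_64_inv F \<sigma> + biquadratic F i j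
  for F :: "'d::division_ring set" and \<sigma> i j
begin

lemma ex_conjugating_vector: "\<exists>y. y \<noteq> 0 \<and> y * \<sigma> i = i * y \<and> y * \<sigma> j = j * y"
proof -
  have \<sigma>i: "\<sigma> i * \<sigma> i = i * i" and \<sigma>j: "\<sigma> j * \<sigma> j = j * j"
    using J_mult[of i i] J_mult[of j j] J_E[OF i_props(2)] J_E[OF j(2)] by auto
  have \<sigma>ji: "\<sigma> i * \<sigma> j = \<sigma> j * \<sigma> i" using J_mult[of j i] J_mult[of i j] ji by simp
  obtain x where x: "x \<noteq> 0" "i * x = x * \<sigma> i" using intertwiningE[OF i \<sigma>i] .
  show ?thesis
  proof (cases "j * x + x * \<sigma> j = 0")
    case False
    let ?y = "j * x + x * \<sigma> j"
    have "?y * \<sigma> i = j * (x * \<sigma> i) + x * \<sigma> i * \<sigma> j" unfolding mult.assoc \<sigma>ji by (simp add: distrib_right mult.assoc)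
    also have "\<dots> = j * i * x + i * x * \<sigma> j" unfolding x(2)[symmetric] by (simp add: mult.assoc)
    also have "\<dots> = i * ?y" unfolding ji by (simp add: distrib_left mult.assoc)
    finally have yi: "?y * \<sigma> i = i * ?y" .
    have "x * \<sigma> j * \<sigma> j = j * (j * x)" using F_commutes[OF j(2), of x] \<sigma>j by (simp add: mult.assoc)
    then have "?y * \<sigma> j = j * ?y" by (simp add: distrib_left distrib_right mult.assoc add.commute)
    then show ?thesis using False yi by blast
  next
    case True
    obtain w where w: "w \<noteq> 0" "w * i = i * w" "w * j = - (j * w)" using anticommuting_with_jE .
    have xj: "x * \<sigma> j = - (j * x)" using True by (simp add: eq_neg_iff_add_eq_0 add.commute)
    have "w * x * \<sigma> i = w * i * x" using x(2) by (simp add: mult.assoc)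
    then have wi: "w * x * \<sigma> i = i * (w * x)" using w(2) by (simp add: mult.assoc)
    have "w * x * \<sigma> j = - (w * j * x)" using xj by (simp add: mult.assoc)
    then have "w * x * \<sigma> j = j * (w * x)" using w(3) by (simp add: mult.assoc)
    then show ?thesis using wi w(1) x(1) by (intro exI[of _ "w * x"]) simp
  qed
qed

lemma conjugating_SymE:
  obtains e where "e \<noteq> 0" "\<sigma> e = e" "e * \<sigma> i = i * e" "e * \<sigma> j = j * e"
proof -
  let ?M = "{x. x * \<sigma> i = i * x \<and> x * \<sigma> j = j * x}"
  obtain y where y: "y \<in> ?M" "y \<noteq> 0" using ex_conjugating_vector by blast
  have "\<exists>s\<in>?M. s \<noteq> 0 \<and> \<sigma> s = s"
  proof (rule symmetric_element[OF y subset_UNIV _ _ subset_UNIV _ _ Q_noncommutative])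
    fix x assume x: "x \<in> ?M"
    then have "\<sigma> (x * \<sigma> i) = \<sigma> (i * x)" "\<sigma> (x * \<sigma> j) = \<sigma> (j * x)" by auto
    then show "\<sigma> x \<in> ?M" by (simp add: J_mult J_J)
    show "x + x' \<in> ?M" if "x' \<in> ?M" for x' using x that by (simp add: distrib_left distrib_right)
    fix q assume "q \<in> Q"
    then have "q * i = i * q" "q * j = j * q" by (simp_all add: Q_iff)
    then show "q * x \<in> ?M" using x by (simp add: mult.assoc) (simp flip: mult.assoc)
  qed (rule division_subring_mult[OF division_subring_Q])
  then show thesis using that by blast
qed

context
  assumes \<sigma>i: "\<sigma> i = i" and \<sigma>j: "\<sigma> j = - j"
begin

lemma J_K1_unitary: "k \<in> K1 \<Longrightarrow> \<sigma> k = k"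
  unfolding K1_def by (rule fixed_extension[OF J_E \<sigma>i F_commutes])

lemma J_K2_unitary: "k \<in> K2 \<Longrightarrow> \<sigma> k \<in> K2" "k \<in> K2 \<Longrightarrow> \<sigma> k = k \<Longrightarrow> k \<in> K1"
  unfolding K2_def by (rule skew_extension[OF division_subring_K1 J_K1_unitary \<sigma>j K1_commutes[OF _ ji]]; assumption)+

lemma J_Q_unitary:
  assumes "x \<in> Q" shows "\<sigma> x \<in> Q"
proof -
  have "\<sigma> (x * i) = \<sigma> (i * x)" "\<sigma> (x * j) = \<sigma> (j * x)" using assms by (simp_all add: Q_iff)
  then show ?thesis by (simp add: Q_iff J_mult \<sigma>i \<sigma>j)
qed

lemma skew_QE:
  obtains q where "q \<in> Q" "q \<notin> K2" "\<sigma> q = - q"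
proof -
  obtain y where y: "y \<in> Q" "y \<notin> K2" by (rule Q_not_subset[OF has_dim_K2]) simp_all
  note \<sigma>y = J_Q_unitary[OF y(1)]
  show thesis
  proof (cases "y - \<sigma> y \<in> K2")
    case False
    then show ?thesis
      using that[of "y - \<sigma> y"] division_subring_diff[OF division_subring_Q y(1) \<sigma>y] by (simp add: J_diff J_J)
  next
    case True
    let ?s = "y + \<sigma> y"
    have s: "?s \<in> Q" by (rule division_subring_add[OF division_subring_Q y(1) \<sigma>y])
    have sK: "?s \<notin> K2"
    proof
      assume "?s \<in> K2"
      then have "?s + (y - \<sigma> y) \<in> K2" by (rule division_subring_add[OF division_subring_K2 _ True])
      then have "y + y \<in> K2" by simp
      then show False using double_mem[OF division_subring_subspace[OF division_subring_K2 F_subset_K2]] y(2) by blast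
    qed
    show ?thesis
    proof (rule that)
      show "j * ?s \<in> Q" by (rule division_subring_mult[OF division_subring_Q _ s]) (use j_mem_K2 K2_subset_Q in blast)
      have "?s * j = j * ?s" using s by (simp add: Q_iff)
      then show "\<sigma> (j * ?s) = - (j * ?s)" by (simp add: J_mult J_add J_J \<sigma>j add.commute)
      show "j * ?s \<notin> K2"
      proof
        assume "j * ?s \<in> K2"
        then have "inverse j * (j * ?s) \<in> K2"
          by (rule division_subring_mult[OF division_subring_K2 division_subring_inverse[OF division_subring_K2 j_mem_K2]])
        then show False using sK j_nonzero by (simp flip: mult.assoc)
      qed
    qed
  qed
qed

lemma skew_square_root_K1E:
  obtains q where "q \<in> Q" "q \<notin> K2" "\<sigma> q = - q" "q * q \<in> K1"
proof -
  obtain p where p: "p \<in> Q" "p \<notin> K2" "\<sigma> p = - p" using skew_QE .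
  obtain t where t: "t \<in> K2" "(p - t) * (p - t) \<in> K2" "p - t \<in> Q" "p - t \<notin> K2" using complete_square_Q[OF p(1,2)] .
  define q s where "q = p - t" and "s = t + \<sigma> t"
  have q: "q \<in> Q" "q \<notin> K2" "q * q \<in> K2" using t by (simp_all add: q_def)
  note K2 = division_subring_K2
  have s: "s \<in> K2" unfolding s_def by (rule division_subring_add[OF K2 t(1) J_K2_unitary(1)[OF t(1)]])
  have \<sigma>q: "\<sigma> q = - (q + s)" using p(3) by (simp add: q_def s_def J_diff)
  have "s = 0"
  proof (rule ccontr)
    assume "s \<noteq> 0"
    have "\<sigma> (q * q) = (q + s) * (q + s)" unfolding J_mult[OF UNIV_I UNIV_I] \<sigma>q by (rule minus_mult_minus)
    also have "\<dots> = q * q + (s * q + q * s) + s * s" by (simp only: distrib_left distrib_right add.assoc)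
    finally have "s * q + s * q = \<sigma> (q * q) - q * q - s * s"
      unfolding K2_commutes[OF s q(1), symmetric] by simp
    also have "\<dots> \<in> K2"
      by (intro division_subring_diff[OF K2] J_K2_unitary(1) q(3) division_subring_mult[OF K2 s s])
    finally have "s * q \<in> K2" by (rule double_mem[OF division_subring_subspace[OF K2 F_subset_K2]])
    then have "inverse s * (s * q) \<in> K2" by (rule division_subring_mult[OF K2 division_subring_inverse[OF K2 s]])
    then show False using q(2) \<open>s \<noteq> 0\<close> by (simp flip: mult.assoc)
  qed
  then have \<sigma>q: "\<sigma> q = - q" using \<sigma>q by simp
  then have "\<sigma> (q * q) = q * q" by (simp add: J_mult)
  then show thesis using that q \<sigma>q J_K2_unitary(2) by blast
qed

lemma skew_anticommuting_QE:
  assumes q: "q \<in> Q" "q \<notin> K2" "\<sigma> q = - q" "q * q \<in> K1"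
  obtains v where "v \<in> Q" "v \<noteq> 0" "v * q = - (q * v)" "\<sigma> v = - v" "v * v \<in> K1"
proof -
  have qq: "q * q \<in> K2" using q(4) K1_subset_K2 by blast
  obtain u where u: "u \<in> Q" "u \<noteq> 0" "u * q = - (q * u)" using anticommuting_QE[OF q(1,2) qq] .
  have "\<exists>v\<in>Q. v \<noteq> 0 \<and> v * q = - (q * v) \<and> \<sigma> v = - v"
  proof (cases "u - \<sigma> u = 0")
    case False
    have "\<sigma> (u * q) = \<sigma> (- (q * u))" using u(3) by simp
    then have "\<sigma> u * q = - (q * \<sigma> u)" by (simp add: J_mult J_minus q(3))
    then have "(u - \<sigma> u) * q = - (q * (u - \<sigma> u))" using u(3) by (simp add: left_diff_distrib right_diff_distrib)
    moreover have "\<sigma> (u - \<sigma> u) = - (u - \<sigma> u)" by (simp add: J_diff J_J)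
    moreover have "u - \<sigma> u \<in> Q" by (rule division_subring_diff[OF division_subring_Q u(1) J_Q_unitary[OF u(1)]])
    ultimately show ?thesis using False by blast
  next
    case True
    have uj: "u * j = j * u" and qj: "q * j = j * q" using u(1) q(1) by (simp_all add: Q_iff)
    have "\<sigma> (j * u) = - (j * u)" using True uj by (simp add: J_mult \<sigma>j)
    moreover have "j * u * q = - (q * (j * u))"
    proof -
      have "j * u * q = - (j * q * u)" using u(3) by (simp add: mult.assoc)
      then show ?thesis unfolding qj[symmetric] by (simp add: mult.assoc)
    qed
    moreover have "j * u \<in> Q" by (rule division_subring_mult[OF division_subring_Q _ u(1)]) (use j_mem_K2 K2_subset_Q in blast)
    ultimately show ?thesis using u(2) j_nonzero by (intro bexI[of _ "j * u"]) auto
  qed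
  then obtain v where v: "v \<in> Q" "v \<noteq> 0" "v * q = - (q * v)" "\<sigma> v = - v" by blast
  have "\<sigma> (v * v) = v * v" by (simp add: J_mult v(4))
  then have "v * v \<in> K1" by (rule J_K2_unitary(2)[OF anticommuting_square_mem_K2[OF q(1,2) qq v(1-3)]])
  then show thesis using that v by blast
qed

end

end

locale biquadratic_sym = biquadratic_inv F \<sigma> i j for F :: "'d::division_ring set" and \<sigma> i j +
  assumes J_i: "\<sigma> i = i" and J_j: "\<sigma> j = j" and dim_Sym_ge: "has_dim (*) F r Sym \<Longrightarrow> 36 \<le> r"
begin

lemma biquadratic_sym_swap: "biquadratic_sym F \<sigma> j i"
proof -
  interpret swap: biquadratic F j i by (rule biquadratic_swap)
  show ?thesis by unfold_locales (use J_i J_j dim_Sym_ge in auto)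
qed

lemma biquadratic_sym_mult: "biquadratic_sym F \<sigma> (i * j) i"
proof -
  interpret mult: biquadratic F "i * j" i by (rule biquadratic_mult)
  show ?thesis by unfold_locales (use J_i J_j dim_Sym_ge ji in \<open>auto simp: J_mult\<close>)
qed

lemma J_K1: "k \<in> K1 \<Longrightarrow> \<sigma> k = k"
  unfolding K1_def by (rule fixed_extension[OF J_E J_i F_commutes])

lemma J_K2: "k \<in> K2 \<Longrightarrow> \<sigma> k = k"
  unfolding K2_def by (rule fixed_extension[OF J_K1 J_j K1_commutes[OF _ ji]])

lemma J_Cent:
  assumes "x \<in> Cent {i}" shows "\<sigma> x \<in> Cent {i}"
proof -
  have "\<sigma> (x * i) = \<sigma> (i * x)" using assms by (simp add: centralizer_iff)
  then show ?thesis by (simp add: centralizer_iff J_mult J_i)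
qed

lemma J_Q:
  assumes "x \<in> Q" shows "\<sigma> x \<in> Q"
proof -
  have "\<sigma> (x * i) = \<sigma> (i * x)" "\<sigma> (x * j) = \<sigma> (j * x)" using assms by (simp_all add: Q_iff)
  then show ?thesis by (simp add: Q_iff J_mult J_i J_j)
qed

lemma Sym_anticommuting_with_jE:
  obtains w where "w \<noteq> 0" "\<sigma> w = w" "w * i = i * w" "w * j = - (j * w)"
proof -
  let ?M = "{x. x * i = i * x \<and> x * j = - (j * x)}"
  obtain w where w: "w \<in> ?M" "w \<noteq> 0" using anticommuting_with_jE by blast
  have "\<exists>s\<in>?M. s \<noteq> 0 \<and> \<sigma> s = s"
  proof (rule symmetric_element[OF w subset_UNIV _ _ subset_UNIV _ _ Q_noncommutative])
    fix x assume x: "x \<in> ?M"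
    then have "\<sigma> (x * i) = \<sigma> (i * x)" "\<sigma> (x * j) = \<sigma> (- (j * x))" by auto
    then show "\<sigma> x \<in> ?M" by (simp add: J_mult J_minus J_i J_j)
    show "x + x' \<in> ?M" if "x' \<in> ?M" for x' using x that by (simp add: distrib_left distrib_right)
    fix q assume "q \<in> Q"
    then have "q * i = i * q" "q * j = j * q" by (simp_all add: Q_iff)
    then show "q * x \<in> ?M" using x by (simp add: mult.assoc) (simp flip: mult.assoc)
  qed (rule division_subring_mult[OF division_subring_Q])
  then show thesis using that by blast
qed

lemma Sym_Q_not_subset_K2: "\<exists>x\<in>Q. \<sigma> x = x \<and> x \<notin> K2"
proof -
  obtain r where r: "has_dim (*) F r (Sym \<inter> UNIV)" "36 \<le> r"
    using has_dim_subspaceE[OF subspace_Sym subset_UNIV] dim_Sym_ge by auto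
  obtain v where v: "v \<noteq> 0" "v * i = - (i * v)" using square_central_anticommutingE[OF i] by blast
  obtain k where k: "has_dim (*) F k (Sym \<inter> Cent {i})" "4 * r \<le> 4 * k + 64"
    using has_dim_Sym_centralizer[OF D E_sub order_refl dim_D UNIV_I UNIV_I i_props(3,2) J_i UNIV_I v r(1)] .
  obtain w where w: "w \<noteq> 0" "w * i = i * w" "w * j = - (j * w)" using anticommuting_with_jE .
  obtain l where l: "has_dim (*) F l (Sym \<inter> Q)" "4 * k \<le> 4 * l + 32"
    unfolding Q_eq
    by (rule has_dim_Sym_centralizer[OF division_subring_Cent F_subset_Cent subset_UNIV has_dim_Cent_square_central[OF i]
          J_Cent j_mem_Cent[OF w] j_nonzero j(2) J_j w_mem_Cent[OF w] w(1,3) k(1)])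
  have "\<not> Sym \<inter> Q \<subseteq> K2" using ring.has_dim_mono[OF E has_dim_K2 l(1)] l(2) k(2) r(2) by fastforce
  then show ?thesis by (auto simp: Sym_iff)
qed

lemma orthogonal_basisE:
  obtains k w where "k \<in> Q" "k \<notin> K2" "k * k \<in> K2" "\<sigma> k = k" "w \<in> Q" "w \<noteq> 0" "\<sigma> w = w" "w * k = - (k * w)"
proof -
  obtain x where x: "x \<in> Q" "\<sigma> x = x" "x \<notin> K2" using Sym_Q_not_subset_K2 by blast
  obtain t where t: "t \<in> K2" "(x - t) * (x - t) \<in> K2" "x - t \<in> Q" "x - t \<notin> K2" using complete_square_Q[OF x(1,3)] .
  define k where "k = x - t"
  have k: "k \<in> Q" "k \<notin> K2" "k * k \<in> K2" "\<sigma> k = k" unfolding k_def using t x J_K2[OF t(1)] by (auto simp: J_diff)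
  obtain v where v: "v \<in> Q" "v \<noteq> 0" "v * k = - (k * v)" using anticommuting_QE[OF k(1-3)] .
  show thesis
  proof (cases "v + \<sigma> v = 0")
    case False
    have "\<sigma> (v * k) = \<sigma> (- (k * v))" using v(3) by simp
    then have "k * \<sigma> v = - (\<sigma> v * k)" by (simp add: J_mult J_minus k(4))
    then have "(v + \<sigma> v) * k = - (k * (v + \<sigma> v))" using v(3) by (simp add: distrib_left distrib_right)
    moreover have "v + \<sigma> v \<in> Q" by (rule division_subring_add[OF division_subring_Q v(1) J_Q[OF v(1)]])
    ultimately show ?thesis using that[OF k] False add_J_Sym[of v] by (simp add: Sym_iff)
  next
    case True
    then have "\<sigma> v = - v" by (simp add: eq_neg_iff_add_eq_0 add.commute)
    then have "\<sigma> (k * v) = k * v" using v(3) by (simp add: J_mult k(4))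
    moreover have "k * v * k = - (k * (k * v))" using v(3) by (simp add: mult.assoc)
    moreover have "k * v \<noteq> 0" using v(2) q_nonzero[OF k(1-3)] by simp
    moreover have "k * v \<in> Q" by (rule division_subring_mult[OF division_subring_Q k(1) v(1)])
    ultimately show ?thesis using that k by blast
  qed
qed

lemma unitary_basisE:
  assumes w: "w \<noteq> 0" "\<sigma> w = w" "w * i = i * w" "w * j = - (j * w)"
  obtains q v where "q \<in> Q" "q \<notin> K2" "q * q \<in> K1" "w * \<sigma> q = - (q * w)"
    "v \<in> Q" "v \<noteq> 0" "v * q = - (q * v)" "w * \<sigma> v = - (v * w)" "v * v \<in> K1"
proof -
  define \<tau> where "\<tau> = (\<lambda>d. w * \<sigma> d * inverse w)"
  interpret T: division_algebra_64_inv F \<tau> unfolding \<tau>_def by (rule conjugate_involution) (use w in auto)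
  interpret T: biquadratic_inv F \<tau> i j ..
  have \<tau>: "\<tau> i = i" "\<tau> j = - j" unfolding \<tau>_def J_i J_j w(3,4) using w(1) by (simp_all add: mult.assoc)
  obtain q where q: "q \<in> Q" "q \<notin> K2" "\<tau> q = - q" "q * q \<in> K1" using T.skew_square_root_K1E[OF \<tau>] .
  obtain v where v: "v \<in> Q" "v \<noteq> 0" "v * q = - (q * v)" "\<tau> v = - v" "v * v \<in> K1" using T.skew_anticommuting_QE[OF \<tau> q] .
  have "w * \<sigma> x = \<tau> x * w" for x unfolding \<tau>_def using w(1) by (simp add: mult.assoc)
  then show thesis using that q v by simp
qed

end

section \<open>Systems of quadratic forms\<close>

definition multiples :: "'d::times set \<Rightarrow> 'd \<Rightarrow> 'd set" where
  "multiples B e = (\<lambda>b. b * e) ` B"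

lemma multiplesI: "b \<in> B \<Longrightarrow> b * e \<in> multiples B e"
  unfolding multiples_def by blast

lemma multiplesE:
  assumes "x \<in> multiples B e" obtains b where "b \<in> B" "x = b * e"
  using assms unfolding multiples_def by blast

lemma multiples_one [simp]: "multiples (B :: 'd::monoid_mult set) 1 = B"
  by (simp add: multiples_def)

locale system_of_forms = right_module act + division_algebra_64_inv F \<sigma>
  for act :: "'v::ab_group_add \<Rightarrow> 'd::division_ring \<Rightarrow> 'v" (infixl "\<cdot>" 80) and F :: "'d set" and \<sigma> +
  fixes V :: "'v set" and \<beta> :: "'v \<Rightarrow> 'v \<Rightarrow> 'd" and u :: nat
  assumes subspace_V: "subspace_over (\<cdot>) UNIV V"
    and \<beta>_mem: "v \<in> V \<Longrightarrow> w \<in> V \<Longrightarrow> \<beta> v w \<in> F"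
    and \<beta>_add: "v \<in> V \<Longrightarrow> v' \<in> V \<Longrightarrow> w \<in> V \<Longrightarrow> \<beta> (v + v') w = \<beta> v w + \<beta> v' w"
    and \<beta>_act: "v \<in> V \<Longrightarrow> w \<in> V \<Longrightarrow> c \<in> F \<Longrightarrow> \<beta> v (w \<cdot> c) = \<beta> v w * c"
    and \<beta>_sym: "v \<in> V \<Longrightarrow> w \<in> V \<Longrightarrow> \<beta> v w = \<beta> w v"
    and \<beta>_adjoint: "v \<in> V \<Longrightarrow> w \<in> V \<Longrightarrow> \<beta> (v \<cdot> d) w = \<beta> v (w \<cdot> \<sigma> d)"
    and isotropic: "\<sigma> e = e \<Longrightarrow> W \<subseteq> V \<Longrightarrow> has_dim (\<cdot>) F m W \<Longrightarrow> u < m \<Longrightarrow>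
      \<exists>v\<in>W. v \<noteq> 0 \<and> \<beta> (v \<cdot> e) v = 0"
begin

lemma V_act: "v \<in> V \<Longrightarrow> v \<cdot> d \<in> V"
  by (rule subspace_over_act[OF subspace_V _ UNIV_I])

definition null_scalars :: "'v \<Rightarrow> 'd set" where
  "null_scalars v = {x. \<beta> (v \<cdot> x) v = 0}"

lemma null_scalars_add:
  "v \<in> V \<Longrightarrow> x \<in> null_scalars v \<Longrightarrow> y \<in> null_scalars v \<Longrightarrow> x + y \<in> null_scalars v"
  by (simp add: null_scalars_def act_add_right \<beta>_add V_act)

lemma null_scalars_skew:
  assumes v: "v \<in> V" and x: "\<sigma> x = - x"
  shows "x \<in> null_scalars v"
proof -
  have "\<beta> 0 v = 0" using \<beta>_add[OF V_act[OF v, of 0] V_act[OF v, of 0] v] by simp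
  moreover have "\<beta> (v \<cdot> (- x)) v = \<beta> (v \<cdot> x) v"
    using \<beta>_adjoint[OF v v, of x] \<beta>_sym[OF v V_act[OF v], of "- x"] x by simp
  moreover have "\<beta> (v \<cdot> x + v \<cdot> (- x)) v = \<beta> (v \<cdot> x) v + \<beta> (v \<cdot> (- x)) v"
    by (rule \<beta>_add[OF V_act[OF v] V_act[OF v] v])
  ultimately have "\<beta> (v \<cdot> x) v + \<beta> (v \<cdot> x) v = 0" by (simp add: act_minus_right)
  then have "\<beta> (v \<cdot> x) v = 0" by (rule double_eq_0)
  then show ?thesis by (simp add: null_scalars_def)
qed

text \<open>The least such \<open>c\<close> is a \<open>u\<close>-invariant of the system of forms \<open>v \<mapsto> \<beta> (v \<cdot> x) v\<close>, \<open>x \<in> S\<close>,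
  restricted to \<open>B\<close>-subspaces.\<close>

definition isotropy_bound :: "'d set \<Rightarrow> 'd set \<Rightarrow> nat \<Rightarrow> bool" where
  "isotropy_bound B S c \<longleftrightarrow> (\<forall>W m. W \<subseteq> V \<longrightarrow> subspace_over (\<cdot>) B W \<longrightarrow> has_dim (\<cdot>) F m W \<longrightarrow> c < m \<longrightarrow>
     (\<exists>v\<in>W. v \<noteq> 0 \<and> S \<subseteq> null_scalars v))"

lemma isotropy_boundE:
  assumes "isotropy_bound B S c" "W \<subseteq> V" "subspace_over (\<cdot>) B W" "has_dim (\<cdot>) F m W" "c < m"
  obtains v where "v \<in> W" "v \<noteq> 0" "S \<subseteq> null_scalars v"
  using assms unfolding isotropy_bound_def by blast

lemma isotropy_bound_closure:
  assumes "isotropy_bound B S c" "B \<subseteq> B'" and T: "\<And>v. v \<in> V \<Longrightarrow> S \<subseteq> null_scalars v \<Longrightarrow> T \<subseteq> null_scalars v"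
  shows "isotropy_bound B' T c"
  unfolding isotropy_bound_def
proof (intro allI impI)
  fix W m assume W: "W \<subseteq> V" "subspace_over (\<cdot>) B' W" "has_dim (\<cdot>) F m W" "c < m"
  obtain v where "v \<in> W" "v \<noteq> 0" "S \<subseteq> null_scalars v"
    using isotropy_boundE[OF assms(1) W(1) subspace_over_mono[OF W(2) assms(2)] W(3,4)] .
  then show "\<exists>v\<in>W. v \<noteq> 0 \<and> T \<subseteq> null_scalars v" using T W(1) by blast
qed

lemma isotropy_bound_mono: "isotropy_bound B S c \<Longrightarrow> B \<subseteq> B' \<Longrightarrow> isotropy_bound B' S c"
  by (rule isotropy_bound_closure)

lemma isotropy_bound_multiples_F:
  assumes e: "\<sigma> e = e" shows "isotropy_bound F (multiples F e) u"
  unfolding isotropy_bound_def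
proof (intro allI impI)
  fix W m assume W: "W \<subseteq> V" "has_dim (\<cdot>) F m W" "u < m"
  obtain v where v: "v \<in> W" "v \<noteq> 0" "\<beta> (v \<cdot> e) v = 0" using isotropic[OF e W] by blast
  then have vV: "v \<in> V" using W by blast
  have "c * e \<in> null_scalars v" if c: "c \<in> F" for c
  proof -
    have "\<beta> (v \<cdot> (c * e)) v = \<beta> (v \<cdot> e \<cdot> c) v" unfolding F_commutes[OF c, of e] by (simp add: act_mult)
    also have "\<dots> = \<beta> (v \<cdot> e) (v \<cdot> c)" using \<beta>_adjoint[OF V_act[OF vV] vV] J_E[OF c] by simp
    also have "\<dots> = 0" using \<beta>_act[OF V_act[OF vV] vV c] v(3) by simp
    finally show ?thesis by (simp add: null_scalars_def)
  qed
  then show "\<exists>v\<in>W. v \<noteq> 0 \<and> multiples F e \<subseteq> null_scalars v" using v by (auto elim!: multiplesE)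
qed

definition conjugates_into :: "'d \<Rightarrow> 'd set \<Rightarrow> 'd set \<Rightarrow> bool" where
  "conjugates_into e B N \<longleftrightarrow> (\<forall>b\<in>B. \<exists>b'\<in>N. e * \<sigma> b = b' * e)"

lemma conjugates_into_fixed:
  assumes "\<And>b. b \<in> B \<Longrightarrow> \<sigma> b = b" "\<And>b. b \<in> B \<Longrightarrow> b * e = e * b" "B \<subseteq> N"
  shows "conjugates_into e B N"
  unfolding conjugates_into_def
proof
  fix b assume b: "b \<in> B"
  have "e * \<sigma> b = b * e" using assms(1,2)[OF b] by simp
  then show "\<exists>b'\<in>N. e * \<sigma> b = b' * e" using assms(3) b by blast
qed

lemma conjugates_into_F: "conjugates_into e F F"
  by (rule conjugates_into_fixed[OF J_E F_commutes order_refl])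

lemma conjugates_into_extension:
  assumes N: "division_subring N" "conjugates_into e B N" and p: "p' \<in> N" "e * \<sigma> p = p' * e"
  shows "conjugates_into e (extension B p) N"
  unfolding conjugates_into_def
proof
  fix x assume "x \<in> extension B p"
  then obtain a b where x: "x = a + p * b" "a \<in> B" "b \<in> B" by (rule adjoinE)
  obtain a' where a': "a' \<in> N" "e * \<sigma> a = a' * e" using N(2) x(2) unfolding conjugates_into_def by blast
  obtain b' where b': "b' \<in> N" "e * \<sigma> b = b' * e" using N(2) x(3) unfolding conjugates_into_def by blast
  have "e * \<sigma> x = e * \<sigma> a + e * \<sigma> b * \<sigma> p" unfolding x(1) by (simp add: J_add J_mult distrib_left mult.assoc)
  also have "\<dots> = (a' + b' * p') * e" unfolding a'(2) b'(2) mult.assoc[of b' e] p(2) by (simp add: distrib_right mult.assoc)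
  finally have "e * \<sigma> x = (a' + b' * p') * e" .
  moreover have "a' + b' * p' \<in> N" by (rule division_subring_add[OF N(1) a'(1) division_subring_mult[OF N(1) b'(1) p(1)]])
  ultimately show "\<exists>b'\<in>N. e * \<sigma> x = b' * e" by blast
qed

lemma reflexive_form_twisted:
  assumes e: "\<sigma> e = e" and W: "W \<subseteq> V" "subspace_over (\<cdot>) F W"
  shows "reflexive_form (\<cdot>) F W (\<lambda>x y. \<beta> (x \<cdot> e) y)"
proof
  have WV: "x \<in> V" "x \<cdot> e \<in> V" if "x \<in> W" for x using that W(1) V_act by blast+
  have sym: "\<beta> (x \<cdot> e) y = \<beta> (y \<cdot> e) x" if "x \<in> W" "y \<in> W" for x y
    using \<beta>_adjoint[OF WV(1)[OF that(1)] WV(1)[OF that(2)], of e] \<beta>_sym[OF WV(1)[OF that(1)] WV(2)[OF that(2)]] e by simp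
  show "\<beta> (x \<cdot> e) y \<in> F" if "x \<in> W" "y \<in> W" for x y by (rule \<beta>_mem[OF WV(2)[OF that(1)] WV(1)[OF that(2)]])
  show add: "\<beta> ((x + y) \<cdot> e) z = \<beta> (x \<cdot> e) z + \<beta> (y \<cdot> e) z" if "x \<in> W" "y \<in> W" "z \<in> W" for x y z
    unfolding act_add_left by (rule \<beta>_add[OF WV(2)[OF that(1)] WV(2)[OF that(2)] WV(1)[OF that(3)]])
  show "linear_over (\<cdot>) (*) F W (\<beta> (x \<cdot> e))" if x: "x \<in> W" for x
    unfolding linear_over_def
  proof (intro conjI ballI)
    fix y assume y: "y \<in> W"
    show "\<beta> (x \<cdot> e) (y \<cdot> c) = \<beta> (x \<cdot> e) y * c" if "c \<in> F" for c
      by (rule \<beta>_act[OF WV(2)[OF x] WV(1)[OF y] that])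
    show "\<beta> (x \<cdot> e) (y + z) = \<beta> (x \<cdot> e) y + \<beta> (x \<cdot> e) z" if "z \<in> W" for z
      using sym[OF x] add[OF y that x] y that subspace_over_add[OF W(2) y that] by simp
  qed
  show "\<beta> (y \<cdot> e) x = 0" if "x \<in> W" "y \<in> W" "\<beta> (x \<cdot> e) y = 0" for x y using sym that by simp
qed (fact E W(2))+

lemma conjugates_into_adjointE:
  assumes e: "\<sigma> e = e" "conjugates_into e B B" and b: "b \<in> B"
  obtains b' where "b' \<in> B" "\<And>x y. x \<in> V \<Longrightarrow> y \<in> V \<Longrightarrow> \<beta> (x \<cdot> b \<cdot> e) y = \<beta> (x \<cdot> e) (y \<cdot> b')"
proof -
  obtain b' where b': "b' \<in> B" "e * \<sigma> b = b' * e" using e(2) b unfolding conjugates_into_def by blast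
  have "\<sigma> (e * \<sigma> b) = \<sigma> (b' * e)" using b'(2) by simp
  then have "b * e = e * \<sigma> b'" by (simp add: J_mult J_J e(1))
  then have "x \<cdot> b \<cdot> e = x \<cdot> e \<cdot> \<sigma> b'" for x by (simp flip: act_mult)
  then have "\<beta> (x \<cdot> b \<cdot> e) y = \<beta> (x \<cdot> e) (y \<cdot> b')" if "x \<in> V" "y \<in> V" for x y
    using \<beta>_adjoint[OF V_act[OF that(1)] that(2), of e "\<sigma> b'"] by (simp add: J_J)
  then show thesis using that b'(1) by blast
qed

lemma isotropic_subspaceE:
  assumes B: "division_subring B" "F \<subseteq> B" and e: "\<sigma> e = e" "conjugates_into e B B"
    and bound: "isotropy_bound B (multiples B e) c"
    and W: "W \<subseteq> V" "subspace_over (\<cdot>) B W" "has_dim (\<cdot>) F m W"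
  obtains T d where "T \<subseteq> W" "subspace_over (\<cdot>) B T" "has_dim (\<cdot>) F d T" "m \<le> c + 2 * d"
    "\<And>v. v \<in> T \<Longrightarrow> multiples B e \<subseteq> null_scalars v"
proof -
  interpret form: reflexive_form "(\<cdot>)" F W "\<lambda>x y. \<beta> (x \<cdot> e) y"
    by (rule reflexive_form_twisted[OF e(1) W(1) has_dim_subspace[OF W(3) E]])
  have adjoints: "form.has_adjoints B"
    unfolding form.has_adjoints_def
  proof
    fix b assume "b \<in> B"
    then obtain b' where "b' \<in> B" "\<And>x y. x \<in> V \<Longrightarrow> y \<in> V \<Longrightarrow> \<beta> (x \<cdot> b \<cdot> e) y = \<beta> (x \<cdot> e) (y \<cdot> b')"
      by (rule conjugates_into_adjointE[OF e]) (rule that)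
    then show "\<exists>b'\<in>B. \<forall>x\<in>W. \<forall>y\<in>W. \<beta> (x \<cdot> b \<cdot> e) y = \<beta> (x \<cdot> e) (y \<cdot> b')" using W(1) by blast
  qed
  obtain T d where T: "form.totally_isotropic T" "subspace_over (\<cdot>) B T" "has_dim (\<cdot>) F d T" "m \<le> c + 2 * d"
  proof (rule form.totally_isotropic_subspaceE[OF B W(2) adjoints W(3)])
    fix U k assume U: "U \<subseteq> W" "subspace_over (\<cdot>) B U" "has_dim (\<cdot>) F k U" "c < k"
    then have "U \<subseteq> V" using W(1) by blast
    then obtain v where v: "v \<in> U" "v \<noteq> 0" "multiples B e \<subseteq> null_scalars v" using isotropy_boundE[OF bound _ U(2-4)] by blast
    have "\<beta> (v \<cdot> b \<cdot> e) v = 0" if "b \<in> B" for b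
      using v(3) multiplesI[OF that, of e] by (auto simp: null_scalars_def act_mult)
    then show "\<exists>v\<in>U. v \<noteq> 0 \<and> (\<forall>b\<in>B. \<beta> (v \<cdot> b \<cdot> e) v = 0)" using v(1,2) by blast
  qed
  show thesis
  proof (rule that[OF _ T(2-4)])
    show "T \<subseteq> W" using T(1) by (simp add: form.totally_isotropic_def)
    fix v assume v: "v \<in> T"
    have "\<beta> (v \<cdot> (b * e)) v = 0" if "b \<in> B" for b
      unfolding act_mult using T(1) v subspace_over_act[OF T(2) v that] by (simp add: form.totally_isotropic_def)
    then show "multiples B e \<subseteq> null_scalars v" by (auto elim!: multiplesE simp: null_scalars_def)
  qed
qed

lemma isotropy_bound_compose:
  assumes B: "division_subring B" "F \<subseteq> B" and e: "\<sigma> e = e" "conjugates_into e B B"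
    and bound: "isotropy_bound B (multiples B e) c" and bound': "isotropy_bound B' S c'" "B' \<subseteq> B"
  shows "isotropy_bound B (multiples B e \<union> S) (c + 2 * c')"
  unfolding isotropy_bound_def
proof (intro allI impI)
  fix W m assume W: "W \<subseteq> V" "subspace_over (\<cdot>) B W" "has_dim (\<cdot>) F m W" "c + 2 * c' < m"
  obtain T d where T: "T \<subseteq> W" "subspace_over (\<cdot>) B T" "has_dim (\<cdot>) F d T" "m \<le> c + 2 * d"
    "\<And>v. v \<in> T \<Longrightarrow> multiples B e \<subseteq> null_scalars v"
    by (rule isotropic_subspaceE[OF B e bound W(1-3)]) (rule that)
  have "c' < d" using T(4) W(4) by linarith
  moreover have "T \<subseteq> V" using T(1) W(1) by blast
  ultimately obtain v where v: "v \<in> T" "v \<noteq> 0" "S \<subseteq> null_scalars v"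
    using isotropy_boundE[OF bound'(1) _ subspace_over_mono[OF T(2) bound'(2)] T(3)] by blast
  then show "\<exists>v\<in>W. v \<noteq> 0 \<and> multiples B e \<union> S \<subseteq> null_scalars v" using T(1,5) by blast
qed

lemma isotropy_bound_extension:
  assumes B: "division_subring B" "F \<subseteq> B" and e: "\<sigma> e = e" "conjugates_into e B B"
    and p: "\<And>b. b \<in> B \<Longrightarrow> p * b = b * p"
    and bounds: "isotropy_bound B (multiples B e) c" "isotropy_bound B (multiples B (p * e)) c'"
  shows "isotropy_bound B (multiples (extension B p) e) (c + 2 * c')"
proof (rule isotropy_bound_closure[OF isotropy_bound_compose[OF B e bounds order_refl] order_refl])
  fix v assume v: "v \<in> V" "multiples B e \<union> multiples B (p * e) \<subseteq> null_scalars v"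
  show "multiples (extension B p) e \<subseteq> null_scalars v"
  proof
    fix y assume "y \<in> multiples (extension B p) e"
    then obtain a b where ab: "a \<in> B" "b \<in> B" "y = (a + p * b) * e" by (auto elim!: multiplesE adjoinE)
    have "a * e + b * (p * e) \<in> null_scalars v"
      using v(2) ab(1,2) by (intro null_scalars_add[OF v(1)]) (auto intro: multiplesI)
    then show "y \<in> null_scalars v" unfolding ab(3) using p[OF ab(2)] by (simp add: distrib_right mult.assoc)
  qed
qed

end

locale biquadratic_forms = system_of_forms act F \<sigma> V \<beta> u + biquadratic_sym F \<sigma> i j
  for act :: "'v::ab_group_add \<Rightarrow> 'd::division_ring \<Rightarrow> 'v" (infixl "\<cdot>" 80) and F :: "'d set" and \<sigma> V \<beta> u i j
begin

lemma conjugates_into_K1: "e * i = i * e \<Longrightarrow> K1 \<subseteq> N \<Longrightarrow> conjugates_into e K1 N"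
  by (rule conjugates_into_fixed[OF J_K1 K1_commutes])

lemma conjugates_into_K2: "e \<in> Q \<Longrightarrow> K2 \<subseteq> N \<Longrightarrow> conjugates_into e K2 N"
  by (rule conjugates_into_fixed[OF J_K2 K2_commutes])

lemma isotropy_bound_multiples_K1:
  assumes e: "\<sigma> e = e" "e * i = i * e"
  shows "isotropy_bound F (multiples K1 e) (3 * u)"
proof -
  have "\<sigma> (i * e) = i * e" using e J_i by (simp add: J_mult)
  then have "isotropy_bound F (multiples K1 e) (u + 2 * u)"
    unfolding K1_def
    by (intro isotropy_bound_extension[OF E order_refl e(1) conjugates_into_F F_commutes[symmetric]]
        isotropy_bound_multiples_F e(1))
  then show ?thesis by simp
qed

lemma isotropy_bound_multiples_K2:
  assumes e: "\<sigma> e = e" "e \<in> Q"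
  shows "isotropy_bound K1 (multiples K2 e) (9 * u)"
proof -
  have ei: "e * i = i * e" and ej: "e * j = j * e" using e(2) by (auto simp: Q_iff)
  have "\<sigma> (j * e) = j * e" using e(1) ej J_j by (simp add: J_mult)
  moreover have "j * e * i = i * (j * e)" by (rule commutes_mult[OF ji ei])
  ultimately have "isotropy_bound K1 (multiples K2 e) (3 * u + 2 * (3 * u))"
    unfolding K2_def
    by (intro isotropy_bound_extension[OF division_subring_K1 F_subset_K1 e(1) conjugates_into_K1[OF ei order_refl]
          K1_commutes[OF _ ji, symmetric]] isotropy_bound_mono[OF isotropy_bound_multiples_K1 F_subset_K1] e(1) ei)
  then show ?thesis by simp
qed

lemma isotropy_bound_multiples_K2_K2:
  "\<sigma> e = e \<Longrightarrow> e \<in> Q \<Longrightarrow> isotropy_bound K2 (multiples K2 e) (9 * u)"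
  by (rule isotropy_bound_mono[OF isotropy_bound_multiples_K2 K1_subset_K2])

lemma skew_mult_K2:
  assumes k: "k \<in> Q" "\<sigma> k = k" and w: "w \<in> Q" "\<sigma> w = w" "w * k = - (k * w)" and d: "d \<in> K2"
  shows "\<sigma> (k * d * w) = - (k * d * w)"
proof -
  have "\<sigma> (k * d * w) = w * (d * k)" using k(2) w(2) J_K2[OF d] by (simp add: J_mult)
  also have "\<dots> = w * k * d" using K2_commutes[OF d k(1)] by (simp add: mult.assoc)
  also have "\<dots> = - (k * d * w)" unfolding w(3) using K2_commutes[OF d w(1)] by (simp add: mult.assoc)
  finally show ?thesis .
qed

lemma isotropy_bound_Q: "isotropy_bound Q Q (45 * u)"
proof -
  obtain k w where k: "k \<in> Q" "k \<notin> K2" "k * k \<in> K2" "\<sigma> k = k"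
    and w: "w \<in> Q" "w \<noteq> 0" "\<sigma> w = w" "w * k = - (k * w)" by (rule orthogonal_basisE)
  have one: "1 \<in> Q" by (rule division_subring_one[OF division_subring_Q])
  let ?K = "K3 k"
  note K = division_subring_K3[OF k(1-3)] F_subset_K3[OF k(1-3)] K2_subset_K3[OF k(1-3)] q_mem_K3[OF k(1-3)]
  have "isotropy_bound K2 (multiples ?K 1) (9 * u + 2 * (9 * u))"
  proof (rule isotropy_bound_extension[OF division_subring_K2 F_subset_K2 J_one conjugates_into_K2[OF one order_refl]])
    show "k * b = b * k" if "b \<in> K2" for b using K2_commutes[OF that k(1)] by simp
    show "isotropy_bound K2 (multiples K2 1) (9 * u)" by (rule isotropy_bound_multiples_K2_K2[OF J_one one])
    show "isotropy_bound K2 (multiples K2 (k * 1)) (9 * u)" using isotropy_bound_multiples_K2_K2[OF k(4,1)] by simp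
  qed
  then have "isotropy_bound ?K (multiples ?K 1) (27 * u)" by (intro isotropy_bound_mono[OF _ K(3)]) simp
  moreover have "conjugates_into 1 ?K ?K"
    by (rule conjugates_into_extension[OF K(1) conjugates_into_K2[OF one K(3)] K(4)]) (simp add: k(4))
  ultimately have "isotropy_bound ?K (multiples ?K 1 \<union> multiples K2 w) (27 * u + 2 * (9 * u))"
    by (intro isotropy_bound_compose[OF K(1,2) J_one _ _ isotropy_bound_multiples_K2_K2[OF w(3,1)] K(3)])
  moreover have "?K \<subseteq> Q" by (rule extension_least[OF division_subring_Q K2_subset_Q k(1)])
  ultimately have "isotropy_bound Q Q (27 * u + 2 * (9 * u))"
  proof (rule isotropy_bound_closure)
    fix v assume v: "v \<in> V" "multiples ?K 1 \<union> multiples K2 w \<subseteq> null_scalars v"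
    show "Q \<subseteq> null_scalars v"
    proof
      fix y assume "y \<in> Q"
      then obtain a b c d where y: "a \<in> K2" "b \<in> K2" "c \<in> K2" "d \<in> K2" "y = a + k * b + (c + k * d) * w"
        by (rule quaternion_decompositionE[OF k(1-3) w(1,2,4)])
      have ab: "a + k * b \<in> null_scalars v" using v(2) adjoinI[OF y(1,2)] by auto
      have cw: "c * w \<in> null_scalars v" using v(2) multiplesI[OF y(3)] by blast
      have "k * d * w \<in> null_scalars v"
        by (rule null_scalars_skew[OF v(1) skew_mult_K2[OF k(1,4) w(1,3,4) y(4)]])
      then have "(a + k * b) + (c * w + k * d * w) \<in> null_scalars v"
        by (rule null_scalars_add[OF v(1) ab null_scalars_add[OF v(1) cw]])
      then show "y \<in> null_scalars v" unfolding y(5) by (simp add: distrib_right)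
    qed
  qed
  then show ?thesis by simp
qed

end

locale unitary_forms = biquadratic_forms act F \<sigma> V \<beta> u i j
  for act :: "'v::ab_group_add \<Rightarrow> 'd::division_ring \<Rightarrow> 'v" (infixl "\<cdot>" 80) and F :: "'d set" and \<sigma> V \<beta> u i j +
  fixes w q p :: 'd
  assumes w: "\<sigma> w = w" "w * i = i * w" "w * j = - (j * w)"
    and q: "q \<in> Q" "q \<notin> K2" "q * q \<in> K1" "w * \<sigma> q = - (q * w)"
    and p: "p \<in> Q" "p \<noteq> 0" "p * q = - (q * p)" "w * \<sigma> p = - (p * w)" "p * p \<in> K1"
begin

definition e1 :: 'd where "e1 = j * q * w"
definition e2 :: 'd where "e2 = j * p * w"
definition e3 :: 'd where "e3 = q * e2"
definition M :: "'d set" where "M = extension K1 q"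
definition N :: "'d set" where "N = extension M p"

lemmas e_defs = e1_def e2_def e3_def

lemma generators_commute: "q * j = j * q" "q * i = i * q" "p * j = j * p" "p * i = i * p"
  using q(1) p(1) by (simp_all add: Q_iff)

lemma reorder: "q * (j * x) = j * (q * x)" "p * (j * x) = j * (p * x)" "w * (j * x) = - (j * (w * x))"
  "p * (q * x) = - (q * (p * x))" "w * (\<sigma> q * x) = - (q * (w * x))" "w * (\<sigma> p * x) = - (p * (w * x))"
  "q * (i * x) = i * (q * x)" "p * (i * x) = i * (p * x)" "w * (i * x) = i * (w * x)" "j * (i * x) = i * (j * x)"
  using generators_commute w(2,3) p(3,4) q(4) ji by (simp_all flip: mult.assoc)

context
  fixes k assumes k: "k \<in> K1"
begin

lemma K1_commutes_generators: "k * q = q * k" "k * p = p * k" "k * w = w * k" "k * j = j * k"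
  "k * \<sigma> q = \<sigma> q * k" "k * \<sigma> p = \<sigma> p * k"
  using generators_commute w(2) ji J_Q[OF q(1)] J_Q[OF p(1)] by (auto intro: K1_commutes[OF k] simp: Q_iff)

lemma K1_reorder: "k * (q * x) = q * (k * x)" "k * (p * x) = p * (k * x)" "k * (w * x) = w * (k * x)"
  "k * (j * x) = j * (k * x)" "k * (\<sigma> q * x) = \<sigma> q * (k * x)" "k * (\<sigma> p * x) = \<sigma> p * (k * x)"
  using K1_commutes_generators by (simp_all flip: mult.assoc)

lemma skew_products: "\<sigma> (q * k * w) = - (q * k * w)" "\<sigma> (k * p * w) = - (k * p * w)"
  "\<sigma> (q * k * p * w) = - (q * k * p * w)" "\<sigma> (k * (j * w)) = - (k * (j * w))"
  using K1_reorder K1_commutes_generators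
  by (simp_all add: J_mult J_K1[OF k] J_j w mult.assoc reorder q(4) p(4))

end

lemma J_e: "\<sigma> e1 = e1" "\<sigma> e2 = e2" "\<sigma> e3 = e3"
  unfolding e_defs using w(3) by (simp_all add: J_mult J_j w(1) mult.assoc reorder generators_commute)

lemma e_commutes_i: "e1 * i = i * e1" "e2 * i = i * e2" "e3 * i = i * e3"
  unfolding e_defs by (simp_all add: mult.assoc reorder w(2))

lemma division_subring_M: "division_subring M"
  unfolding M_def
proof (rule division_subring_extension[OF division_subring_K1 F_subset_K1 subset_UNIV UNIV_I q(3)])
  show "\<exists>b'\<in>K1. b * q = q * b'" if "b \<in> K1" for b using that K1_commutes_generators(1) by blast
qed

lemma K1_subset_M: "K1 \<subseteq> M" and q_mem_M: "q \<in> M"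
  unfolding M_def by (rule extension_superset extension_new; rule division_subring_K1)+

lemma F_subset_M: "F \<subseteq> M"
  using F_subset_K1 K1_subset_M by blast

lemma division_subring_N: "division_subring N"
  unfolding N_def
proof (rule division_subring_extension[OF division_subring_M F_subset_M subset_UNIV UNIV_I])
  show "p * p \<in> M" using p(5) K1_subset_M by blast
  fix b assume "b \<in> M"
  then obtain a c where b: "b = a + q * c" "a \<in> K1" "c \<in> K1" unfolding M_def by (rule adjoinE)
  have "b * p = p * (a + q * (- c))"
    unfolding b(1) using K1_commutes_generators[OF b(2)] K1_commutes_generators[OF b(3)]
    by (simp add: distrib_right left_diff_distrib right_diff_distrib mult.assoc reorder)
  then show "\<exists>b'\<in>M. b * p = p * b'"
    unfolding M_def using adjoinI[OF b(2) division_subring_minus[OF division_subring_K1 b(3)]] by blast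
qed

lemma M_subset_N: "M \<subseteq> N" and p_mem_N: "p \<in> N"
  unfolding N_def by (rule extension_superset extension_new; rule division_subring_M)+

lemma K1_subset_N: "K1 \<subseteq> N" and F_subset_N: "F \<subseteq> N" and q_mem_N: "q \<in> N"
  using K1_subset_M F_subset_M q_mem_M M_subset_N by auto

lemma N_subset_Q: "N \<subseteq> Q"
  unfolding N_def M_def
  using extension_least[OF division_subring_Q] K1_subset_K2 K2_subset_Q q(1) p(1) by (meson order_trans)

lemma isotropy_bound_K1_K1: "\<sigma> e = e \<Longrightarrow> e * i = i * e \<Longrightarrow> isotropy_bound K1 (multiples K1 e) (3 * u)"
  by (rule isotropy_bound_mono[OF isotropy_bound_multiples_K1 F_subset_K1])

lemma isotropy_bound_M: "isotropy_bound M (multiples M e2) (9 * u)"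
proof -
  have "isotropy_bound K1 (multiples M e2) (3 * u + 2 * (3 * u))"
    unfolding M_def
  proof (rule isotropy_bound_extension[OF division_subring_K1 F_subset_K1 J_e(2) conjugates_into_K1[OF e_commutes_i(2) order_refl]])
    show "q * b = b * q" if "b \<in> K1" for b using K1_commutes_generators(1)[OF that] by simp
    show "isotropy_bound K1 (multiples K1 e2) (3 * u)" by (rule isotropy_bound_K1_K1[OF J_e(2) e_commutes_i(2)])
    show "isotropy_bound K1 (multiples K1 (q * e2)) (3 * u)"
      unfolding e3_def[symmetric] by (rule isotropy_bound_K1_K1[OF J_e(3) e_commutes_i(3)])
  qed
  then show ?thesis using isotropy_bound_mono[OF _ K1_subset_M] by simp
qed

lemma conjugates_into_M: "conjugates_into e2 M M"
proof -
  have "e2 * \<sigma> q = q * e2" unfolding e_defs by (simp add: mult.assoc reorder q(4) p(3))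
  then have "conjugates_into e2 (extension K1 q) M"
    by (rule conjugates_into_extension[OF division_subring_M conjugates_into_K1[OF e_commutes_i(2) K1_subset_M] q_mem_M])
  then show ?thesis by (simp only: M_def)
qed

lemma conjugates_into_N: "conjugates_into e1 N N"
proof -
  have "e1 * \<sigma> q = (- q) * e1" unfolding e_defs by (simp add: mult.assoc reorder q(4))
  then have "conjugates_into e1 (extension K1 q) N"
    by (rule conjugates_into_extension[OF division_subring_N conjugates_into_K1[OF e_commutes_i(1) K1_subset_N]
          division_subring_minus[OF division_subring_N q_mem_N]])
  moreover have "e1 * \<sigma> p = p * e1" unfolding e_defs by (simp add: mult.assoc reorder p(4))
  ultimately have "conjugates_into e1 (extension (extension K1 q) p) N"
    using conjugates_into_extension[OF division_subring_N _ p_mem_N] by blast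
  then show ?thesis by (simp add: N_def M_def)
qed

lemma q_K1_e1_skew:
  assumes b: "b \<in> K1" shows "\<sigma> (q * b * e1) = - (q * b * e1)"
proof -
  have "q * b * e1 = (b * (q * q)) * (j * w)"
    unfolding e1_def using K1_reorder[OF b] by (simp add: mult.assoc reorder)
  then show ?thesis using skew_products(4)[OF division_subring_mult[OF division_subring_K1 b q(3)]] by simp
qed

lemma p_M_e1:
  assumes "m \<in> M" shows "p * m * e1 \<in> multiples M e2"
proof -
  obtain c d where m: "m = c + q * d" "c \<in> K1" "d \<in> K1" using assms unfolding M_def by (rule adjoinE)
  have dq: "d * (q * q) \<in> K1" by (rule division_subring_mult[OF division_subring_K1 m(3) q(3)])
  have "p * m * e1 = (d * (q * q) + q * (- c)) * e2"
    unfolding m(1) e_defs using K1_reorder[OF m(2)] K1_reorder[OF m(3)] K1_commutes_generators[OF m(2)] K1_commutes_generators[OF m(3)]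
    by (simp add: mult.assoc reorder distrib_left distrib_right left_diff_distrib right_diff_distrib)
  moreover have "d * (q * q) + q * (- c) \<in> M"
    unfolding M_def by (rule adjoinI[OF dq division_subring_minus[OF division_subring_K1 m(2)]])
  ultimately show ?thesis using multiplesI by metis
qed

lemma isotropy_bound_N: "isotropy_bound N (multiples N e1) (15 * u)"
proof -
  have "isotropy_bound M (multiples M e2 \<union> multiples K1 e1) (9 * u + 2 * (3 * u))"
    by (rule isotropy_bound_compose[OF division_subring_M F_subset_M J_e(2) conjugates_into_M isotropy_bound_M
          isotropy_bound_K1_K1[OF J_e(1) e_commutes_i(1)] K1_subset_M])
  then have "isotropy_bound N (multiples N e1) (9 * u + 2 * (3 * u))"
  proof (rule isotropy_bound_closure[OF _ M_subset_N])
    fix v assume v: "v \<in> V" "multiples M e2 \<union> multiples K1 e1 \<subseteq> null_scalars v"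
    show "multiples N e1 \<subseteq> null_scalars v"
    proof
      fix y assume "y \<in> multiples N e1"
      then obtain m m' where m: "y = (m + p * m') * e1" "m \<in> M" "m' \<in> M"
        unfolding N_def by (auto elim!: multiplesE adjoinE)
      obtain a b where ab: "m = a + q * b" "a \<in> K1" "b \<in> K1" using m(2) unfolding M_def by (rule adjoinE)
      have "a * e1 + q * b * e1 \<in> null_scalars v"
        by (rule null_scalars_add[OF v(1) _ null_scalars_skew[OF v(1) q_K1_e1_skew[OF ab(3)]]])
          (use v(2) multiplesI[OF ab(2)] in blast)
      moreover have "p * m' * e1 \<in> null_scalars v" using v(2) p_M_e1[OF m(3)] by blast
      ultimately have "a * e1 + q * b * e1 + p * m' * e1 \<in> null_scalars v" by (rule null_scalars_add[OF v(1)])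
      then show "y \<in> null_scalars v" unfolding m(1) ab(1) by (simp add: distrib_right)
    qed
  qed
  then show ?thesis by simp
qed

lemma j_N_w:
  assumes n: "n \<in> N" shows "j * n * w \<in> multiples N e1"
proof -
  have nj: "j * n = n * j" using n N_subset_Q by (auto simp: Q_iff)
  have q0: "q \<noteq> 0" using q_nonzero[OF q(1,2)] q(3) K1_subset_K2 by blast
  have "j * n * w = n * (inverse q * q) * j * w" unfolding nj using q0 by simp
  also have "\<dots> = n * inverse q * e1" unfolding e1_def by (simp only: mult.assoc generators_commute reorder)
  finally show ?thesis
    using multiplesI[OF division_subring_mult[OF division_subring_N n division_subring_inverse[OF division_subring_N q_mem_N]]] by metis
qed

lemma Q_w_decompositionE:
  assumes x: "x \<in> Q"
  obtains a b c d n where "a \<in> K1" "b \<in> K1" "c \<in> K1" "d \<in> K1" "n \<in> N"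
    "x * w = a * w + (q * b * w + (c * p * w + (q * d * p * w + j * n * w)))"
proof -
  have qq: "q * q \<in> K2" using q(3) K1_subset_K2 by blast
  obtain a b c d where K2: "a \<in> K2" "b \<in> K2" "c \<in> K2" "d \<in> K2" and x_eq: "x = a + q * b + (c + q * d) * p"
    by (rule quaternion_decompositionE[OF q(1,2) qq p(1-3) x])
  obtain a1 a2 where a: "a = a1 + j * a2" "a1 \<in> K1" "a2 \<in> K1" using K2(1) unfolding K2_def by (rule adjoinE)
  obtain b1 b2 where b: "b = b1 + j * b2" "b1 \<in> K1" "b2 \<in> K1" using K2(2) unfolding K2_def by (rule adjoinE)
  obtain c1 c2 where c: "c = c1 + j * c2" "c1 \<in> K1" "c2 \<in> K1" using K2(3) unfolding K2_def by (rule adjoinE)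
  obtain d1 d2 where d: "d = d1 + j * d2" "d1 \<in> K1" "d2 \<in> K1" using K2(4) unfolding K2_def by (rule adjoinE)
  define n where "n = a2 + q * b2 + (c2 + q * d2) * p"
  have mem: "a2 \<in> N" "b2 \<in> N" "c2 \<in> N" "d2 \<in> N" using a b c d K1_subset_N by auto
  have "n \<in> N" unfolding n_def using mem q_mem_N p_mem_N division_subring_N by (simp add: division_subring_closed)
  moreover have "x * w = a1 * w + (q * b1 * w + (c1 * p * w + (q * d1 * p * w + j * n * w)))"
    unfolding x_eq a(1) b(1) c(1) d(1) n_def
    by (simp add: mult.assoc reorder distrib_left distrib_right ac_simps)
  ultimately show thesis using that a(2) b(2) c(2) d(2) by blast
qed

lemma isotropy_bound_Q_w: "isotropy_bound Q (multiples Q w) (21 * u)"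
proof -
  have "isotropy_bound N (multiples N e1 \<union> multiples K1 w) (15 * u + 2 * (3 * u))"
    by (rule isotropy_bound_compose[OF division_subring_N F_subset_N J_e(1) conjugates_into_N isotropy_bound_N
          isotropy_bound_multiples_K1[OF w(1,2)] F_subset_N])
  then have "isotropy_bound Q (multiples Q w) (15 * u + 2 * (3 * u))"
  proof (rule isotropy_bound_closure[OF _ N_subset_Q])
    fix v assume v: "v \<in> V" "multiples N e1 \<union> multiples K1 w \<subseteq> null_scalars v"
    show "multiples Q w \<subseteq> null_scalars v"
    proof
      fix y assume "y \<in> multiples Q w"
      then obtain x where x: "x \<in> Q" "y = x * w" by (rule multiplesE)
      obtain a b c d n where xw: "a \<in> K1" "b \<in> K1" "c \<in> K1" "d \<in> K1" "n \<in> N"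
        "x * w = a * w + (q * b * w + (c * p * w + (q * d * p * w + j * n * w)))"
        using Q_w_decompositionE[OF x(1)] .
      have "j * n * w \<in> null_scalars v" and "a * w \<in> null_scalars v"
        using v(2) j_N_w[OF xw(5)] multiplesI[OF xw(1)] by blast+
      moreover have "q * b * w \<in> null_scalars v" "c * p * w \<in> null_scalars v" "q * d * p * w \<in> null_scalars v"
        by (rule null_scalars_skew[OF v(1) skew_products(1)[OF xw(2)]] null_scalars_skew[OF v(1) skew_products(2)[OF xw(3)]]
            null_scalars_skew[OF v(1) skew_products(3)[OF xw(4)]])+
      ultimately show "y \<in> null_scalars v" unfolding x(2) xw(6) by (intro null_scalars_add[OF v(1)])
    qed
  qed
  then show ?thesis by simp
qed

end

context biquadratic_forms
begin

lemma isotropy_bound_multiples_Q: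
  assumes w: "w \<noteq> 0" "\<sigma> w = w" "w * i = i * w" "w * j = - (j * w)"
  shows "isotropy_bound Q (multiples Q w) (21 * u)"
proof -
  obtain q p where "q \<in> Q" "q \<notin> K2" "q * q \<in> K1" "w * \<sigma> q = - (q * w)"
    "p \<in> Q" "p \<noteq> 0" "p * q = - (q * p)" "w * \<sigma> p = - (p * w)" "p * p \<in> K1"
    using unitary_basisE[OF w] .
  then interpret unitary_forms act F \<sigma> V \<beta> u i j w q p by unfold_locales (use w in auto)
  show ?thesis by (rule isotropy_bound_Q_w)
qed

lemma conjugates_into_Q:
  assumes w: "w \<noteq> 0" "w * i = i * w \<or> w * i = - (i * w)" "w * j = j * w \<or> w * j = - (j * w)"
  shows "conjugates_into w Q Q"
  unfolding conjugates_into_def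
proof
  fix b assume b: "b \<in> Q"
  have commutes: "w * \<sigma> b * inverse w * a = a * (w * \<sigma> b * inverse w)"
    if "\<sigma> b * a = a * \<sigma> b" "w * a = a * w \<or> w * a = - (a * w)" for a
  proof (rule quotient_commutes[OF w(1)])
    have eq: "w * \<sigma> b * a = w * a * \<sigma> b" using that(1) by (simp add: mult.assoc)
    from that(2) show "w * \<sigma> b * a = a * (w * \<sigma> b) \<and> w * a = a * w \<or> w * \<sigma> b * a = - (a * (w * \<sigma> b)) \<and> w * a = - (a * w)"
    proof
      assume wa: "w * a = a * w"
      have "w * \<sigma> b * a = a * (w * \<sigma> b)" using eq unfolding wa by (simp only: mult.assoc)
      then show ?thesis using wa by blast
    next
      assume wa: "w * a = - (a * w)"
      have "w * \<sigma> b * a = - (a * (w * \<sigma> b))" using eq unfolding wa by (simp only: mult.assoc mult_minus_left)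
      then show ?thesis using wa by blast
    qed
  qed
  have "w * \<sigma> b * inverse w \<in> Q" using J_Q[OF b] commutes w(2,3) unfolding Q_iff by blast
  moreover have "w * \<sigma> b = w * \<sigma> b * inverse w * w" using w(1) by (simp add: mult.assoc)
  ultimately show "\<exists>b'\<in>Q. w * \<sigma> b = b' * w" by blast
qed

lemma conjugates_into_Cent: "conjugates_into 1 (Cent {i}) (Cent {i})"
  unfolding conjugates_into_def using J_Cent by simp

text \<open>Under conjugation by \<open>i\<close> and \<open>j\<close>, the algebra is graded by sign pairs as \<open>Q + Q w1 + Q w2 + Q w3\<close>;
  the first two summands make up the centralizer of \<open>i\<close>.\<close>

context
  fixes w1 w2 w3
  assumes w1: "w1 \<noteq> 0" "\<sigma> w1 = w1" "w1 * i = i * w1" "w1 * j = - (j * w1)"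
    and w2: "w2 \<noteq> 0" "\<sigma> w2 = w2" "w2 * i = - (i * w2)" "w2 * j = j * w2"
    and w3: "w3 \<noteq> 0" "\<sigma> w3 = w3" "w3 * i = - (i * w3)" "w3 * j = - (j * w3)"
begin

lemma grading_decompositionE:
  obtains c a b where "c \<in> Cent {i}" "a \<in> Q" "b \<in> Q" "x = c + (a * w2 + b * w3)"
proof -
  obtain c e where ce: "c \<in> Cent {i}" "e \<in> Cent {i}" "x = c + e * w2"
    using commuting_decomposition[OF D E_sub order_refl dim_D UNIV_I i_props(3) F_commutes[OF i_props(2)] UNIV_I w2(1,3) UNIV_I] .
  obtain a b where ab: "a \<in> Q" "b \<in> Q" "e = a + b * w1"
    using Cent_decompositionE[OF w1(1,3,4), of e] ce(2) by (auto simp: centralizer_iff)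
  have w12i: "w1 * w2 * i = - (i * (w1 * w2))"
  proof -
    have "w1 * w2 * i = - (w1 * i * w2)" using w2(3) by (simp add: mult.assoc)
    then show ?thesis unfolding w1(3) by (simp add: mult.assoc)
  qed
  have w12j: "w1 * w2 * j = - (j * (w1 * w2))"
  proof -
    have "w1 * w2 * j = w1 * j * w2" using w2(4) by (simp add: mult.assoc)
    then show ?thesis unfolding w1(4) by (simp add: mult.assoc)
  qed
  have "w1 * w2 * inverse w3 \<in> Q"
    unfolding Q_iff using quotient_commutes[OF w3(1)] w12i w12j w3(3,4) by blast
  then have "b * (w1 * w2 * inverse w3) \<in> Q" by (rule division_subring_mult[OF division_subring_Q ab(2)])
  moreover have "x = c + (a * w2 + b * (w1 * w2 * inverse w3) * w3)"
    unfolding ce(3) ab(3) using w3(1) by (simp add: distrib_right mult.assoc)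
  ultimately show thesis using that ce(1) ab(1) by blast
qed

lemma isotropy_bound_Cent: "isotropy_bound (Cent {i}) (Cent {i}) (87 * u)"
proof -
  have one: "conjugates_into 1 Q Q" by (rule conjugates_into_Q) auto
  have "isotropy_bound Q (multiples Q 1) (45 * u)" using isotropy_bound_Q by simp
  then have "isotropy_bound Q (multiples Q 1 \<union> multiples Q w1) (45 * u + 2 * (21 * u))"
    by (rule isotropy_bound_compose[OF division_subring_Q F_subset_Q J_one one _ isotropy_bound_multiples_Q[OF w1] order_refl])
  then have "isotropy_bound (Cent {i}) (Cent {i}) (45 * u + 2 * (21 * u))"
  proof (rule isotropy_bound_closure)
    show "Q \<subseteq> Cent {i}" by (auto simp: Q_iff centralizer_iff)
    fix v assume v: "v \<in> V" "multiples Q 1 \<union> multiples Q w1 \<subseteq> null_scalars v"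
    show "Cent {i} \<subseteq> null_scalars v"
    proof
      fix y assume "y \<in> Cent {i}"
      then have "y * i = i * y" by (simp add: centralizer_iff)
      then obtain c d where y: "c \<in> Q" "d \<in> Q" "y = c + d * w1" by (rule Cent_decompositionE[OF w1(1,3,4)])
      have "c \<in> null_scalars v" "d * w1 \<in> null_scalars v" using v(2) y(1) multiplesI[OF y(2)] by auto
      then show "y \<in> null_scalars v" unfolding y(3) by (rule null_scalars_add[OF v(1)])
    qed
  qed
  then show ?thesis by simp
qed

lemma isotropy_bound_complement:
  assumes "isotropy_bound Q (multiples Q w2) (21 * u)" "isotropy_bound Q (multiples Q w3) (21 * u)"
  shows "isotropy_bound (Cent {i}) (multiples Q w2 \<union> multiples Q w3) (63 * u)"
proof -
  have "conjugates_into w2 Q Q" by (rule conjugates_into_Q) (use w2 in auto)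
  then have "isotropy_bound Q (multiples Q w2 \<union> multiples Q w3) (21 * u + 2 * (21 * u))"
    by (rule isotropy_bound_compose[OF division_subring_Q F_subset_Q w2(2) _ assms order_refl])
  moreover have "Q \<subseteq> Cent {i}" by (auto simp: Q_iff centralizer_iff)
  ultimately show ?thesis using isotropy_bound_mono by simp
qed

lemma common_isotropic_vector:
  assumes bounds: "isotropy_bound Q (multiples Q w2) (21 * u)" "isotropy_bound Q (multiples Q w3) (21 * u)"
    and V: "has_dim (\<cdot>) F (64 * n) V" and n: "87 * u div 64 + 63 * u div 32 < n"
  shows "\<exists>v\<in>V. v \<noteq> 0 \<and> null_scalars v = UNIV"
proof -
  let ?C = "Cent {i}"
  have "isotropy_bound ?C (multiples ?C 1) (87 * u)" using isotropy_bound_Cent by simp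
  then obtain T d where T: "T \<subseteq> V" "subspace_over (\<cdot>) ?C T" "has_dim (\<cdot>) F d T" "64 * n \<le> 87 * u + 2 * d"
    "\<And>v. v \<in> T \<Longrightarrow> multiples ?C 1 \<subseteq> null_scalars v"
    by (rule isotropic_subspaceE[OF division_subring_Cent F_subset_Cent J_one conjugates_into_Cent _ order_refl
          subspace_over_mono[OF subspace_V subset_UNIV] V]) (rule that)
  obtain t where t: "has_dim (\<cdot>) ?C t T"
    using has_dim_extend_scalarsE[OF E T(3) division_subring_Cent F_subset_Cent T(2)] .
  have d: "d = 32 * t"
    using has_dim_unique[OF E T(3) has_dim_tower[OF E has_dim_Cent_square_central[OF i] division_subring_Cent F_subset_Cent t]] by simp
  have "63 * u < d"
  proof (rule ccontr)
    assume "\<not> ?thesis"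
    then have "t * 32 \<le> 63 * u" "(n - t) * 64 \<le> 87 * u" using d T(4) by auto
    then have "t \<le> 63 * u div 32" "n - t \<le> 87 * u div 64" by (simp_all add: less_eq_div_iff_mult_less_eq)
    then show False using n by linarith
  qed
  then obtain v where v: "v \<in> T" "v \<noteq> 0" "multiples Q w2 \<union> multiples Q w3 \<subseteq> null_scalars v"
    using isotropy_boundE[OF isotropy_bound_complement[OF bounds] T(1-3)] by blast
  have vV: "v \<in> V" using v(1) T(1) by blast
  have "x \<in> null_scalars v" for x
  proof -
    obtain c a b where x: "c \<in> ?C" "a \<in> Q" "b \<in> Q" "x = c + (a * w2 + b * w3)" using grading_decompositionE .
    have "c \<in> null_scalars v" "a * w2 \<in> null_scalars v" "b * w3 \<in> null_scalars v"
      using T(5)[OF v(1)] v(3) x(1) multiplesI[OF x(2)] multiplesI[OF x(3)] by auto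
    then show ?thesis unfolding x(4) by (intro null_scalars_add[OF vV])
  qed
  then show ?thesis using v(2) vV by blast
qed

end

theorem common_isotropic:
  assumes "has_dim (\<cdot>) F (64 * n) V" "87 * u div 64 + 63 * u div 32 < n"
  shows "\<exists>v\<in>V. v \<noteq> 0 \<and> null_scalars v = UNIV"
proof -
  interpret swap: biquadratic_sym F \<sigma> j i by (rule biquadratic_sym_swap)
  interpret mult: biquadratic_sym F \<sigma> "i * j" i by (rule biquadratic_sym_mult)
  interpret swap: biquadratic_forms act F \<sigma> V \<beta> u j i ..
  interpret mult: biquadratic_forms act F \<sigma> V \<beta> u "i * j" i ..
  have commutes_mult_iff: "x * (i * j) = i * j * x \<longleftrightarrow> x * j = j * x" if "x * i = i * x" for x
  proof -
    have "x * (i * j) = i * (x * j)" using that by (metis mult.assoc)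
    then show ?thesis using i_props(3) by (simp add: mult.assoc)
  qed
  have Q_swap: "swap.Q = Q" and Q_mult: "mult.Q = Q"
    using commutes_mult_iff by (auto simp: swap.Q_iff mult.Q_iff Q_iff)
  obtain w1 where w1: "w1 \<noteq> 0" "\<sigma> w1 = w1" "w1 * i = i * w1" "w1 * j = - (j * w1)" using Sym_anticommuting_with_jE .
  obtain w2 where w2: "w2 \<noteq> 0" "\<sigma> w2 = w2" "w2 * j = j * w2" "w2 * i = - (i * w2)" using swap.Sym_anticommuting_with_jE .
  obtain w3 where w3: "w3 \<noteq> 0" "\<sigma> w3 = w3" "w3 * (i * j) = i * j * w3" "w3 * i = - (i * w3)" using mult.Sym_anticommuting_with_jE .
  have "i * (j * w3) = w3 * i * j" using w3(3) by (simp add: mult.assoc)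
  also have "\<dots> = i * (- (w3 * j))" unfolding w3(4) by (simp add: mult.assoc)
  finally have "j * w3 = - (w3 * j)" using mult_left_cancel[OF i_props(3)] by blast
  then have w3j: "w3 * j = - (j * w3)" by simp
  show ?thesis
    by (rule common_isotropic_vector[OF w1 w2(1,2,4,3) w3(1,2,4) w3j
          swap.isotropy_bound_multiples_Q[OF w2, unfolded Q_swap] mult.isotropy_bound_multiples_Q[OF w3, unfolded Q_mult] assms])
qed

end

section \<open>Hermitian forms\<close>

lemma (in right_module) linear_over_sum:
  assumes W: "subspace_over (\<cdot>) B W" and f: "linear_over (\<cdot>) act' B W f" "f 0 = 0"
    and I: "finite I" "\<And>k. k \<in> I \<Longrightarrow> b k \<in> W \<and> c k \<in> B"
  shows "f (\<Sum>k\<in>I. b k \<cdot> c k) = (\<Sum>k\<in>I. act' (f (b k)) (c k))"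
  using I
proof (induction I rule: finite_induct)
  case (insert k I)
  have mem: "b k \<cdot> c k \<in> W" "(\<Sum>k\<in>I. b k \<cdot> c k) \<in> W"
    using insert.prems subspace_over_act[OF W] by (auto intro!: subspace_over_sum[OF W])
  have "f (\<Sum>k\<in>insert k I. b k \<cdot> c k) = f (b k \<cdot> c k) + f (\<Sum>k\<in>I. b k \<cdot> c k)"
    using insert.hyps linear_over_add[OF f(1) mem] by simp
  then show ?case using insert linear_over_act[OF f(1)] by simp
qed (simp add: f(2))

lemma (in right_module) bilinear_over_sum:
  assumes W: "subspace_over (\<cdot>) B W"
    and left: "\<And>w. w \<in> W \<Longrightarrow> linear_over (\<cdot>) (*) B W (\<lambda>v. g v w)"
    and right: "\<And>v. v \<in> W \<Longrightarrow> linear_over (\<cdot>) (*) B W (g v)"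
    and I: "finite I" "\<And>k. k \<in> I \<Longrightarrow> b k \<in> W \<and> c k \<in> B"
  shows "g (\<Sum>k\<in>I. b k \<cdot> c k) (\<Sum>k\<in>I. b k \<cdot> c k) = (\<Sum>k\<in>I. \<Sum>l\<in>I. g (b k) (b l) * c l * c k)"
proof -
  let ?v = "\<Sum>k\<in>I. b k \<cdot> c k"
  have v: "?v \<in> W" using I(2) by (intro subspace_over_sum[OF W] subspace_over_act[OF W]) auto
  have "g ?v ?v = (\<Sum>k\<in>I. g (b k) ?v * c k)"
    by (rule linear_over_sum[OF W left[OF v] linear_over_zero[OF left[OF v] W] I])
  also have "\<dots> = (\<Sum>k\<in>I. (\<Sum>l\<in>I. g (b k) (b l) * c l) * c k)"
  proof (rule sum.cong[OF refl])
    fix k assume "k \<in> I"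
    then have k: "b k \<in> W" using I(2) by blast
    have "g (b k) ?v = (\<Sum>l\<in>I. g (b k) (b l) * c l)"
      by (rule linear_over_sum[OF W right[OF k] linear_over_zero[OF right[OF k] W] I])
    then show "g (b k) ?v * c k = (\<Sum>l\<in>I. g (b k) (b l) * c l) * c k" by simp
  qed
  finally show ?thesis by (simp add: sum_distrib_right)
qed

context split_orthogonal_algebra
begin

lemma isotropic_vector:
  assumes u: "u_inv TYPE('a) = enat u" and "right_module act" and m: "has_dim act F m W" "u < m"
    and mem: "\<And>v w. v \<in> W \<Longrightarrow> w \<in> W \<Longrightarrow> g v w \<in> F"
    and left: "\<And>w. w \<in> W \<Longrightarrow> linear_over act (*) F W (\<lambda>v. g v w)"
    and right: "\<And>v. v \<in> W \<Longrightarrow> linear_over act (*) F W (g v)"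
  shows "\<exists>v\<in>W. v \<noteq> 0 \<and> g v v = 0"
proof -
  interpret V: right_module act by fact
  note W = V.has_dim_subspace[OF m(1) E]
  obtain b where b: "independent_family act F m b" "\<And>k. k < m \<Longrightarrow> b k \<in> W"
    using V.has_dim_basisE[OF E m(1)] by metis
  have "\<forall>k l. \<exists>x. k < m \<longrightarrow> l < m \<longrightarrow> g (b k) (b l) = \<iota> x" using mem b(2) by blast
  then obtain a where a: "\<And>k l. k < m \<Longrightarrow> l < m \<Longrightarrow> g (b k) (b l) = \<iota> (a k l)" by metis
  have "\<not> anisotropic_qf m a"
  proof
    assume "anisotropic_qf m a"
    then have "enat m \<le> u_inv TYPE('a)" unfolding u_inv_def by (intro Sup_upper) blast
    then show False using u m(2) by simp
  qed
  then obtain x where x: "qf_eval m a x = 0" "\<exists>k<m. x k \<noteq> 0" unfolding anisotropic_qf_def by blast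
  define v where "v = (\<Sum>k<m. act (b k) (\<iota> (x k)))"
  have vW: "v \<in> W" unfolding v_def using b(2) by (intro subspace_over_sum[OF W] subspace_over_act[OF W]) auto
  have "v \<noteq> 0"
  proof
    assume "v = 0"
    then have "\<iota> (x k) = 0" if "k < m" for k
      using independent_familyD[OF b(1), of "\<lambda>k. \<iota> (x k)"] that unfolding v_def by blast
    then show False using x(2) iota.hom_eq_0_iff by blast
  qed
  moreover have "g v v = 0"
  proof -
    have "g v v = (\<Sum>k<m. \<Sum>l<m. g (b k) (b l) * \<iota> (x l) * \<iota> (x k))"
      unfolding v_def by (rule V.bilinear_over_sum[OF W left right]) (use b(2) in auto)
    also have "\<dots> = (\<Sum>k<m. \<Sum>l<m. \<iota> (a k l * x k * x l))"
      by (intro sum.cong refl) (simp add: a ac_simps flip: iota.hom_mult)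
    also have "\<dots> = \<iota> (qf_eval m a x)" unfolding qf_eval_def by (simp add: iota.hom_sum)
    finally show ?thesis using x(1) by (simp add: iota.hom_zero)
  qed
  ultimately show ?thesis using vW by blast
qed

sublocale division_algebra_64_inv F \<gamma>
  by unfold_locales

lemma biquadratic_symE:
  obtains e i j where "e \<noteq> 0" "\<gamma> e = e" "biquadratic_sym F (\<lambda>d. e * \<gamma> d * inverse e) i j"
proof -
  obtain i where i: "square_central i" using ex_square_central by blast
  obtain j where j: "j * i = i * j" "j \<notin> extension F i" "j * j \<in> F" using second_square_central[OF i] .
  interpret biquadratic_inv F \<gamma> i j by unfold_locales (fact i j)+
  obtain e where e: "e \<noteq> 0" "\<gamma> e = e" "e * \<gamma> i = i * e" "e * \<gamma> j = j * e" using conjugating_SymE .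
  define \<sigma> where "\<sigma> = (\<lambda>d. e * \<gamma> d * inverse e)"
  interpret S: division_algebra_64_inv F \<sigma> unfolding \<sigma>_def by (rule conjugate_involution) (use e in auto)
  have "36 \<le> s" if s: "has_dim (*) F s S.Sym" for s
  proof -
    obtain r p where r: "has_dim (*) F r Sym" "has_dim (*) F p Skew" "r + p = 64" using has_dim_Sym_SkewE .
    have "has_dim (*) F r ((*) e ` Sym)"
      by (rule ring.has_dim_image[OF E r(1) right_module_times]) (use e(1) in \<open>auto simp: linear_over_def distrib_left mult.assoc\<close>)
    moreover have "\<sigma> (e * x) = e * x" if "\<gamma> x = x" for x
      unfolding \<sigma>_def using e(1,2) that by (simp add: J_mult mult.assoc)
    then have "(*) e ` Sym \<subseteq> S.Sym" by (auto simp: S.Sym_iff Sym_iff)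
    ultimately have "r \<le> s" using ring.has_dim_mono[OF E s] by blast
    then show ?thesis using dim_Skew_le[OF r(2)] r(3) by linarith
  qed
  moreover have "\<sigma> i = i" "\<sigma> j = j" unfolding \<sigma>_def e(3,4) using e(1) by (simp_all add: mult.assoc)
  ultimately have "biquadratic_sym F \<sigma> i j" by unfold_locales
  then show thesis using that e(1,2) unfolding \<sigma>_def by blast
qed

lemma Dspace_eq: "Dspace n = coordinate_space (UNIV :: 'd set) n"
  by (simp add: Dspace_def coordinate_space_def)

lemma subspace_Dspace: "subspace_over pointwise_act UNIV (Dspace n :: (nat \<Rightarrow> 'd) set)"
  by (auto simp: subspace_over_def Dspace_def pointwise_act_def)

lemma has_dim_Dspace: "has_dim pointwise_act F (64 * n) (Dspace n :: (nat \<Rightarrow> 'd) set)"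
  unfolding Dspace_eq
  by (rule right_module.has_dim_tower[OF right_module_pointwise_act E dim_D D subset_UNIV has_dim_coordinate_space[OF D]])

context
  fixes n h e l u
  assumes h: "anisotropic_hermitian \<gamma> n h" and e: "e \<noteq> 0" "\<gamma> e = e"
    and l: "invariant_trace l" and u: "u_inv TYPE('a) = enat u"
begin

lemmas trace_rules = invariant_traceD[OF l]

lemma hermitian_add:
  assumes "v \<in> Dspace n" "v' \<in> Dspace n" "w \<in> Dspace n"
  shows "h (v + v') w = h v w + h v' w" "h w (v + v') = h w v + h w v'"
  using h assms unfolding anisotropic_hermitian_def hermitian_form_def plus_fun_def by blast+

lemma hermitian_act:
  assumes "v \<in> Dspace n" "w \<in> Dspace n"
  shows "h (pointwise_act v a) w = \<gamma> a * h v w" "h v (pointwise_act w b) = h v w * b"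
proof -
  have act: "h (\<lambda>i. v i * a) (\<lambda>i. w i * b) = \<gamma> a * h v w * b" for a b
    using h assms unfolding anisotropic_hermitian_def hermitian_form_def by blast
  show "h (pointwise_act v a) w = \<gamma> a * h v w" "h v (pointwise_act w b) = h v w * b"
    using act[of a 1] act[of 1 b] by (simp_all add: J_one pointwise_act_def)
qed

lemma trace_form_linear:
  assumes w: "w \<in> Dspace n"
  shows "linear_over pointwise_act (*) F (Dspace n) (\<lambda>v. l (x * h v w))"
    and "linear_over pointwise_act (*) F (Dspace n) (\<lambda>v. l (x * h w v))"
proof -
  note l_add = linear_over_add[OF trace_rules(1) UNIV_I UNIV_I] and l_act = linear_over_act[OF trace_rules(1) UNIV_I]
  show "linear_over pointwise_act (*) F (Dspace n) (\<lambda>v. l (x * h w v))"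
    unfolding linear_over_def
    using w by (simp add: hermitian_add hermitian_act distrib_left l_add l_act flip: mult.assoc)
  show "linear_over pointwise_act (*) F (Dspace n) (\<lambda>v. l (x * h v w))"
    unfolding linear_over_def
  proof (intro conjI ballI)
    fix v :: "nat \<Rightarrow> 'd" and c assume v: "v \<in> Dspace n" and c: "c \<in> F"
    have "x * h (pointwise_act v c) w = x * h v w * c"
      unfolding hermitian_act(1)[OF v w] J_E[OF c] F_commutes[OF c, of "h v w"] by (simp add: mult.assoc)
    then show "l (x * h (pointwise_act v c) w) = l (x * h v w) * c" using l_act[OF c] by simp
  qed (use w in \<open>simp add: hermitian_add distrib_left l_add\<close>)
qed

lemma trace_form_isotropic:
  assumes W: "W \<subseteq> Dspace n" "has_dim pointwise_act F m W" "u < m"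
  shows "\<exists>v\<in>W. v \<noteq> 0 \<and> l (x * h v v) = 0"
proof (rule isotropic_vector[where g = "\<lambda>v w. l (x * h v w)", OF u right_module_pointwise_act W(2,3)])
  show "l (x * h v w) \<in> F" for v w using trace_rules(2) by blast
  fix w assume "w \<in> W"
  then have "w \<in> Dspace n" using W(1) by blast
  then show "linear_over pointwise_act (*) F W (\<lambda>v. l (x * h v w))" "linear_over pointwise_act (*) F W (\<lambda>v. l (x * h w v))"
    by (rule linear_over_subset[OF trace_form_linear(1) W(1)] linear_over_subset[OF trace_form_linear(2) W(1)])+
qed

lemma hermitian_system_of_forms:
  "system_of_forms pointwise_act F (\<lambda>d. e * \<gamma> d * inverse e) (Dspace n) (\<lambda>v w. l (e * h v w)) u"
proof -
  define \<sigma> where "\<sigma> = (\<lambda>d. e * \<gamma> d * inverse e)"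
  interpret S: division_algebra_64_inv F \<sigma> unfolding \<sigma>_def by (rule conjugate_involution) (use e in auto)
  interpret M: right_module "pointwise_act :: (nat \<Rightarrow> 'd) \<Rightarrow> 'd \<Rightarrow> nat \<Rightarrow> 'd" by (rule right_module_pointwise_act)
  have "system_of_forms pointwise_act F \<sigma> (Dspace n) (\<lambda>v w. l (e * h v w)) u"
  proof
    fix v w :: "nat \<Rightarrow> 'd" assume v: "v \<in> Dspace n" and w: "w \<in> Dspace n"
    show "l (e * h v w) \<in> F" using trace_rules(2) by blast
    show "l (e * h (v + v') w) = l (e * h v w) + l (e * h v' w)" if "v' \<in> Dspace n" for v'
      by (rule linear_over_add[OF trace_form_linear(1)[OF w] v that])
    show "l (e * h v (pointwise_act w c)) = l (e * h v w) * c" if "c \<in> F" for c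
      by (rule linear_over_act[OF trace_form_linear(2)[OF v] w that])
    have "h w v = \<gamma> (h v w)"
      using h v w unfolding anisotropic_hermitian_def hermitian_form_def by blast
    then have "l (e * h w v) = l (\<gamma> (h v w * e))" by (simp add: J_mult e(2))
    then show "l (e * h v w) = l (e * h w v)" using trace_rules(3)[of e "h v w"] by (simp add: trace_rules(4))
    fix d
    have "l (e * h v (pointwise_act w (\<sigma> d))) = l ((e * h v w * e * \<gamma> d) * inverse e)"
      unfolding hermitian_act(2)[OF v w] \<sigma>_def by (simp add: mult.assoc)
    also have "\<dots> = l (inverse e * (e * h v w * e * \<gamma> d))" by (rule trace_rules(3))
    also have "\<dots> = l (h v w * (e * \<gamma> d))" using e(1) by (simp flip: mult.assoc)
    also have "\<dots> = l (e * \<gamma> d * h v w)" by (rule trace_rules(3))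
    finally show "l (e * h (pointwise_act v d) w) = l (e * h v (pointwise_act w (\<sigma> d)))"
      unfolding hermitian_act(1)[OF v w] by (simp add: mult.assoc)
  next
    fix s W m assume W: "W \<subseteq> Dspace n" "has_dim pointwise_act F m W" "u < m"
    have "l (e * h (pointwise_act v s) v) = l (e * \<gamma> s * h v v)" if "v \<in> W" for v
      using hermitian_act(1)[of v v s] that W(1) by (auto simp: mult.assoc)
    then show "\<exists>v\<in>W. v \<noteq> 0 \<and> l (e * h (pointwise_act v s) v) = 0"
      using trace_form_isotropic[OF W, of "e * \<gamma> s"] by auto
  qed (rule subspace_Dspace)
  then show ?thesis unfolding \<sigma>_def .
qed

lemma ex_trace_form_nonzero:
  assumes v: "v \<in> Dspace n" "v \<noteq> 0"
  shows "\<exists>x. l (e * h (pointwise_act v x) v) \<noteq> 0"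
proof -
  have "h v v \<noteq> 0" using h v unfolding anisotropic_hermitian_def zero_fun_def by blast
  moreover obtain y where y: "l y \<noteq> 0" using trace_rules(5) by blast
  let ?x = "\<gamma> (inverse e * y * inverse (h v v))"
  have "e * h (pointwise_act v ?x) v = e * (inverse e * y * inverse (h v v) * h v v)"
    unfolding hermitian_act(1)[OF v(1,1)] by (simp only: J_J UNIV_I)
  ultimately have "e * h (pointwise_act v ?x) v = y" using e(1) by (simp add: mult.assoc) (simp flip: mult.assoc)
  then show ?thesis using y by metis
qed

end

theorem anisotropic_rank_bound:
  assumes u: "u_inv TYPE('a) = enat u" and h: "anisotropic_hermitian \<gamma> n h"
  shows "n \<le> 87 * u div 64 + 63 * u div 32"
proof (rule ccontr)
  assume n: "\<not> ?thesis"
  obtain e i j where e: "e \<noteq> 0" "\<gamma> e = e" and ij: "biquadratic_sym F (\<lambda>d. e * \<gamma> d * inverse e) i j"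
    using biquadratic_symE .
  obtain l where l: "invariant_trace l" using ex_invariant_trace by blast
  interpret forms: biquadratic_forms pointwise_act F "\<lambda>d. e * \<gamma> d * inverse e" "Dspace n" "\<lambda>v w. l (e * h v w)" u i j
    by (rule biquadratic_forms.intro[OF hermitian_system_of_forms[OF h e l u] ij])
  obtain v where v: "v \<in> Dspace n" "v \<noteq> 0" "forms.null_scalars v = UNIV"
    using forms.common_isotropic[OF has_dim_Dspace] n by auto
  then show False using ex_trace_form_nonzero[OF h e l u v(1,2)] by (auto simp: forms.null_scalars_def)
qed

end

theorem theorem6p1:
  fixes \<iota> :: "'a::field \<Rightarrow> 'd::division_ring"
    and \<gamma> :: "'d \<Rightarrow> 'd"
    and \<kappa> :: "'a \<Rightarrow> 'k::field"
    and \<phi> :: "'d \<Rightarrow> 'k^8^8"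
    and u :: nat
  assumes nonreal: "nonreal_field TYPE('a)"
    and char: "(2::'a) \<noteq> 0"
    and u_fin: "u_inv TYPE('a) = enat u"
    and D: "central_division_algebra_deg8 \<iota>"
    and inv: "F_linear_involution \<iota> \<gamma>"
    and split: "splitting_deg8 \<iota> \<kappa> \<phi>"
    and orth: "orthogonal_wrt \<phi> \<gamma>"
  shows "u_plus \<gamma> \<le> enat (nat \<lfloor>87/64 * real u\<rfloor> + nat \<lfloor>63/32 * real u\<rfloor>)
    \<and> real_of_int (\<lfloor>87/64 * real u\<rfloor> + \<lfloor>63/32 * real u\<rfloor>) \<le> 213/64 * real u"
proof
  interpret split_orthogonal_algebra \<iota> \<gamma> \<kappa> \<phi> by unfold_locales fact+
  have "87/64 * real u = real (87 * u) / real 64" "63/32 * real u = real (63 * u) / real 32" by simp_all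
  then have floors: "\<lfloor>87/64 * real u\<rfloor> = int (87 * u div 64)" "\<lfloor>63/32 * real u\<rfloor> = int (63 * u div 32)"
    by (simp_all only: floor_divide_of_nat_eq)
  show "u_plus \<gamma> \<le> enat (nat \<lfloor>87/64 * real u\<rfloor> + nat \<lfloor>63/32 * real u\<rfloor>)"
    unfolding u_plus_def floors
  proof (rule Sup_least)
    fix x assume "x \<in> {enat n | n. \<exists>h. anisotropic_hermitian \<gamma> n h}"
    then obtain n h where "x = enat n" "anisotropic_hermitian \<gamma> n h" by blast
    then show "x \<le> enat (nat (int (87 * u div 64)) + nat (int (63 * u div 32)))"
      using anisotropic_rank_bound[OF u_fin] by simp
  qed
  have "\<lfloor>87/64 * real u\<rfloor> \<le> 87/64 * real u" "\<lfloor>63/32 * real u\<rfloor> \<le> 63/32 * real u" by (rule of_int_floor_le)+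
  then show "real_of_int (\<lfloor>87/64 * real u\<rfloor> + \<lfloor>63/32 * real u\<rfloor>) \<le> 213/64 * real u" by simp
qed

end
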